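(* Let $q$ be a fixed prime power with $q\equiv 1 \pmod 4$, and let $k$ be a fixed even natural number. Let $n=2g+1$ or $n=2g+2$, where $g\ge 1$ is an integer. Then \[ \frac{1}{|\mathcal{P}_{n}|}\sum_{P\in\mathcal{P}_{n}}L\left(\tfrac{1}{2},\chi_P\right)^k \gg_k (\log_q|P|)^{\frac{k(k+1)}{2}}, \] where $|P|=q^{n}$ for $P\in\mathcal{P}_n$, i.e. there is a constant $c>0$ depending on $k$ (and $q$) such that the left side is at least $c\,n^{k(k+1)/2}$ for all sufficiently large $g$.
   Context: $\mathbb{A}=\mathbb{F}_q[T]$. For nonzero $f\in\mathbb{A}$, $|f|=q^{\deg f}$. $\mathcal{P}_n$ denotes the set of monic irreducible polynomials of degree $n$ in $\mathbb{A}$. For a monic irreducible $P$, $\chi_P$ is the quadratic character given by the quadratic residue symbol modulo $P$: for $f\in\mathbb{A}$, $\chi_P(f)=0$ if $P\mid f$, $\chi_P(f)=1$ if $P\nmid f$ and $f$ is a square modulo $P$, and $\chi_P(f)=-1$ otherwise (for $q\equiv 1\pmod 4$ and monic arguments this coincides with the symbol $\left(\frac{P}{f}\right)$ by quadratic reciprocity). The Dirichlet $L$-function is $L(s,\chi_P)=\sum_{f\text{ monic}}\chi_P(f)|f|^{-s}$, which is a polynomial in $q^{-s}$ (of degree less than $\deg P$), so $L(\tfrac12,\chi_P)$ is a well-defined real number. *)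

theory Defs
  imports "HOL-Computational_Algebra.Computational_Algebra"
begin

definition monic_deg :: "nat \<Rightarrow> ('a::{field,finite}) poly set" where
  "monic_deg d = {f. degree f = d \<and> lead_coeff f = 1}"

definition monic_irred_deg :: "nat \<Rightarrow> ('a::{field,finite}) poly set" where
  "monic_irred_deg n = {P. degree P = n \<and> lead_coeff P = 1 \<and> irreducible P}"

definition chi :: "('a::{field,finite}) poly \<Rightarrow> 'a poly \<Rightarrow> real" where
  "chi P f = (if P dvd f then 0
              else if (\<exists>h. P dvd (h ^ 2 - f)) then 1 else -1)"

text \<open>L(1/2, chi_P) = sum over monic f of chi_P(f) |f|^(-1/2), summed by degree,
  with |f| = q^(deg f).\<close>
definition L_half :: "('a::{field,finite}) poly \<Rightarrow> real" where
  "L_half P = (\<Sum>d. (\<Sum>f\<in>(monic_deg d :: 'a poly set). chi P f)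
                     / sqrt (real (card (UNIV :: 'a set))) ^ d)"

end

theory Submission
  imports Defs "HOL-Number_Theory.Cong" "HOL-Library.FuncSet" "HOL-Library.Cardinality"
begin

text \<open>The argument follows Rudnick and Soundararajan. Let \<open>A(P)\<close> be the sum of
  \<open>\<chi>\<^sub>P(f) |f|^(-1/2)\<close> over monic \<open>f\<close> of degree at most \<open>x\<close>, a small multiple of \<open>n\<close>. Since
  \<open>L^k \<ge> k B^(k-1) L - (k-1) B^k\<close> for even \<open>k\<close>, taking \<open>B\<close> a small multiple of \<open>A(P)\<close> reduces the
  theorem to a lower bound for the average of \<open>L A^(k-1)\<close> and an upper bound for that of \<open>A^k\<close>.
  The functional equation, proved with Gauss sums evaluated by means of an isotropic subspace,
  writes \<open>L\<close> as a sum over \<open>f\<close> of degree at most \<open>g\<close>. On expanding, the tuples with square product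
  contribute the main term, of order \<open>n^(k(k+1)/2)\<close>: such a tuple is described by one polynomial
  for each unordered pair of indices. All other products are non-squares \<open>f\<close> of degree at most
  \<open>2g\<close>, for which the sum of \<open>\<chi>\<^sub>P(f)\<close> over \<open>P\<close> is \<open>O(q^(n/2))\<close>. This bound comes from Bombieri's
  version of Stepanov's method, carried out in the polynomial ring: an auxiliary polynomial of
  degree about \<open>q^n / 2\<close> is divisible by every \<open>P\<close> of degree \<open>n\<close> with a prescribed value of
  \<open>\<chi>\<^sub>P(f)\<close>.\<close>

text \<open>Write \<open>s = sqrt q\<close>. The monic \<open>f\<close> of degree \<open>d\<close>
  have total weight \<open>q^d / s^d = s^d\<close>, so bounding a sum of length \<open>d\<close>
  term by term costs about \<open>s^d\<close>. Each non-square product contributes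
  \<open>O(q^g)\<close>, while the number of \<open>P\<close> is about \<open>s^(4g) / n\<close>.
  The full \<open>L\<close> has length about \<open>2g\<close>, so its error
  \<open>s^(2g) * s^(2g + (k-1)x)\<close> would swamp the main term. Cutting \<open>L\<close> to
  length \<open>g\<close> lowers the error to \<open>s^(3g + (k-1)x)\<close>, and with
  \<open>k x\<close> at most \<open>g / 2\<close> a positive power of \<open>s\<close> is saved. The
  same cut keeps every product of degree at most \<open>2g\<close>. Since \<open>x\<close> is a
  fixed fraction of \<open>n\<close>, powers of \<open>x\<close> and of \<open>n\<close> differ by
  constants only.

  All sums stay real: a Gauss sum is formed with a real function of mean zero on the field, and a
  single such function for each parity of \<open>n\<close> is enough. Only the order of magnitude of
  the main term matters, so crude coverings and injections replace asymptotics in the count of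
  square tuples.\<close>

section \<open>Polynomials over a finite field\<close>

text \<open>Stated through coefficients, so that this is visibly a vector space; it contains 0 even
  for \<open>n = 0\<close>, where \<open>degree 0 < 0\<close> fails. These spaces serve both as
  residue systems modulo \<open>P\<close> and as the subspaces of the Gauss sum argument.\<close>

definition polys_lt :: "nat \<Rightarrow> 'a::zero poly set" where
  "polys_lt n = {f. \<forall>i\<ge>n. coeff f i = 0}"

lemma polys_lt_iff: "f \<in> polys_lt n \<longleftrightarrow> f = 0 \<or> degree f < n"
proof
  assume f: "f \<in> polys_lt n"
  then have "lead_coeff f = 0" if "\<not> degree f < n"
    using that by (simp add: polys_lt_def)
  then show "f = 0 \<or> degree f < n" by (metis leading_coeff_0_iff)
qed (auto simp: polys_lt_def coeff_eq_0)

lemma polys_lt_0 [simp]: "polys_lt 0 = {0}"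
  by (auto simp: polys_lt_iff)

lemma zero_in_polys_lt [simp]: "0 \<in> polys_lt n"
  by (simp add: polys_lt_def)

lemma polys_lt_add: "f \<in> polys_lt n \<Longrightarrow> g \<in> polys_lt n \<Longrightarrow> f + g \<in> polys_lt n"
  for f :: "'a::comm_monoid_add poly"
  by (simp add: polys_lt_def)

lemma polys_lt_diff: "f \<in> polys_lt n \<Longrightarrow> g \<in> polys_lt n \<Longrightarrow> f - g \<in> polys_lt n"
  for f :: "'a::ab_group_add poly"
  by (simp add: polys_lt_def)

lemma polys_lt_smult: "f \<in> polys_lt n \<Longrightarrow> smult c f \<in> polys_lt n"
  for f :: "'a::comm_semiring_0 poly"
  by (simp add: polys_lt_def)

lemma polys_lt_mono: "f \<in> polys_lt m \<Longrightarrow> m \<le> n \<Longrightarrow> f \<in> polys_lt n"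
  by (auto simp: polys_lt_def)

lemma polys_lt_sum: "(\<And>i. i \<in> A \<Longrightarrow> f i \<in> polys_lt n) \<Longrightarrow> (\<Sum>i\<in>A. f i) \<in> polys_lt n"
  for f :: "'b \<Rightarrow> 'a::comm_monoid_add poly"
  by (induction A rule: infinite_finite_induct) (auto intro: polys_lt_add)

lemma monom_in_polys_lt: "i < n \<Longrightarrow> monom c i \<in> polys_lt n"
  by (auto simp: polys_lt_def)

lemma bij_betw_polys_lt_Suc:
  "bij_betw (\<lambda>(c, f). monom c n + f) (UNIV \<times> polys_lt n) (polys_lt (Suc n) :: 'a::field poly set)"
proof (rule bij_betwI[where g = "\<lambda>f. (coeff f n, f - monom (coeff f n) n)"])
  show "(\<lambda>f. (coeff f n, f - monom (coeff f n) n)) \<in> polys_lt (Suc n) \<rightarrow> UNIV \<times> polys_lt n"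
    by (auto simp: polys_lt_def le_Suc_eq)
qed (auto simp: polys_lt_def)

lemma finite_polys_lt [simp]: "finite (polys_lt n :: 'a::{field,finite} poly set)"
proof (induction n)
  case (Suc n)
  then show ?case
    using bij_betw_finite[OF bij_betw_polys_lt_Suc[of n, where 'a='a]] by simp
qed simp

lemma card_polys_lt: "card (polys_lt n :: 'a::{field,finite} poly set) = CARD('a) ^ n"
proof (induction n)
  case (Suc n)
  then show ?case
    using bij_betw_same_card[OF bij_betw_polys_lt_Suc[of n, where 'a='a]]
    by (simp add: card_cartesian_product)
qed simp

lemma sum_polys_lt_Suc:
  "(\<Sum>f\<in>polys_lt (Suc n). h f) = (\<Sum>c\<in>UNIV. \<Sum>f\<in>polys_lt n. h (monom c n + f))"
  for h :: "'a::{field,finite} poly \<Rightarrow> 'b::comm_monoid_add"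
  using sum.reindex_bij_betw[OF bij_betw_polys_lt_Suc[of n, where 'a='a], of h]
  by (simp add: sum.cartesian_product case_prod_beta')

lemma monic_degD: "f \<in> monic_deg d \<Longrightarrow> degree f = d" "f \<in> monic_deg d \<Longrightarrow> lead_coeff f = 1"
  "f \<in> monic_deg d \<Longrightarrow> coeff f d = 1" "f \<in> monic_deg d \<Longrightarrow> f \<noteq> 0"
  by (auto simp: monic_deg_def)

lemma bij_betw_monic_deg:
  "bij_betw (\<lambda>f. monom 1 d + f) (polys_lt d) (monic_deg d :: 'a::{field,finite} poly set)"
proof (rule bij_betwI[where g = "\<lambda>f. f - monom 1 d"])
  show "(+) (monom 1 d) \<in> polys_lt d \<rightarrow> (monic_deg d :: 'a poly set)"
  proof
    fix f :: "'a poly" assume f: "f \<in> polys_lt d"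
    have "degree (monom 1 d + f) = d"
    proof (cases "f = 0")
      case False
      then have "degree f < d" using f by (simp add: polys_lt_iff)
      then show ?thesis by (simp add: degree_add_eq_left degree_monom_eq)
    qed (simp add: degree_monom_eq)
    then show "monom 1 d + f \<in> monic_deg d" using f by (simp add: monic_deg_def polys_lt_def)
  qed
  show "(\<lambda>f. f - monom 1 d) \<in> (monic_deg d :: 'a poly set) \<rightarrow> polys_lt d"
  proof
    fix f :: "'a poly" assume "f \<in> monic_deg d"
    then have "coeff (f - monom 1 d) i = 0" if "i \<ge> d" for i
      using that by (cases "i = d") (auto simp: monic_deg_def coeff_eq_0)
    then show "f - monom 1 d \<in> polys_lt d" by (simp add: polys_lt_def)
  qed
qed auto

lemma sum_monic_deg: "(\<Sum>f\<in>monic_deg d. h f) = (\<Sum>f\<in>polys_lt d. h (monom 1 d + f))"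
  using sum.reindex_bij_betw[OF bij_betw_monic_deg[of d], of h] by simp

lemma finite_monic_deg [simp]: "finite (monic_deg d :: 'a::{field,finite} poly set)"
  using bij_betw_finite[OF bij_betw_monic_deg[of d, where 'a='a]] by simp

lemma card_monic_deg: "card (monic_deg d :: 'a::{field,finite} poly set) = CARD('a) ^ d"
  using bij_betw_same_card[OF bij_betw_monic_deg[of d, where 'a='a]] by (simp add: card_polys_lt)

lemma card_field_ge_2: "CARD('a::{field,finite}) \<ge> 2"
  using card_mono[of UNIV "{0, 1::'a}"] by simp

section \<open>Frobenius on the field and on its polynomials\<close>

lemma bij_betw_times_nonzero: "c \<noteq> 0 \<Longrightarrow> bij_betw ((*) c) (UNIV - {0}) (UNIV - {0::'a::field})"
  by (rule bij_betwI[where g = "(*) (inverse c)"]) (auto simp: field_simps)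

lemma field_pow_card: "(x::'a::{field,finite}) ^ CARD('a) = x"
proof (cases "x = 0")
  case False
  let ?P = "\<Prod>y\<in>UNIV - {0::'a}. y"
  have "?P = (\<Prod>y\<in>UNIV - {0}. x * y)"
    using prod.reindex_bij_betw[OF bij_betw_times_nonzero[OF False], of "\<lambda>y. y"] by simp
  also have "\<dots> = x ^ (CARD('a) - 1) * ?P"
    by (simp add: prod.distrib card_Diff_singleton)
  finally have "x ^ (CARD('a) - 1) = 1" by simp
  then have "x * x ^ (CARD('a) - 1) = x" by simp
  moreover have "CARD('a) = Suc (CARD('a) - 1)" using card_field_ge_2[where 'a='a] by simp
  ultimately show ?thesis by (metis power_Suc)
qed (use card_field_ge_2[where 'a='a] in auto)

lemma field_pow_card_pow: "(x::'a::{field,finite}) ^ (CARD('a) ^ i) = x"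
  by (induction i) (auto simp: power_mult field_pow_card)

text \<open>The polynomial \<open>(X + 1)^q - X^q - 1\<close> has degree below \<open>q\<close> and vanishes on the whole field.\<close>
lemma of_nat_choose_card_eq_0:
  assumes "0 < i" "i < CARD('a)"
  shows "of_nat (CARD('a) choose i) = (0::'a::{field,finite})"
proof -
  let ?q = "CARD('a)"
  let ?f = "[:1, 1:] ^ ?q - monom 1 ?q - 1 :: 'a poly"
  have q: "?q \<ge> 2" by (rule card_field_ge_2)
  have lin: "([:1, 1:] ^ ?q :: 'a poly) \<in> monic_deg ?q"
    using lead_coeff_power[of "[:1, 1:] :: 'a poly" ?q] by (simp add: monic_deg_def degree_linear_power)
  have co: "coeff ?f j = 0" if "j \<ge> ?q" for j
    using that q lin by (cases "j = ?q") (auto simp: monic_deg_def coeff_eq_0 poly_eq_iff one_pCons coeff_pCons split: nat.splits)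
  have "?f = 0"
  proof (rule ccontr)
    assume nz: "?f \<noteq> 0"
    have "{x. poly ?f x = 0} = UNIV"
      by (auto simp: poly_monom field_pow_card)
    then have "?q \<le> degree ?f" using card_poly_roots_bound[OF nz] by simp
    then have "lead_coeff ?f = 0" by (rule co)
    then show False using nz by (simp only: leading_coeff_0_iff)
  qed
  then have "coeff ?f i = 0" by simp
  moreover have "coeff ([:1, 1:] ^ ?q :: 'a poly) i = of_nat (?q choose i)"
    using assms coeff_linear_poly_power[of i "?q" 1 "1::'a"] by simp
  ultimately show ?thesis using assms by (simp add: one_pCons coeff_pCons split: nat.splits)
qed

text \<open>The freshman's dream is proved for \<open>q\<close> directly, so the characteristic
  never enters.\<close>

lemma add_pow_card_poly: "(f + g) ^ CARD('a) = f ^ CARD('a) + g ^ CARD('a)"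
  for f g :: "'a::{field,finite} poly"
proof -
  let ?q = "CARD('a)"
  have q: "?q \<ge> 2" by (rule card_field_ge_2)
  have "(f + g) ^ ?q = (\<Sum>i\<le>?q. of_nat (?q choose i) * f ^ i * g ^ (?q - i))"
    by (rule binomial_ring)
  also have "\<dots> = (\<Sum>i\<in>{0, ?q}. of_nat (?q choose i) * f ^ i * g ^ (?q - i))"
  proof (rule sum.mono_neutral_right)
    show "\<forall>i\<in>{..?q} - {0, ?q}. of_nat (?q choose i) * f ^ i * g ^ (?q - i) = 0"
      using of_nat_choose_card_eq_0[where 'a='a] by (auto simp: of_nat_poly)
  qed auto
  also have "\<dots> = f ^ ?q + g ^ ?q" using q by auto
  finally show ?thesis .
qed

lemma add_pow_card_pow_poly: "(f + g) ^ (CARD('a) ^ i) = f ^ (CARD('a) ^ i) + g ^ (CARD('a) ^ i)"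
  for f g :: "'a::{field,finite} poly"
  by (induction i) (auto simp: power_mult add_pow_card_poly mult.commute[of "CARD('a)"])

lemma sum_pow_card_pow_poly: "(\<Sum>x\<in>A. f x) ^ (CARD('a) ^ i) = (\<Sum>x\<in>A. f x ^ (CARD('a) ^ i))"
  for f :: "'b \<Rightarrow> 'a::{field,finite} poly"
  using zero_less_power[of "CARD('a)" i] card_field_ge_2[where 'a='a]
  by (induction A rule: infinite_finite_induct) (auto simp: add_pow_card_pow_poly power_0_left)

text \<open>Frobenius fixes the coefficients and acts only on the variable. In Stepanov's method
  this makes \<open>f ^ (q ^ \<nu>)\<close> a polynomial in \<open>X^(q^\<nu>)\<close> with constant
  coefficients.\<close>

lemma pow_card_pow_poly: "f ^ (CARD('a) ^ i) = pcompose f (monom 1 (CARD('a) ^ i))"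
  for f :: "'a::{field,finite} poly"
proof (induction f)
  case 0
  then show ?case using zero_less_power[of "CARD('a)" i] card_field_ge_2[where 'a='a]
    by (simp add: power_0_left)
next
  case (pCons a f)
  have "pCons a f = [:a:] + [:0, 1:] * f" by simp
  then have "pCons a f ^ (CARD('a) ^ i) = [:a:] ^ (CARD('a) ^ i) + ([:0, 1:] * f) ^ (CARD('a) ^ i)"
    by (simp only: add_pow_card_pow_poly)
  also have "[:a:] ^ (CARD('a) ^ i) = [:a:]"
    by (simp add: poly_const_pow field_pow_card_pow)
  also have "([:0, 1:] * f) ^ (CARD('a) ^ i) = monom 1 (CARD('a) ^ i) * pcompose f (monom 1 (CARD('a) ^ i))"
    by (simp only: power_mult_distrib pCons.IH) (metis monom_altdef smult_1_left)
  finally show ?case by (simp add: pcompose_pCons)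
qed

section \<open>Residues modulo an irreducible polynomial\<close>

text \<open>The residue field depends on the term \<open>P\<close>, so it cannot be a type;
  \<open>polys_lt n\<close> is its set of representatives, and congruences stand for its
  equations.\<close>

locale prime_modulus =
  fixes P :: "'a::{field,finite} poly" and n :: nat
  assumes P: "P \<in> monic_irred_deg n"
begin

lemma irred: "irreducible P" and degP: "degree P = n" and lcP: "lead_coeff P = 1"
  using P by (auto simp: monic_irred_deg_def)

lemma prime: "prime_elem P"
  using irred by (rule field_poly_irreducible_imp_prime)

lemma P_nz [simp]: "P \<noteq> 0"
  using prime by auto

lemma n_pos: "n > 0"
proof (rule ccontr)
  assume "\<not> n > 0"
  then have "degree P = 0" using degP by simp
  then have "P dvd 1" using P_nz 
    by (metis degree_eq_zeroE dvd_field_iff is_unit_const_poly_iff pCons_eq_0_iff)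
  then show False using irred by (simp add: irreducible_def)
qed

lemma dvd_mult_iff: "P dvd a * b \<longleftrightarrow> P dvd a \<or> P dvd b"
  using prime by (rule prime_elem_dvd_mult_iff)

lemma dvd_power_iff: "k > 0 \<Longrightarrow> P dvd a ^ k \<longleftrightarrow> P dvd a"
  using prime_elem_dvd_power_iff[OF prime] by blast

lemma cong_iff: "[a = b] (mod P) \<longleftrightarrow> P dvd a - b"
  by (rule cong_iff_dvd_diff)

lemma mod_in_polys_lt [simp]: "a mod P \<in> polys_lt n"
  using degree_mod_less'[of P a] by (auto simp: polys_lt_iff degP)

lemma dvd_polys_lt: "a \<in> polys_lt n \<Longrightarrow> P dvd a \<longleftrightarrow> a = 0"
  using dvd_imp_degree_le[of P a] by (fastforce simp: polys_lt_iff degP)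

lemma mod_polys_lt: "a \<in> polys_lt n \<Longrightarrow> a mod P = a"
  using mod_poly_less[of a P] by (auto simp: polys_lt_iff degP)

lemma cong_polys_lt: "a \<in> polys_lt n \<Longrightarrow> b \<in> polys_lt n \<Longrightarrow> [a = b] (mod P) \<longleftrightarrow> a = b"
  by (simp add: cong_def mod_polys_lt)

lemma one_in_polys_lt: "1 \<in> polys_lt n"
  using n_pos by (simp add: polys_lt_iff)

lemma not_dvd_one: "\<not> P dvd 1"
  using dvd_polys_lt[OF one_in_polys_lt] by simp

lemma dvd_prod_iff: "finite A \<Longrightarrow> P dvd (\<Prod>i\<in>A. f i) \<longleftrightarrow> (\<exists>i\<in>A. P dvd f i)"
  by (induction A rule: finite_induct) (auto simp: dvd_mult_iff not_dvd_one)

lemma not_dvd_const: "c \<noteq> 0 \<Longrightarrow> \<not> P dvd [:c:]"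
  using dvd_polys_lt[of "[:c:]"] n_pos by (simp add: polys_lt_iff)

text \<open>Lagrange's bound in the residue field, with the coefficients lifted to polynomials. A
  leading coefficient 1 cannot vanish modulo \<open>P\<close>, and it passes to the quotient of a
  synthetic division.\<close>

lemma root_count:
  fixes F :: "'a poly poly"
  assumes "lead_coeff F = 1" "A \<subseteq> polys_lt n" "\<And>a. a \<in> A \<Longrightarrow> P dvd poly F a"
  shows "card A \<le> degree F"
  using assms
proof (induction "degree F" arbitrary: F A)
  case 0
  then obtain c where "F = [:c:]" by (metis degree_eq_zeroE)
  then have "A = {}" using 0 not_dvd_one by (auto split: if_splits)
  then show ?case by simp
next
  case (Suc d)
  show ?case
  proof (cases "A = {}")
    case False
    then obtain a where a: "a \<in> A" by auto
    define G where "G = synthetic_div F a"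
    have FG: "F + smult a G = pCons (poly F a) G"
      unfolding G_def by (rule synthetic_div_correct)
    have ev: "poly F b = poly F a + (b - a) * poly G b" for b
      using arg_cong[OF FG, of "\<lambda>p. poly p b"] by (simp add: algebra_simps)
    have dG: "degree G = d" using Suc.hyps(2) by (simp add: G_def degree_synthetic_div)
    have "coeff F (Suc d) = coeff G d"
    proof -
      have "coeff G (Suc d) = 0" using dG by (simp add: coeff_eq_0)
      then show ?thesis using arg_cong[OF FG, of "\<lambda>p. coeff p (Suc d)"] by simp
    qed
    then have lcG: "lead_coeff G = 1" using Suc dG by simp
    have "card (A - {a}) \<le> degree G"
    proof (rule Suc.hyps(1))
      show "d = degree G" using dG by simp
      show "lead_coeff G = 1" by (rule lcG)
      show "A - {a} \<subseteq> polys_lt n" using Suc.prems by auto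
      fix b assume b: "b \<in> A - {a}"
      then have "P dvd poly F b" "P dvd poly F a" using Suc.prems a by auto
      then have "P dvd (b - a) * poly G b" using ev[of b] by (simp add: dvd_add_right_iff)
      moreover have "\<not> P dvd b - a"
        using b a Suc.prems(2) by (subst dvd_polys_lt) (auto intro!: polys_lt_diff)
      ultimately show "P dvd poly G b" by (simp add: dvd_mult_iff)
    qed
    moreover have "finite A" using Suc.prems(2) by (rule finite_subset) simp
    ultimately show ?thesis using a dG Suc.hyps(2) by (simp add: card_Diff_singleton)
  qed simp
qed

lemma bij_betw_times_mod:
  assumes "\<not> P dvd f"
  shows "bij_betw (\<lambda>g. f * g mod P) (polys_lt n) (polys_lt n)"
proof -
  have "inj_on (\<lambda>g. f * g mod P) (polys_lt n)"
  proof (rule inj_onI)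
    fix g h assume g: "g \<in> polys_lt n" and h: "h \<in> polys_lt n" and eq: "f * g mod P = f * h mod P"
    then have "P dvd f * (g - h)"
      using mod_eq_dvd_iff[of "f * g" P "f * h"] by (simp add: algebra_simps)
    then have "[g = h] (mod P)" using assms by (simp add: dvd_mult_iff cong_iff)
    then show "g = h" using g h by (simp add: cong_polys_lt)
  qed
  moreover have "(\<lambda>g. f * g mod P) ` polys_lt n \<subseteq> polys_lt n" by auto
  ultimately show ?thesis
    unfolding bij_betw_def using endo_inj_surj[OF finite_polys_lt] by blast
qed

lemma fermat:
  assumes "\<not> P dvd f"
  shows "[f ^ (CARD('a) ^ n - 1) = 1] (mod P)"
proof -
  let ?R = "polys_lt n - {0} :: 'a poly set"
  let ?Q = "\<Prod>g\<in>?R. g"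
  have bij: "bij_betw (\<lambda>g. f * g mod P) ?R ?R"
  proof (rule bij_betw_DiffI[OF bij_betw_times_mod[OF assms]])
    show "bij_betw (\<lambda>g. f * g mod P) {0} {0}" by (auto simp: bij_betw_def)
  qed auto
  have "?Q = (\<Prod>g\<in>?R. f * g mod P)"
    using prod.reindex_bij_betw[OF bij, of "\<lambda>g. g"] by simp
  moreover have "[(\<Prod>g\<in>?R. f * g mod P) = (\<Prod>g\<in>?R. f * g)] (mod P)"
    by (rule cong_prod) simp
  moreover have "(\<Prod>g\<in>?R. f * g) = f ^ (CARD('a) ^ n - 1) * ?Q"
    by (simp add: prod.distrib card_Diff_singleton card_polys_lt)
  ultimately have "[f ^ (CARD('a) ^ n - 1) * ?Q = ?Q] (mod P)"
    by (metis cong_sym)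
  then have "P dvd (f ^ (CARD('a) ^ n - 1) - 1) * ?Q"
    by (simp add: cong_iff algebra_simps)
  moreover have "\<not> P dvd ?Q"
    by (subst dvd_prod_iff) (auto simp: dvd_polys_lt)
  ultimately show ?thesis by (simp add: dvd_mult_iff cong_iff)
qed

lemma pow_card_cong: "[f ^ (CARD('a) ^ n) = f] (mod P)"
proof (cases "P dvd f")
  case True
  then have "P dvd f ^ (CARD('a) ^ n)" by (simp add: dvd_power_iff)
  with True show ?thesis by (simp add: cong_iff)
next
  case False
  have "[f * f ^ (CARD('a) ^ n - 1) = f * 1] (mod P)"
    by (intro cong_mult cong_refl fermat False)
  moreover have "CARD('a) ^ n = Suc (CARD('a) ^ n - 1)" by simp
  ultimately show ?thesis by (metis mult_1_right power_Suc)
qed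

lemma cong_pcompose: "[h = k] (mod P) \<Longrightarrow> [pcompose f h = pcompose f k] (mod P)"
  by (induction f) (auto simp: pcompose_pCons intro!: cong_add cong_mult)

text \<open>If the \<open>q^N\<close>-th power map fixes \<open>X\<close> modulo \<open>P\<close>,
  it fixes every residue. The \<open>q^n\<close>-th power map does so too, hence \<open>N\<close>
  may be replaced by \<open>r = N mod n\<close>; for \<open>r > 0\<close> all \<open>q^n\<close>
  residues would be roots of a polynomial of degree \<open>q^r < q^n\<close>.\<close>

lemma degree_dvd_of_dvd_X_pow_diff:
  assumes "P dvd monom 1 (CARD('a) ^ N) - monom 1 1"
  shows "n dvd N"
proof (rule ccontr)
  assume "\<not> n dvd N"
  define r where "r = N mod n"
  define m where "m = N div n"
  have r: "0 < r" "r < n" using \<open>\<not> n dvd N\<close> n_pos by (auto simp: r_def mod_greater_zero_iff_not_dvd)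
  have N: "N = n * m + r" by (simp add: r_def m_def)
  let ?q = "CARD('a)"
  have q: "?q \<ge> 2" by (rule card_field_ge_2)
  have iter: "[y ^ (?q ^ (n * i)) = y] (mod P)" for y i
  proof (induction i)
    case (Suc i)
    have "[(y ^ (?q ^ (n * i))) ^ (?q ^ n) = y ^ (?q ^ (n * i))] (mod P)" by (rule pow_card_cong)
    also note Suc.IH
    finally show ?case by (simp add: power_mult[symmetric] power_add mult.commute)
  qed simp
  have fixed: "[y ^ (?q ^ r) = y] (mod P)" for y
  proof -
    have "[y ^ (?q ^ N) = pcompose y (monom 1 1)] (mod P)"
      unfolding pow_card_pow_poly using assms by (intro cong_pcompose) (simp add: cong_iff)
    also have "pcompose y (monom 1 1) = y"
      by (simp add: monom_altdef pcompose_idR)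
    finally have 1: "[y ^ (?q ^ N) = y] (mod P)" .
    have "[(y ^ (?q ^ (n * m))) ^ (?q ^ r) = y ^ (?q ^ r)] (mod P)"
      by (intro cong_pow iter)
    then have "[y ^ (?q ^ N) = y ^ (?q ^ r)] (mod P)"
      by (simp add: N power_add power_mult[symmetric])
    then show ?thesis using 1 cong_sym cong_trans by blast
  qed
  let ?F = "monom 1 (?q ^ r) - monom 1 1 :: 'a poly poly"
  have big: "?q ^ r > 1" using r q by (intro one_less_power) auto
  have "degree ?F = ?q ^ r"
    using big degree_add_eq_left[of "- monom 1 1 :: 'a poly poly" "monom 1 (?q ^ r)"]
    by (simp add: degree_monom_eq)
  moreover have "lead_coeff ?F = 1"
    unfolding \<open>degree ?F = ?q ^ r\<close> using big by simp
  ultimately have "card (polys_lt n :: 'a poly set) \<le> ?q ^ r"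
    using root_count[of ?F "polys_lt n"] fixed by (simp add: poly_monom cong_iff)
  moreover have "?q ^ r < ?q ^ n" using r q by (intro power_strict_increasing) auto
  ultimately show False by (simp add: card_polys_lt)
qed

lemma chi_cong: "[f = g] (mod P) \<Longrightarrow> chi P f = chi P g"
proof -
  assume *: "[f = g] (mod P)"
  then have "P dvd f \<longleftrightarrow> P dvd g" by (metis cong_dvd_iff)
  moreover have "P dvd h ^ 2 - f \<longleftrightarrow> P dvd h ^ 2 - g" for h
    using * by (metis cong_iff cong_sym cong_trans)
  ultimately show ?thesis by (simp add: chi_def)
qed

lemma chi_mod [simp]: "chi P (f mod P) = chi P f"
  by (rule chi_cong) simp

lemma chi_cases: "chi P f = 0 \<or> chi P f = 1 \<or> chi P f = -1"
  by (simp add: chi_def)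

lemma chi_eq_0_iff: "chi P f = 0 \<longleftrightarrow> P dvd f"
  by (simp add: chi_def)

lemma chi_0 [simp]: "chi P 0 = 0"
  by (simp add: chi_def)

lemma chi_square: "\<not> P dvd f \<Longrightarrow> chi P (f ^ 2) = 1"
  unfolding chi_def using dvd_power_iff[of 2 f] by (metis diff_self dvd_0_right pos2)

end

section \<open>The quadratic character: Euler's criterion and multiplicativity\<close>

locale odd_prime_modulus = prime_modulus P n for P :: "'a::{field,finite} poly" and n +
  assumes odd_card: "odd CARD('a)"
begin

lemma two_neq_0: "(2::'a) \<noteq> 0"
proof
  assume 2: "(2::'a) = 0"
  obtain m where m: "CARD('a) = 2 * m + 1" using odd_card by (elim oddE)
  have "of_nat (CARD('a)) = (0::'a)"
    using of_nat_choose_card_eq_0[of 1, where 'a='a] card_field_ge_2[where 'a='a] odd_card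
    by (cases "CARD('a) = 2") auto
  then show False unfolding m by (simp add: 2)
qed

lemma not_dvd_two: "\<not> P dvd 2"
  using not_dvd_const[OF two_neq_0] by (metis numeral_poly)

lemma card_square_roots:
  assumes y: "y \<in> polys_lt n"
  shows "real (card {x \<in> polys_lt n. [x ^ 2 = y] (mod P)}) = 1 + chi P y"
proof (cases "y = 0")
  case True
  then have "{x \<in> polys_lt n. [x ^ 2 = y] (mod P)} = {0}"
    by (auto simp: cong_iff dvd_power_iff dvd_polys_lt)
  then show ?thesis using True by simp
next
  case False
  then have ndvd: "\<not> P dvd y" using y by (simp add: dvd_polys_lt)
  show ?thesis
  proof (cases "\<exists>h. P dvd h ^ 2 - y")
    case True
    then obtain h where h: "[h ^ 2 = y] (mod P)" by (auto simp: cong_iff)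
    define x where "x = h mod P"
    have x: "x \<in> polys_lt n" "[x ^ 2 = y] (mod P)"
      using h by (auto simp: x_def cong_def power_mod)
    have "x \<noteq> 0" using x ndvd by (auto simp: cong_iff)
    have "- x \<in> polys_lt n" using x(1) by (simp add: polys_lt_def)
    have "{x \<in> polys_lt n. [x ^ 2 = y] (mod P)} = {x, - x}"
    proof (intro equalityI subsetI)
      fix z assume z: "z \<in> {x \<in> polys_lt n. [x ^ 2 = y] (mod P)}"
      then have "[z ^ 2 = x ^ 2] (mod P)" using x by (metis (mono_tags, lifting) cong_sym cong_trans mem_Collect_eq)
      then have "P dvd (z - x) * (z + x)"
        by (simp add: cong_iff power2_eq_square algebra_simps)
      then have "P dvd z - x \<or> P dvd z - (- x)" by (simp add: dvd_mult_iff)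
      then show "z \<in> {x, - x}"
        using z x \<open>- x \<in> polys_lt n\<close> cong_polys_lt[of z x] cong_polys_lt[of z "- x"]
        unfolding cong_iff by blast
    qed (use x \<open>- x \<in> polys_lt n\<close> in auto)
    moreover have "x \<noteq> - x"
    proof
      assume "x = - x"
      then have "x + x = 0" by (metis add.left_inverse)
      then have "2 * x = 0" by (metis mult_2)
      then show False using \<open>x \<noteq> 0\<close> not_dvd_two by auto
    qed
    ultimately show ?thesis using True ndvd by (simp add: chi_def)
  next
    case False
    then have "{x \<in> polys_lt n. [x ^ 2 = y] (mod P)} = {}" by (auto simp: cong_iff)
    then show ?thesis using False ndvd by (simp add: chi_def)
  qed
qed

text \<open>The factor \<open>1 + chi P y\<close> counts the square roots of \<open>y\<close>. A
  constant \<open>h\<close> shows that \<open>chi\<close> sums to zero; functions of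
  \<open>res\<close> will give quadratic Gauss sums.\<close>

lemma sum_square_residues:
  "(\<Sum>x\<in>polys_lt n. h (x ^ 2 mod P)) = (\<Sum>y\<in>polys_lt n. (1 + chi P y) * h y)"
  for h :: "'a poly \<Rightarrow> real"
proof -
  have "(\<Sum>x\<in>polys_lt n. h (x ^ 2 mod P)) =
        (\<Sum>y\<in>(polys_lt n :: 'a poly set). \<Sum>x\<in>{x \<in> polys_lt n. x ^ 2 mod P = y}. h (x ^ 2 mod P))"
    by (rule sum.group[symmetric]) auto
  also have "\<dots> = (\<Sum>y\<in>(polys_lt n :: 'a poly set). (1 + chi P y) * h y)"
  proof (rule sum.cong[OF refl])
    fix y :: "'a poly" assume y: "y \<in> polys_lt n"
    then show "(\<Sum>x\<in>{x \<in> polys_lt n. x ^ 2 mod P = y}. h (x ^ 2 mod P)) = (1 + chi P y) * h y"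
      using card_square_roots[OF y] by (simp add: cong_def mod_polys_lt[OF y])
  qed
  finally show ?thesis .
qed

lemma sum_chi_residues: "(\<Sum>y\<in>polys_lt n. chi P y) = 0"
  using sum_square_residues[of "\<lambda>_. 1"] by (simp add: sum.distrib)

lemma half_card: "2 * ((CARD('a) ^ n - 1) div 2) = CARD('a) ^ n - 1"
  using odd_card by simp

lemma card_chi_eq_1: "card {y \<in> polys_lt n. chi P y = 1} = (CARD('a) ^ n - 1) div 2"
proof -
  let ?A = "\<lambda>a. {y \<in> polys_lt n. chi P y = a}"
  have fin: "finite (?A a)" for a by (rule finite_subset[of _ "polys_lt n"]) auto
  have un: "polys_lt n = ?A 0 \<union> ?A 1 \<union> ?A (-1)" using chi_cases by auto
  have A0: "?A 0 = {0}" by (auto simp: chi_eq_0_iff dvd_polys_lt)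
  have "(\<Sum>y\<in>polys_lt n. chi P y) = (\<Sum>y\<in>?A 0 \<union> ?A 1. chi P y) + (\<Sum>y\<in>?A (-1). chi P y)"
    by (subst un, rule sum.union_disjoint) (use fin in auto)
  also have "(\<Sum>y\<in>?A 0 \<union> ?A 1. chi P y) = (\<Sum>y\<in>?A 0. chi P y) + (\<Sum>y\<in>?A 1. chi P y)"
    by (rule sum.union_disjoint) (use fin in auto)
  finally have "card (?A 1) = card (?A (-1))" using sum_chi_residues by simp
  moreover have "card (polys_lt n :: 'a poly set) = card (?A 0) + card (?A 1) + card (?A (-1))"
  proof -
    have "card (?A 0 \<union> ?A 1 \<union> ?A (-1)) = card (?A 0 \<union> ?A 1) + card (?A (-1))"
      by (rule card_Un_disjoint) (use fin in auto)
    also have "card (?A 0 \<union> ?A 1) = card (?A 0) + card (?A 1)"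
      by (rule card_Un_disjoint) (use fin in auto)
    finally show ?thesis using un by simp
  qed
  ultimately show ?thesis using A0 by (simp add: card_polys_lt)
qed

lemma euler_residue:
  assumes "chi P f = 1"
  shows "[f ^ ((CARD('a) ^ n - 1) div 2) = 1] (mod P)"
proof -
  let ?c = "(CARD('a) ^ n - 1) div 2"
  have nd: "\<not> P dvd f" using assms by (auto simp: chi_def)
  then obtain h where h: "[h ^ 2 = f] (mod P)"
    using assms by (auto simp: chi_def cong_iff split: if_splits)
  have "\<not> P dvd h" using nd cong_dvd_iff[OF h] by (metis dvd_power_iff pos2)
  have "[f ^ ?c = (h ^ 2) ^ ?c] (mod P)" using h by (intro cong_pow) (rule cong_sym)
  also have "(h ^ 2) ^ ?c = h ^ (CARD('a) ^ n - 1)" by (simp only: power_mult[symmetric] half_card)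
  also have "[\<dots> = 1] (mod P)" by (rule fermat) fact
  finally show ?thesis .
qed

text \<open>The nonzero squares are already as many roots as a polynomial of degree
  \<open>(q^n - 1) div 2\<close> can have, so the power of a non-residue is not 1; its square is 1
  by \<open>fermat\<close>.\<close>

lemma euler_nonresidue:
  assumes "chi P f = -1"
  shows "[f ^ ((CARD('a) ^ n - 1) div 2) = -1] (mod P)"
proof -
  let ?c = "(CARD('a) ^ n - 1) div 2"
  let ?A = "{y \<in> polys_lt n. chi P y = 1}"
  have nd: "\<not> P dvd f" using assms by (auto simp: chi_def)
  have q: "CARD('a) \<ge> 2" by (rule card_field_ge_2)
  have "CARD('a) ^ n > 1" using q n_pos by (intro one_less_power) auto
  then have c: "?c > 0" using half_card by (cases "?c = 0") auto
  have "\<not> [f ^ ?c = 1] (mod P)"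
  proof
    assume f1: "[f ^ ?c = 1] (mod P)"
    let ?F = "monom 1 ?c - 1 :: 'a poly poly"
    have "degree ?F = ?c"
      using c degree_add_eq_left[of "- 1 :: 'a poly poly" "monom 1 ?c"] by (simp add: degree_monom_eq)
    moreover have "lead_coeff ?F = 1"
      unfolding \<open>degree ?F = ?c\<close> using c by (simp add: coeff_eq_0)
    moreover have "P dvd poly ?F y" if "y \<in> insert (f mod P) ?A" for y
    proof -
      have "[y ^ ?c = 1] (mod P)"
      proof (cases "y = f mod P")
        case True
        then show ?thesis using f1 by (simp add: cong_def power_mod)
      qed (use that euler_residue in auto)
      then show ?thesis by (simp add: poly_monom cong_iff)
    qed
    ultimately have "card (insert (f mod P) ?A) \<le> ?c"
      by (metis (no_types, lifting) insert_subset mem_Collect_eq mod_in_polys_lt root_count subsetI)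
    moreover have "f mod P \<notin> ?A" using assms by simp
    ultimately show False using card_chi_eq_1 by simp
  qed
  moreover have "P dvd (f ^ ?c - 1) * (f ^ ?c - (-1))"
  proof -
    have "(f ^ ?c - 1) * (f ^ ?c - (-1)) = f ^ (2 * ?c) - 1"
      by (simp add: algebra_simps mult_2 power_add)
    then show ?thesis using fermat[OF nd] half_card by (simp only: cong_iff)
  qed
  ultimately show ?thesis by (simp only: cong_iff dvd_mult_iff simp_thms)
qed

lemma chi_mult: "chi P (f * g) = chi P f * chi P g"
proof (cases "P dvd f \<or> P dvd g")
  case True
  then show ?thesis by (auto simp: chi_def dvd_mult_iff)
next
  case False
  then have fg: "\<not> P dvd f * g" by (simp add: dvd_mult_iff)
  let ?c = "(CARD('a) ^ n - 1) div 2"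
  have euler: "[h ^ ?c = of_int (if chi P h = 1 then 1 else -1)] (mod P)" if "\<not> P dvd h" for h
    using that chi_cases[of h] euler_residue[of h] euler_nonresidue[of h] chi_eq_0_iff[of h] by auto
  let ?s = "\<lambda>h. if chi P h = 1 then 1 else -1 :: int"
  have "[of_int (?s (f * g)) = (f * g) ^ ?c] (mod P)" using euler[OF fg] by (rule cong_sym)
  also have "(f * g) ^ ?c = f ^ ?c * g ^ ?c" by (rule power_mult_distrib)
  also have "[\<dots> = of_int (?s f) * of_int (?s g)] (mod P)"
    using False by (intro cong_mult euler) auto
  finally have *: "[of_int (?s (f * g)) = of_int (?s f * ?s g) :: 'a poly] (mod P)" by simp
  have neg: "\<not> [1 = - 1 :: 'a poly] (mod P)" "\<not> [- 1 = 1 :: 'a poly] (mod P)"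
    using not_dvd_two by (auto simp: cong_iff simp flip: dvd_minus_iff[of P "- 2"])
  have "?s (f * g) = ?s f * ?s g"
    using * neg by (auto split: if_splits)
  then have "real_of_int (?s (f * g)) = real_of_int (?s f) * real_of_int (?s g)"
    by (simp only: of_int_mult)
  moreover have "real_of_int (?s h) = chi P h" if "\<not> P dvd h" for h
    using that chi_cases[of h] chi_eq_0_iff[of h] by auto
  moreover have "\<not> P dvd f" "\<not> P dvd g" using False by auto
  ultimately show ?thesis using fg by (metis (no_types))
qed

lemma chi_one [simp]: "chi P 1 = 1"
  using chi_square[OF not_dvd_one] by simp

lemma chi_prod: "chi P (\<Prod>i\<in>A. F i) = (\<Prod>i\<in>A. chi P (F i))"
  by (induction A rule: infinite_finite_induct) (auto simp: chi_mult)

end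

section \<open>Factorisation into irreducible polynomials\<close>

definition monic_irred :: "'a::{field,finite} poly \<Rightarrow> bool" where
  "monic_irred P \<longleftrightarrow> lead_coeff P = 1 \<and> irreducible P"

lemma monic_irred_deg_iff: "P \<in> monic_irred_deg n \<longleftrightarrow> monic_irred P \<and> degree P = n"
  by (auto simp: monic_irred_def monic_irred_deg_def)

lemma monic_irred_prime_modulus: "monic_irred P \<Longrightarrow> prime_modulus P (degree P)"
  by unfold_locales (simp add: monic_irred_deg_iff)

lemma finite_monic_irred_deg [simp]: "finite (monic_irred_deg n :: 'a::{field,finite} poly set)"
  by (rule finite_subset[OF _ finite_monic_deg[of n]]) (auto simp: monic_irred_deg_def monic_deg_def)

lemma monic_irred_dvd_exists:
  fixes f :: "'a::{field,finite} poly"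
  assumes "degree f > 0"
  obtains P where "monic_irred P" "P dvd f"
proof -
  obtain g where g: "degree g > 0 \<and> g dvd f" and
    min: "\<And>h. degree h > 0 \<and> h dvd f \<Longrightarrow> degree g \<le> degree h"
    using ex_has_least_nat[of "\<lambda>g. degree g > 0 \<and> g dvd f" f degree] assms by auto
  have gnz: "g \<noteq> 0" using g by auto
  let ?c = "inverse (lead_coeff g)"
  have c: "?c \<noteq> 0" using gnz by simp
  let ?P = "smult ?c g"
  have unit: "h dvd 1" if "h \<noteq> 0" "degree h = 0" for h :: "'a poly"
    using that by (metis degree_eq_zeroE dvd_field_iff is_unit_const_poly_iff pCons_0_0)
  have "irreducible ?P"
  proof (rule irreducibleI)
    show "?P \<noteq> 0" using c gnz by simp
    show "\<not> ?P dvd 1"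
    proof
      assume "?P dvd 1"
      then have "degree ?P \<le> 0" using dvd_imp_degree_le[of ?P 1] by simp
      then show False using g c by simp
    qed
    fix a b assume ab: "?P = a * b"
    then have nz: "a \<noteq> 0" "b \<noteq> 0" using c gnz by auto
    have "a dvd ?P" using ab by simp
    then have "a dvd g" using c by (simp add: dvd_smult_iff)
    then have "a dvd f" using g dvd_trans by blast
    moreover have "degree g = degree a + degree b"
      using arg_cong[OF ab, of degree] c nz by (simp add: degree_mult_eq)
    ultimately show "a dvd 1 \<or> b dvd 1"
      using min[of a] unit nz by (cases "degree a = 0") auto
  qed
  then have "monic_irred ?P" using gnz by (simp add: monic_irred_def)
  moreover have "?P dvd f" using g c by (simp add: smult_dvd_iff)
  ultimately show thesis by (rule that)
qed

lemma monic_dvd_antisym: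
  fixes p q :: "'a::field poly"
  assumes "p dvd q" "q dvd p" "lead_coeff p = 1" "lead_coeff q = 1"
  shows "p = q"
proof -
  obtain u where u: "q = p * u" using assms(1) by (elim dvdE)
  have nz: "p \<noteq> 0" "q \<noteq> 0" using assms(3,4) by auto
  then have "degree u = 0"
    using u dvd_imp_degree_le[OF assms(2)] by (auto simp: degree_mult_eq)
  then obtain c where "u = [:c:]" by (elim degree_eq_zeroE)
  then show ?thesis using u nz assms(3,4) by (cases "c = 0") auto
qed

lemma monic_irred_dvd_eq:
  assumes "monic_irred P" "monic_irred P'" "P dvd P'"
  shows "P = P'"
proof -
  interpret P: prime_modulus P "degree P" by (rule monic_irred_prime_modulus) fact
  obtain u where u: "P' = P * u" using assms(3) by (elim dvdE)
  have "irreducible P'" using assms(2) by (simp add: monic_irred_def)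
  then have "u dvd 1"
    using u P.irred by (auto simp: irreducible_def)
  then have "P' dvd P" using u by simp
  then show ?thesis
    using assms by (intro monic_dvd_antisym) (auto simp: monic_irred_def)
qed

text \<open>Distinct irreducible factors can be divided out one after the other. This turns
  divisibility by many \<open>P\<close> into a count, for the number of irreducibles as well as in
  Stepanov's method.\<close>

lemma sum_degree_le:
  fixes F :: "'a::{field,finite} poly"
  assumes "finite S" "F \<noteq> 0" "\<And>P. P \<in> S \<Longrightarrow> monic_irred P" "\<And>P. P \<in> S \<Longrightarrow> P dvd F"
  shows "(\<Sum>P\<in>S. degree P) \<le> degree F"
  using assms
proof (induction S arbitrary: F rule: finite_induct)
  case (insert P S)
  obtain F' where F': "F = P * F'" using insert.prems by (metis dvdE insertI1)
  have "F' \<noteq> 0" using F' insert.prems by auto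
  moreover have "P' dvd F'" if "P' \<in> S" for P'
  proof -
    interpret P': prime_modulus P' "degree P'"
      by (rule monic_irred_prime_modulus) (use insert.prems that in auto)
    have "P' \<noteq> P" using that insert.hyps by auto
    then have "\<not> P' dvd P" using monic_irred_dvd_eq insert.prems that by blast
    moreover have "P' dvd P * F'" using insert.prems that F' by blast
    ultimately show ?thesis by (simp add: P'.dvd_mult_iff)
  qed
  ultimately have "(\<Sum>P\<in>S. degree P) \<le> degree F'"
    using insert.prems by (intro insert.IH) auto
  then show ?case using insert.hyps F' \<open>F \<noteq> 0\<close> by (auto simp: degree_mult_eq)
qed simp

lemma finite_monic_irred_dvd:
  fixes F :: "'a::{field,finite} poly"
  assumes "F \<noteq> 0"
  shows "finite {P. monic_irred P \<and> P dvd F}"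
  by (rule finite_subset[OF _ finite_polys_lt[of "Suc (degree F)"]])
     (use assms in \<open>auto simp: polys_lt_iff less_Suc_eq_le dvd_imp_degree_le\<close>)

lemma degree_le_sum:
  fixes F :: "'a::{field,finite} poly"
  assumes "F \<noteq> 0" "\<And>P. monic_irred P \<Longrightarrow> \<not> P ^ 2 dvd F"
  shows "degree F \<le> (\<Sum>P\<in>{P. monic_irred P \<and> P dvd F}. degree P)"
  using assms
proof (induction "degree F" arbitrary: F rule: less_induct)
  case less
  show ?case
  proof (cases "degree F = 0")
    case False
    then obtain P where P: "monic_irred P" "P dvd F" using monic_irred_dvd_exists by blast
    interpret P: prime_modulus P "degree P" by (rule monic_irred_prime_modulus) fact
    obtain F' where F': "F = P * F'" using P by (elim dvdE)
    have nz: "F' \<noteq> 0" using F' less.prems by auto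
    have deg: "degree F = degree P + degree F'" using F' nz by (simp add: degree_mult_eq)
    have "\<not> P dvd F'" using less.prems(2)[OF P(1)] F' by (auto simp: power2_eq_square)
    have "degree F' \<le> (\<Sum>P\<in>{P. monic_irred P \<and> P dvd F'}. degree P)"
    proof (rule less.hyps)
      show "degree F' < degree F" using deg P.n_pos by simp
      show "\<not> P' ^ 2 dvd F'" if "monic_irred P'" for P'
        using less.prems(2)[OF that] F' by (auto intro: dvd_mult)
    qed fact
    then have "degree F \<le> (\<Sum>P\<in>insert P {P. monic_irred P \<and> P dvd F'}. degree P)"
      using deg finite_monic_irred_dvd[OF nz] \<open>\<not> P dvd F'\<close> by simp
    also have "\<dots> \<le> (\<Sum>P\<in>{P. monic_irred P \<and> P dvd F}. degree P)"
      using P F' finite_monic_irred_dvd[OF \<open>F \<noteq> 0\<close>] by (intro sum_mono2) auto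
    finally show ?thesis .
  qed simp
qed

text \<open>Descent on the degree of \<open>v\<close>: an irreducible factor of \<open>v\<close>
  also divides \<open>r\<close> and cancels. In the end \<open>v\<close> is a constant, which is
  absorbed into \<open>r\<close>.\<close>

lemma square_cancel:
  fixes f v r :: "'a::{field,finite} poly"
  assumes "f * v ^ 2 = r ^ 2" "v \<noteq> 0"
  shows "\<exists>w. f = w ^ 2"
  using assms
proof (induction "degree v" arbitrary: v r rule: less_induct)
  case less
  show ?case
  proof (cases "degree v = 0")
    case True
    then obtain c where c: "v = [:c:]" "c \<noteq> 0" using less.prems by (metis degree_eq_zeroE pCons_0_0)
    then have "f * [:c ^ 2:] = r ^ 2" using less.prems by (simp add: power2_eq_square)
    then have "smult (c ^ 2) f = r ^ 2" by simp
    then have "smult (inverse (c ^ 2)) (smult (c ^ 2) f) = smult (inverse (c ^ 2)) (r ^ 2)" by simp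
    then have "f = smult (inverse (c ^ 2)) (r ^ 2)" using c by simp
    also have "\<dots> = (smult (inverse c) r) ^ 2" by (simp add: power2_eq_square)
    finally show ?thesis by blast
  next
    case False
    then obtain P where P: "monic_irred P" "P dvd v" using monic_irred_dvd_exists by blast
    interpret P: prime_modulus P "degree P" by (rule monic_irred_prime_modulus) fact
    obtain v' where v': "v = P * v'" using P by (elim dvdE)
    have "P dvd r ^ 2" using less.prems(1) v' by (metis dvd_mult dvd_power dvd_triv_left dvd_trans pos2)
    then have "P dvd r" by (simp add: P.dvd_power_iff)
    then obtain r' where r': "r = P * r'" by (elim dvdE)
    have "P ^ 2 * (f * v' ^ 2) = P ^ 2 * r' ^ 2"
      using less.prems(1) v' r' by (simp add: power_mult_distrib algebra_simps)
    then have "f * v' ^ 2 = r' ^ 2" by simp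
    moreover have "v' \<noteq> 0" using v' less.prems by auto
    moreover have "degree v' < degree v" using v' P.n_pos \<open>v' \<noteq> 0\<close> by (simp add: degree_mult_eq)
    ultimately show ?thesis using less.hyps by blast
  qed
qed

section \<open>Counting irreducible polynomials\<close>

text \<open>Classically the product of all monic irreducible polynomials whose degree divides
  \<open>N\<close>. What is needed of that fact is that it is squarefree and which degrees its
  irreducible factors can have.\<close>

definition X_pow_diff :: "nat \<Rightarrow> 'a::{field,finite} poly" where
  "X_pow_diff N = monom 1 (CARD('a) ^ N) - monom 1 1"

lemma card_pow_gt_1: "N > 0 \<Longrightarrow> CARD('a::{field,finite}) ^ N > 1"
  using card_field_ge_2[where 'a='a] by (intro one_less_power) auto

lemma degree_X_pow_diff: "N > 0 \<Longrightarrow> degree (X_pow_diff N :: 'a::{field,finite} poly) = CARD('a) ^ N"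
  using card_pow_gt_1[of N, where 'a='a]
    degree_add_eq_left[of "- monom 1 1 :: 'a poly" "monom 1 (CARD('a) ^ N)"]
  by (simp add: X_pow_diff_def degree_monom_eq)

lemma X_pow_diff_nz: "N > 0 \<Longrightarrow> X_pow_diff N \<noteq> (0 :: 'a::{field,finite} poly)"
  using degree_X_pow_diff[of N, where 'a='a] card_pow_gt_1[of N, where 'a='a] by auto

text \<open>A double factor would divide the derivative, which is -1 because \<open>q\<close>
  vanishes in the field.\<close>

lemma X_pow_diff_squarefree:
  fixes P :: "'a::{field,finite} poly"
  assumes "N > 0" "monic_irred P"
  shows "\<not> P ^ 2 dvd X_pow_diff N"
proof
  assume "P ^ 2 dvd X_pow_diff N"
  then obtain u where u: "X_pow_diff N = P ^ 2 * u" by (elim dvdE)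
  interpret P: prime_modulus P "degree P" by (rule monic_irred_prime_modulus) fact
  have "of_nat (CARD('a)) = (0::'a)"
    using of_nat_choose_card_eq_0[of 1, where 'a='a] card_field_ge_2[where 'a='a] by simp
  then have "of_nat (CARD('a) ^ N) = (0::'a)" using assms by simp
  then have "pderiv (X_pow_diff N) = (- 1 :: 'a poly)"
    by (simp add: X_pow_diff_def pderiv_diff pderiv_monom one_pCons monom_0 del: of_nat_power)
  moreover have "P dvd pderiv (P ^ 2 * u)"
    by (simp add: power2_eq_square pderiv_mult algebra_simps)
  ultimately show False using u P.not_dvd_one by (metis dvd_minus_iff)
qed

lemma (in prime_modulus) dvd_X_pow_diff: "P dvd X_pow_diff n"
  using pow_card_cong[of "monom 1 1"] by (simp add: X_pow_diff_def cong_iff monom_power)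

lemma card_monic_irred_deg_le: "n * card (monic_irred_deg n :: 'a::{field,finite} poly set) \<le> CARD('a) ^ n"
proof (cases "n = 0")
  case False
  have "(\<Sum>P\<in>(monic_irred_deg n :: 'a poly set). degree P) \<le> degree (X_pow_diff n :: 'a poly)"
  proof (rule sum_degree_le)
    fix P :: "'a poly" assume P: "P \<in> monic_irred_deg n"
    then interpret prime_modulus P n by unfold_locales
    show "monic_irred P" using P by (simp add: monic_irred_deg_iff)
    show "P dvd X_pow_diff n" by (rule dvd_X_pow_diff)
  qed (use False X_pow_diff_nz in auto)
  then show ?thesis
    using False by (simp add: degree_X_pow_diff monic_irred_deg_def mult.commute)
qed auto

lemma sum_pow_le: "(q::nat) \<ge> 2 \<Longrightarrow> (\<Sum>i\<le>n. q ^ i) \<le> 2 * q ^ n"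
proof (induction n)
  case (Suc n)
  then have "(\<Sum>i\<le>Suc n. q ^ i) \<le> 2 * q ^ n + q ^ Suc n" by simp
  also have "2 * q ^ n \<le> q * q ^ n" using Suc by (intro mult_right_mono) auto
  finally show ?case by simp
qed simp

text \<open>The degree of the squarefree \<open>X_pow_diff n\<close> is the sum of the degrees of
  its irreducible factors. A factor of degree other than \<open>n\<close> has a proper divisor of
  \<open>n\<close> as its degree, hence at most \<open>n div 2\<close>.\<close>

lemma card_monic_irred_deg_ge:
  assumes "n > 0"
  shows "CARD('a) ^ n \<le> n * card (monic_irred_deg n :: 'a::{field,finite} poly set) + 2 * CARD('a) ^ (n div 2)"
proof -
  let ?q = "CARD('a)"
  let ?M = "\<lambda>d. monic_irred_deg d :: 'a poly set"
  let ?S = "{P :: 'a poly. monic_irred P \<and> P dvd X_pow_diff n}"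
  have q: "?q \<ge> 2" by (rule card_field_ge_2)
  have sub: "?S \<subseteq> ?M n \<union> (\<Union>d\<in>{..n div 2}. ?M d)"
  proof
    fix P assume "P \<in> ?S"
    then have mem: "P \<in> ?M (degree P)" and dvd: "P dvd X_pow_diff n" by (auto simp: monic_irred_deg_iff)
    interpret prime_modulus P "degree P" using mem by unfold_locales
    have "degree P dvd n" using dvd unfolding X_pow_diff_def by (rule degree_dvd_of_dvd_X_pow_diff)
    then obtain k where k: "n = degree P * k" by (elim dvdE)
    show "P \<in> ?M n \<union> (\<Union>d\<in>{..n div 2}. ?M d)"
    proof (cases "k \<le> 1")
      case True
      then have "k = 1" using k assms by (cases k) auto
      then show ?thesis using P k by simp
    next
      case False
      then have "degree P * 2 \<le> n" using k by simp
      then have "degree P \<le> n div 2" by simp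
      then show ?thesis using P by auto
    qed
  qed
  have "?q ^ n = degree (X_pow_diff n :: 'a poly)" using assms by (simp add: degree_X_pow_diff)
  also have "\<dots> \<le> (\<Sum>P\<in>?S. degree P)"
    using assms by (intro degree_le_sum X_pow_diff_nz X_pow_diff_squarefree)
  also have "\<dots> \<le> (\<Sum>P\<in>?M n \<union> (\<Union>d\<in>{..n div 2}. ?M d). degree P)"
    using sub by (intro sum_mono2) auto
  also have "\<dots> \<le> (\<Sum>P\<in>?M n. degree P) + (\<Sum>P\<in>(\<Union>d\<in>{..n div 2}. ?M d). degree P)"
    by (subst sum_Un_nat) auto
  also have "(\<Sum>P\<in>?M n. degree P) = n * card (?M n)"
    by (simp add: monic_irred_deg_def mult.commute)
  also have "(\<Sum>P\<in>(\<Union>d\<in>{..n div 2}. ?M d). degree P) = (\<Sum>d\<le>n div 2. \<Sum>P\<in>?M d. degree P)"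
    by (rule sum.UNION_disjoint) (auto simp: monic_irred_deg_iff)
  also have "\<dots> = (\<Sum>d\<le>n div 2. d * card (?M d))"
    by (intro sum.cong refl) (simp add: monic_irred_deg_def mult.commute)
  also have "\<dots> \<le> (\<Sum>d\<le>n div 2. ?q ^ d)"
    by (intro sum_mono card_monic_irred_deg_le)
  also have "\<dots> \<le> 2 * ?q ^ (n div 2)" using q by (rule sum_pow_le)
  finally show ?thesis by simp
qed

section \<open>Character sums over irreducible polynomials\<close>

text \<open>Coefficients of degree below \<open>D\<close> land in disjoint ranges of exponents, so
  nothing can cancel: \<open>X\<close> and \<open>X^D\<close> behave like independent
  variables.\<close>

lemma poly_at_monom_eq_0:
  fixes W :: "'a::{field,finite} poly poly"
  assumes "\<And>i. coeff W i \<in> polys_lt D" "poly W (monom 1 D) = 0"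
  shows "W = 0"
  using assms
proof (induction W)
  case (pCons a W)
  have a: "a \<in> polys_lt D" using pCons.prems(1)[of 0] by simp
  have eq: "a + monom 1 D * poly W (monom 1 D) = 0" using pCons.prems(2) by simp
  then have "monom 1 D dvd a" by (metis add_eq_0_iff dvd_minus_iff dvd_triv_left)
  then have "a = 0"
    using a dvd_imp_degree_le[of "monom 1 D" a] by (fastforce simp: polys_lt_iff degree_monom_eq)
  then have "poly W (monom 1 D) = 0" using eq by simp
  moreover have "coeff W i \<in> polys_lt D" for i using pCons.prems(1)[of "Suc i"] by simp
  ultimately show ?case using pCons.IH \<open>a = 0\<close> by simp
qed simp

lemma polys_lt_mult:
  fixes f g :: "'a::field poly"
  assumes "f \<in> polys_lt (Suc a)" "g \<in> polys_lt (Suc b)"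
  shows "f * g \<in> polys_lt (Suc (a + b))"
  using assms degree_mult_le[of f g] by (auto simp: polys_lt_iff)

lemma coeff_mult_polys_lt:
  fixes U V :: "'a::field poly poly"
  assumes "\<And>i. coeff U i \<in> polys_lt (Suc a)" "\<And>i. coeff V i \<in> polys_lt (Suc b)"
  shows "coeff (U * V) i \<in> polys_lt (Suc (a + b))"
  unfolding coeff_mult using assms by (intro polys_lt_sum polys_lt_mult)

text \<open>The degree conditions make the substitution \<open>Z = X^D\<close> injective, so the vanishing lifts to an
  identity \<open>R(X,Z)\<^sup>2 = f(X) f(Z) V(X,Z)\<^sup>2\<close>; its leading coefficient in \<open>Z\<close> exhibits \<open>f\<close> as a square.\<close>
lemma auxiliary_nonzero:
  fixes f :: "'a::{field,finite} poly"
  assumes f: "f \<in> monic_deg m" "\<nexists>w. f = w ^ 2"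
    and R: "\<And>j. j < J \<Longrightarrow> R j \<in> polys_lt (Suc d)"
    and V: "\<And>j. j < J \<Longrightarrow> V j \<in> polys_lt (Suc (d - m))"
    and d: "m \<le> d" "2 * d < CARD('a) ^ \<nu>" and odd: "odd CARD('a)"
    and zero: "(\<Sum>j<J. (R j + V j * f ^ ((1 + CARD('a) ^ \<nu>) div 2)) * monom 1 (j * CARD('a) ^ \<nu>)) = 0"
    and j: "j < J"
  shows "R j = 0 \<and> V j = 0"
proof -
  let ?D = "CARD('a) ^ \<nu>"
  let ?z = "monom 1 ?D :: 'a poly"
  define RR where "RR = (\<Sum>j<J. monom (R j) j)"
  define VV where "VV = (\<Sum>j<J. monom (V j) j)"
  define ff where "ff = map_poly (\<lambda>c. [:c:]) f"
  have coeff_RR: "coeff RR i = (if i < J then R i else 0)" for i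
    unfolding RR_def coeff_sum by (simp add: sum.delta)
  have coeff_VV: "coeff VV i = (if i < J then V i else 0)" for i
    unfolding VV_def coeff_sum by (simp add: sum.delta)
  have zpow: "?z ^ i = monom 1 (i * ?D)" for i by (simp add: monom_power mult.commute)
  have "(\<Sum>j<J. (R j + V j * f ^ ((1 + ?D) div 2)) * monom 1 (j * ?D)) =
     poly RR ?z + f ^ ((1 + ?D) div 2) * poly VV ?z"
    unfolding RR_def VV_def poly_sum poly_monom zpow sum_distrib_left sum.distrib[symmetric]
    by (rule sum.cong) (auto simp: algebra_simps)
  then have rel: "poly RR ?z = - (f ^ ((1 + ?D) div 2) * poly VV ?z)"
    using zero by (simp add: eq_neg_iff_add_eq_0)
  \<comment> \<open>Squaring produces the exponent \<open>1 + q^\<nu>\<close>, and only an exponent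
    of this kind can be read in the variable \<open>Z\<close>.\<close>
  have even: "2 * ((1 + ?D) div 2) = 1 + ?D" using odd by simp
  have "poly RR ?z ^ 2 = f ^ (2 * ((1 + ?D) div 2)) * poly VV ?z ^ 2"
    by (simp only: rel power2_minus power_mult_distrib power_mult[symmetric] mult.commute[of 2])
  also have "\<dots> = f * f ^ ?D * poly VV ?z ^ 2" by (simp only: even power_add power_one_right)
  also have "f ^ ?D = poly ff ?z"
    by (simp add: pow_card_pow_poly ff_def pcompose_altdef)
  finally have sq: "poly RR ?z ^ 2 = f * poly ff ?z * poly VV ?z ^ 2" .
  \<comment> \<open>The two terms have coefficients of degree at most \<open>2 * d\<close> and
    \<open>m + 2 * (d - m)\<close>, both below \<open>q^\<nu>\<close>. The smaller range allowed for
    \<open>V\<close> makes room for the factor \<open>f\<close>.\<close>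
  define W where "W = RR * RR - [:f:] * (ff * (VV * VV))"
  have "W = 0"
  proof (rule poly_at_monom_eq_0[of _ ?D])
    have "coeff (RR * RR) i \<in> polys_lt (Suc (d + d))" for i
      by (rule coeff_mult_polys_lt) (auto simp: coeff_RR R)
    moreover have "coeff ([:f:] * (ff * (VV * VV))) i \<in> polys_lt (Suc (m + (0 + ((d - m) + (d - m)))))" for i
    proof (intro coeff_mult_polys_lt)
      show "coeff [:f:] i \<in> polys_lt (Suc m)" for i
        using f by (auto simp: coeff_pCons polys_lt_iff monic_deg_def split: nat.splits)
      show "coeff ff i \<in> polys_lt (Suc 0)" for i
        by (auto simp: ff_def coeff_map_poly polys_lt_iff)
    qed (auto simp: coeff_VV V)
    ultimately show "coeff W i \<in> polys_lt ?D" for i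
      unfolding W_def coeff_diff using d
      by (intro polys_lt_diff) (rule polys_lt_mono, assumption, simp)+
    show "poly W ?z = 0"
      using sq by (simp add: W_def power2_eq_square algebra_simps)
  qed
  then have eq: "RR * RR = [:f:] * (ff * (VV * VV))" by (simp add: W_def)
  have "lead_coeff ff = 1"
    using f unfolding ff_def by (subst lead_coeff_map_poly_nz) (auto simp: monic_deg_def)
  then have lc: "lead_coeff RR * lead_coeff RR = f * (lead_coeff VV * lead_coeff VV)"
    using arg_cong[OF eq, of lead_coeff] by (simp add: lead_coeff_mult del: mult_pCons_left)
  have "VV = 0"
  proof (rule ccontr)
    assume "VV \<noteq> 0"
    then have "lead_coeff VV \<noteq> 0" by simp
    moreover have "f * lead_coeff VV ^ 2 = lead_coeff RR ^ 2" using lc by (simp add: power2_eq_square)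
    ultimately show False using square_cancel f(2) by blast
  qed
  then have "RR = 0" using eq by simp
  show ?thesis using coeff_RR[of j] coeff_VV[of j] \<open>VV = 0\<close> \<open>RR = 0\<close> j by simp
qed

text \<open>The count behind \<open>auxiliary_exists\<close>: on the left the coefficients that must
  vanish, on the right the free coefficients of all \<open>R j\<close> and \<open>V j\<close>.
  \<open>J\<close> has to be about \<open>M / 2\<close>, as this gives the auxiliary polynomial its
  degree \<open>q^n / 2\<close>; the extra \<open>m\<close> compensates for the \<open>V j\<close>
  having \<open>m\<close> coefficients fewer.\<close>

lemma unknowns_exceed_conditions:
  fixes M m J :: nat
  assumes "1 \<le> m" "m \<le> M" "odd M" "J = (M - 1) div 2 + m"
  shows "M * M + J < Suc M * J + Suc (M - m) * J"
proof -
  obtain c where c: "M = 2 * c + 1" using assms(3) by (elim oddE)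
  obtain e where e: "M = m + e" using assms(2) le_Suc_ex by blast
  have J: "J = c + m" using assms(4) c by simp
  have "2 * (M * M) < 2 * (J * (M + e + 1))"
  proof -
    have "2 * J = m + e + 2 * m - 1" using J c e by simp
    then have 2: "2 * J + 1 = 3 * m + e" using assms(1) by simp
    have "2 * (J * (M + e + 1)) + (m + 2 * e + 1) = (2 * J + 1) * (m + 2 * e + 1)"
      using e by (simp add: algebra_simps)
    also have "\<dots> = (3 * m + e) * (m + 2 * e + 1)" by (simp only: 2)
    also have "\<dots> = 2 * ((m + e) * (m + e)) + m * m + 3 * m + 3 * m * e + e"
      by (simp add: algebra_simps)
    finally have *: "2 * (J * (M + e + 1)) + (m + 2 * e + 1) = 2 * (M * M) + m * m + 3 * m + 3 * m * e + e"
      using e by simp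
    have "e \<le> m * e" "3 * m * e = 3 * (m * e)" using assms(1) by simp_all
    then have "m + 2 * e + 1 < m * m + 3 * m + 3 * m * e + e" using assms(1) by linarith
    then show ?thesis using * by linarith
  qed
  then show ?thesis using e by (simp add: algebra_simps)
qed

text \<open>Siegel's lemma by pigeonhole. Since \<open>M\<close> is a power of \<open>q\<close>, the
  map from \<open>(R, V)\<close> to the relation is additive although it involves
  \<open>M\<close>-th powers, so two tuples with the same image differ by a nontrivial
  solution.\<close>

lemma auxiliary_exists:
  fixes f e :: "'a::{field,finite} poly"
  assumes f: "f \<in> monic_deg m" and m: "1 \<le> m" "m \<le> M" and M: "M = CARD('a) ^ \<mu>"
    and odd: "odd CARD('a)" and e: "degree e = 0"
    and J: "J = (M - 1) div 2 + m"
  obtains R V where "\<And>j. j < J \<Longrightarrow> R j \<in> polys_lt (Suc M)" "\<And>j. j < J \<Longrightarrow> V j \<in> polys_lt (Suc (M - m))"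
    "\<exists>j<J. R j \<noteq> 0 \<or> V j \<noteq> 0"
    "(\<Sum>j<J. (R j ^ M + e * f ^ ((M + 1) div 2) * V j ^ M) * monom 1 j) = 0"
proof -
  define \<Psi> where "\<Psi> = (\<lambda>(R, V). \<Sum>j<J. (R j ^ M + e * f ^ ((M + 1) div 2) * V j ^ M) * monom 1 j)"
  let ?A = "PiE {..<J} (\<lambda>_. polys_lt (Suc M) :: 'a poly set)"
  let ?B = "PiE {..<J} (\<lambda>_. polys_lt (Suc (M - m)) :: 'a poly set)"
  have oddM: "odd M" using M odd by simp
  have degf: "degree f = m" using f by (rule monic_degD)
  have halfM: "m * ((M + 1) div 2) + M * (M - m) \<le> M * M"
  proof -
    have "(M + 1) div 2 \<le> M" using oddM by (auto elim: oddE)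
    then have "m * ((M + 1) div 2) \<le> M * m" by (simp add: mult.commute)
    moreover have "M * (M - m) + M * m = M * M" using m by (simp add: add_mult_distrib2[symmetric])
    ultimately show ?thesis by linarith
  qed
  have into: "\<Psi> ` (?A \<times> ?B) \<subseteq> polys_lt (M * M + J)"
  proof (rule image_subsetI)
    fix x assume "x \<in> ?A \<times> ?B"
    then obtain R V where x: "x = (R, V)" and R: "R \<in> ?A" and V: "V \<in> ?B" by blast
    have "(\<Sum>j<J. (R j ^ M + e * f ^ ((M + 1) div 2) * V j ^ M) * monom 1 j) \<in> polys_lt (M * M + J)"
    proof (rule polys_lt_sum)
      fix j assume j: "j \<in> {..<J}"
      have dR: "degree (R j) \<le> M" and dV: "degree (V j) \<le> M - m"
        using R V j by (auto simp: polys_lt_iff PiE_iff less_Suc_eq_le Ball_def)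
      have "degree (R j ^ M) \<le> M * M"
        using dR degree_power_le[of "R j" M] by (meson le_trans mult_le_mono1)
      moreover have "degree (e * f ^ ((M + 1) div 2) * V j ^ M) \<le> M * M"
      proof -
        have "degree (e * f ^ ((M + 1) div 2) * V j ^ M) \<le> degree (e * f ^ ((M + 1) div 2)) + degree (V j ^ M)"
          by (rule degree_mult_le)
        also have "degree (e * f ^ ((M + 1) div 2)) \<le> degree e + degree (f ^ ((M + 1) div 2))"
          by (rule degree_mult_le)
        also have "degree (f ^ ((M + 1) div 2)) \<le> m * ((M + 1) div 2)"
          using degree_power_le[of f "(M + 1) div 2"] degf by simp
        also have "degree (V j ^ M) \<le> M * (M - m)"
          using dV degree_power_le[of "V j" M] by (metis le_trans mult.commute mult_le_mono1)
        finally show ?thesis using e halfM by simp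
      qed
      ultimately have "degree (R j ^ M + e * f ^ ((M + 1) div 2) * V j ^ M) \<le> M * M"
        by (rule degree_add_le)
      then have "degree ((R j ^ M + e * f ^ ((M + 1) div 2) * V j ^ M) * monom 1 j) \<le> M * M + j"
        using degree_mult_le[of "R j ^ M + e * f ^ ((M + 1) div 2) * V j ^ M" "monom 1 j"]
        by (simp add: degree_monom_eq)
      then show "(R j ^ M + e * f ^ ((M + 1) div 2) * V j ^ M) * monom 1 j \<in> polys_lt (M * M + J)"
        using j by (simp add: polys_lt_iff)
    qed
    then show "\<Psi> x \<in> polys_lt (M * M + J)" by (simp add: x \<Psi>_def)
  qed
  have "card (?A \<times> ?B) = CARD('a) ^ (Suc M * J + Suc (M - m) * J)"
    by (simp add: card_cartesian_product card_PiE card_polys_lt power_add power_mult power_mult_distrib)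
  moreover have "card (polys_lt (M * M + J) :: 'a poly set) = CARD('a) ^ (M * M + J)"
    by (rule card_polys_lt)
  moreover have "CARD('a) ^ (M * M + J) < CARD('a) ^ (Suc M * J + Suc (M - m) * J)"
    using unknowns_exceed_conditions[OF m oddM J] card_field_ge_2[where 'a='a]
    by (intro power_strict_increasing) auto
  ultimately have "card (polys_lt (M * M + J) :: 'a poly set) < card (?A \<times> ?B)" by simp
  then have "\<not> inj_on \<Psi> (?A \<times> ?B)"
    using card_inj_on_le[OF _ into] by (meson finite_polys_lt not_le)
  then obtain x y where xy: "x \<in> ?A \<times> ?B" "y \<in> ?A \<times> ?B" "x \<noteq> y" "\<Psi> x = \<Psi> y"
    by (meson inj_onI)
  obtain R V R' V' where RV: "x = (R, V)" "y = (R', V')" by (metis surj_pair)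
  have mem: "R \<in> ?A" "V \<in> ?B" "R' \<in> ?A" "V' \<in> ?B"
    using xy(1,2) unfolding RV by (blast dest: SigmaD1 SigmaD2)+
  have ne: "(R, V) \<noteq> (R', V')" and eq: "\<Psi> (R, V) = \<Psi> (R', V')"
    using xy(3,4) by (simp_all only: RV simp_thms)
  have diff_pow: "(a - b) ^ M = a ^ M - b ^ M" for a b :: "'a poly"
    using add_pow_card_pow_poly[of "a - b" b \<mu>] by (simp add: M)
  show thesis
  proof (rule that[of "\<lambda>j. R j - R' j" "\<lambda>j. V j - V' j"])
    show "R j - R' j \<in> polys_lt (Suc M)" "V j - V' j \<in> polys_lt (Suc (M - m))" if "j < J" for j
      using mem that by (auto intro!: polys_lt_diff)
    show "\<exists>j<J. R j - R' j \<noteq> 0 \<or> V j - V' j \<noteq> 0"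
    proof (rule ccontr)
      assume "\<not> ?thesis"
      then have "R j = R' j" "V j = V' j" if "j \<in> {..<J}" for j using that by auto
      then have "R = R'" "V = V'"
        using PiE_ext[OF mem(1,3)] PiE_ext[OF mem(2,4)] by blast+
      then show False using ne by simp
    qed
    have "(\<Sum>j<J. ((R j - R' j) ^ M + e * f ^ ((M + 1) div 2) * (V j - V' j) ^ M) * monom 1 j) =
      \<Psi> (R, V) - \<Psi> (R', V')"
      by (simp add: \<Psi>_def diff_pow sum_subtractf[symmetric] algebra_simps)
    then show "(\<Sum>j<J. ((R j - R' j) ^ M + e * f ^ ((M + 1) div 2) * (V j - V' j) ^ M) * monom 1 j) = 0"
      using eq by simp
  qed
qed

text \<open>Bombieri's form of Stepanov's method. With \<open>Q = q^(\<mu> + \<nu>)\<close> and \<open>M = q^\<mu>\<close>, every \<open>P\<close> counted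
  here satisfies \<open>X^Q = X\<close> and \<open>f^((Q-1)/2) = a\<close> modulo \<open>P\<close>, so the \<open>M\<close>-th power of the
  auxiliary polynomial reduces to the vanishing combination of \<open>auxiliary_exists\<close>.\<close>
lemma card_chi_eq_le:
  fixes f :: "'a::{field,finite} poly"
  assumes f: "f \<in> monic_deg m" "\<nexists>w. f = w ^ 2" and m: "1 \<le> m" "m \<le> CARD('a) ^ \<mu>"
    and odd: "odd CARD('a)" and \<mu>\<nu>: "\<mu> < \<nu>" and a: "a = 1 \<or> a = - 1"
  shows "(\<mu> + \<nu>) * card {P \<in> monic_irred_deg (\<mu> + \<nu>). chi P f = a}
    \<le> CARD('a) ^ (\<mu> + \<nu>) div 2 + 2 * m * CARD('a) ^ \<nu>"
proof -
  define M where "M = CARD('a) ^ \<mu>"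
  define D where "D = CARD('a) ^ \<nu>"
  define J where "J = (M - 1) div 2 + m"
  define e :: "'a poly" where "e = (if a = 1 then 1 else - 1)"
  let ?n = "\<mu> + \<nu>"
  have q3: "CARD('a) \<ge> 3"
    using card_field_ge_2[where 'a='a] odd by (cases "CARD('a) = 2") auto
  have MD: "CARD('a) ^ ?n = M * D" by (simp add: M_def D_def power_add)
  have oddM: "odd M" and oddD: "odd D" using odd by (simp_all add: M_def D_def)
  have M1: "M \<ge> 1" using oddM by (cases M) auto
  \<comment> \<open>The aim is \<open>3 * M <= D\<close>, which supplies the condition
    \<open>2 * d < q^\<nu>\<close> of \<open>auxiliary_nonzero\<close> with
    \<open>d = M\<close>.\<close>
  have "CARD('a) ^ Suc \<mu> \<le> D"
    unfolding D_def using \<mu>\<nu> q3 by (intro power_increasing) auto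
  moreover have "3 * M \<le> CARD('a) ^ Suc \<mu>" using mult_le_mono1[OF q3, of M] by (simp add: M_def)
  ultimately have "3 * M \<le> D" by linarith
  have degf: "degree f = m" using f(1) by (rule monic_degD)
  obtain R V where R: "\<And>j. j < J \<Longrightarrow> R j \<in> polys_lt (Suc M)"
    and V: "\<And>j. j < J \<Longrightarrow> V j \<in> polys_lt (Suc (M - m))"
    and nz: "\<exists>j<J. R j \<noteq> 0 \<or> V j \<noteq> 0"
    and rel: "(\<Sum>j<J. (R j ^ M + e * f ^ ((M + 1) div 2) * V j ^ M) * monom 1 j) = 0"
  proof (rule auxiliary_exists[OF f(1) m(1) _ _ odd _ J_def])
    show "degree e = 0" by (simp add: e_def)
  qed (use m in \<open>auto simp: M_def\<close>)
  define \<Phi> where "\<Phi> = (\<Sum>j<J. (R j + V j * f ^ ((1 + D) div 2)) * monom 1 (j * D))"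
  have "\<Phi> \<noteq> 0"
  proof
    assume "\<Phi> = 0"
    then have "R j = 0 \<and> V j = 0" if "j < J" for j
      using auxiliary_nonzero[where J = J and R = R and V = V and d = M and \<nu> = \<nu> and j = j, OF f R V] that odd m \<open>3 * M \<le> D\<close> M1
      unfolding \<Phi>_def D_def M_def by auto
    then show False using nz by auto
  qed
  have dvd: "P dvd \<Phi>" if P: "P \<in> monic_irred_deg ?n" and chi: "chi P f = a" for P
  proof -
    interpret odd_prime_modulus P ?n using P odd by unfold_locales
    have fe: "[f ^ ((M * D - 1) div 2) = e] (mod P)"
      using chi a euler_residue[of f] euler_nonresidue[of f] by (auto simp: e_def MD)
    have X: "[monom 1 (j * D) ^ M = monom 1 j] (mod P)" for j
    proof -
      have "[(monom 1 j) ^ (CARD('a) ^ ?n) = monom 1 j] (mod P)" by (rule pow_card_cong)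
      then show ?thesis by (simp add: MD monom_power algebra_simps)
    qed
    have f_pow: "[(f ^ ((1 + D) div 2)) ^ M = e * f ^ ((M + 1) div 2)] (mod P)"
    proof -
      \<comment> \<open>This splits off the Euler exponent \<open>(q^n - 1) div 2\<close> and leaves
        the small power of \<open>f\<close> that appears in \<open>rel\<close>.\<close>
      have "(1 + D) div 2 * M = (M * D - 1) div 2 + (M + 1) div 2"
        using oddM oddD by (auto elim!: oddE simp: algebra_simps)
      then have "(f ^ ((1 + D) div 2)) ^ M = f ^ ((M * D - 1) div 2) * f ^ ((M + 1) div 2)"
        by (simp only: power_mult[symmetric] power_add[symmetric])
      then show ?thesis using cong_mult[OF fe cong_refl] by simp
    qed
    let ?h = "(1 + D) div 2" and ?k = "(M + 1) div 2"
    have pow: "\<Phi> ^ M = (\<Sum>j<J. (R j ^ M + V j ^ M * (f ^ ?h) ^ M) * monom 1 (j * D) ^ M)"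
      unfolding \<Phi>_def M_def
      by (simp add: sum_pow_card_pow_poly power_mult_distrib add_pow_card_pow_poly)
    have c: "[(\<Sum>j<J. (R j ^ M + V j ^ M * (f ^ ?h) ^ M) * monom 1 (j * D) ^ M) =
      (\<Sum>j<J. (R j ^ M + V j ^ M * (e * f ^ ?k)) * monom 1 j)] (mod P)"
      by (rule cong_sum) (rule cong_mult[OF cong_add[OF cong_refl cong_mult[OF cong_refl f_pow]] X])
    have "(\<Sum>j<J. (R j ^ M + V j ^ M * (e * f ^ ?k)) * monom 1 j) =
      (\<Sum>j<J. (R j ^ M + e * f ^ ?k * V j ^ M) * monom 1 j)"
      by (rule sum.cong[OF refl], subst mult.commute[of "V _ ^ M"], rule refl)
    then have "[\<Phi> ^ M = 0] (mod P)" using c unfolding pow rel by simp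
    then have "P dvd \<Phi> ^ M" by (simp only: cong_0_iff)
    then show ?thesis using M1 by (simp add: dvd_power_iff)
  qed
  have "?n * card {P \<in> monic_irred_deg ?n. chi P f = a} =
    (\<Sum>P\<in>{P \<in> monic_irred_deg ?n. chi P f = a}. degree P)"
    by (simp add: monic_irred_deg_def)
  also have "\<dots> \<le> degree \<Phi>"
    using \<open>\<Phi> \<noteq> 0\<close> dvd
    by (intro sum_degree_le finite_subset[OF _ finite_monic_irred_deg[of ?n]])
       (auto simp: monic_irred_deg_iff)
  \<comment> \<open>As \<open>J - 1\<close> is about \<open>M / 2 + m\<close>, the last summand
    carries the leading \<open>q^n / 2\<close>; the powers of \<open>f\<close> cost
    \<open>m * D\<close>.\<close>
  also have "degree \<Phi> \<le> M + m * D + (J - 1) * D"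
    unfolding \<Phi>_def
  proof (rule degree_sum_le)
    fix j assume j: "j \<in> {..<J}"
    have dR: "degree (R j) \<le> M" and dV: "degree (V j) \<le> M - m"
      using R[of j] V[of j] j by (auto simp: polys_lt_iff less_Suc_eq_le)
    have "degree (V j * f ^ ((1 + D) div 2)) \<le> degree (V j) + degree (f ^ ((1 + D) div 2))"
      by (rule degree_mult_le)
    also have "degree (f ^ ((1 + D) div 2)) \<le> m * ((1 + D) div 2)"
      using degree_power_le[of f "(1 + D) div 2"] degf by simp
    also have "\<dots> \<le> m * D" using oddD by (intro mult_left_mono) (auto elim: oddE)
    finally have "degree (V j * f ^ ((1 + D) div 2)) \<le> M + m * D" using dV by simp
    then have "degree (R j + V j * f ^ ((1 + D) div 2)) \<le> M + m * D"
      using dR by (intro degree_add_le) auto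
    moreover have "j * D \<le> (J - 1) * D" using j by (intro mult_right_mono) auto
    moreover have "degree ((R j + V j * f ^ ((1 + D) div 2)) * monom 1 (j * D)) \<le>
      degree (R j + V j * f ^ ((1 + D) div 2)) + j * D"
      by (rule order.trans[OF degree_mult_le]) (simp add: degree_monom_eq)
    ultimately show "degree ((R j + V j * f ^ ((1 + D) div 2)) * monom 1 (j * D)) \<le> M + m * D + (J - 1) * D"
      by linarith
  qed simp
  also have "\<dots> \<le> M * D div 2 + 2 * m * D"
  proof -
    obtain c where c: "M = 2 * c + 1" using oddM by (elim oddE)
    obtain m' where m': "m = Suc m'" using m by (cases m) auto
    have J: "J - 1 = c + m'" by (simp add: J_def c m')
    have "c * D \<le> M * D div 2" by (simp add: c algebra_simps)
    moreover have "M \<le> D" using \<open>3 * M \<le> D\<close> by simp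
    ultimately show ?thesis unfolding J by (simp add: m' algebra_simps)
  qed
  finally show ?thesis by (simp add: MD D_def)
qed

text \<open>Stepanov's method bounds the count of each sign from above only. Both signs together
  make up almost all irreducibles of degree \<open>n\<close>, so each upper bound is also a lower
  bound for the other sign.\<close>

lemma character_sum_bound:
  fixes f :: "'a::{field,finite} poly"
  assumes f: "f \<in> monic_deg m" "\<nexists>w. f = w ^ 2" and m: "m \<le> CARD('a) ^ g"
    and odd: "odd CARD('a)" and n: "n \<in> {2 * g + 1, 2 * g + 2}"
  shows "real n * \<bar>\<Sum>P\<in>monic_irred_deg n. chi P f\<bar> \<le> 7 * real m * real CARD('a) ^ (g + 2)"
proof -
  \<comment> \<open>The most balanced splitting \<open>n = \<mu> + \<nu>\<close> with
    \<open>\<mu> < \<nu>\<close> is \<open>\<mu> = g\<close>; it gives the error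
    \<open>q^\<nu>\<close>, which is of the order of \<open>q^(n/2)\<close>.\<close>
  define \<nu> where "\<nu> = n - g"
  have \<nu>: "n = g + \<nu>" "g < \<nu>" "n div 2 \<le> \<nu>" "\<nu> \<le> g + 2" and n0: "n > 0" using n by (auto simp: \<nu>_def)
  let ?q = "CARD('a)"
  let ?S = "monic_irred_deg n :: 'a poly set"
  let ?N = "\<lambda>a. card {P \<in> ?S. chi P f = a}"
  have q: "?q \<ge> 2" by (rule card_field_ge_2)
  have m1: "1 \<le> m"
  proof (rule ccontr)
    assume "\<not> 1 \<le> m"
    then have "degree f = 0" using f(1) by (simp add: monic_degD)
    then obtain c where "f = [:c:]" by (rule degree_eq_zeroE)
    then have "f = 1" using f(1) by (simp add: monic_deg_def one_pCons)
    then show False using f(2) by (metis one_power2)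
  qed
  have up: "n * ?N a \<le> ?q ^ n div 2 + 2 * m * ?q ^ \<nu>" if "a = 1 \<or> a = -1" for a
    using card_chi_eq_le[OF f m1 m odd \<nu>(2) that] \<nu>(1) by simp
  have fnz: "f \<noteq> 0" using f(1) by (rule monic_degD)
  have zero: "n * ?N 0 \<le> m"
  proof -
    have "(\<Sum>P\<in>{P \<in> ?S. chi P f = 0}. degree P) = (\<Sum>P\<in>{P \<in> ?S. chi P f = 0}. n)"
      by (rule sum.cong) (auto simp: monic_irred_deg_iff)
    then have "n * ?N 0 = (\<Sum>P\<in>{P \<in> ?S. chi P f = 0}. degree P)" by simp
    also have "\<dots> \<le> degree f"
    proof (rule sum_degree_le)
      show "finite {P \<in> ?S. chi P f = 0}" by (rule finite_subset[of _ ?S]) auto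
      fix P assume P: "P \<in> {P \<in> ?S. chi P f = 0}"
      then show "monic_irred P" by (simp add: monic_irred_deg_iff)
      show "P dvd f"
      proof (rule ccontr)
        assume "\<not> P dvd f"
        then have "chi P f \<noteq> 0" by (simp add: chi_def)
        then show False using P by simp
      qed
    qed (rule fnz)
    finally show ?thesis by (simp only: monic_degD(1)[OF f(1)])
  qed
  have chi_vals: "chi P f = 0 \<or> chi P f = 1 \<or> chi P f = -1" for P by (simp add: chi_def)
  have un: "?S = {P \<in> ?S. chi P f = 0} \<union> {P \<in> ?S. chi P f = 1} \<union> {P \<in> ?S. chi P f = -1}"
    using chi_vals by blast
  have fin: "finite {P \<in> ?S. chi P f = a}" for a by (rule finite_subset[of _ ?S]) auto
  have card: "card ?S = ?N 0 + ?N 1 + ?N (-1)"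
  proof -
    have "card ?S = card ({P \<in> ?S. chi P f = 0} \<union> {P \<in> ?S. chi P f = 1} \<union> {P \<in> ?S. chi P f = -1})"
      by (rule arg_cong[OF un])
    also have "\<dots> = card ({P \<in> ?S. chi P f = 0} \<union> {P \<in> ?S. chi P f = 1}) + ?N (-1)"
      by (rule card_Un_disjoint) (use fin in auto)
    also have "card ({P \<in> ?S. chi P f = 0} \<union> {P \<in> ?S. chi P f = 1}) = ?N 0 + ?N 1"
      by (rule card_Un_disjoint) (use fin in auto)
    finally show ?thesis .
  qed
  have sum: "(\<Sum>P\<in>?S. chi P f) = real (?N 1) - real (?N (-1))"
  proof -
    have "(\<Sum>P\<in>?S. chi P f) = (\<Sum>P\<in>?S. of_bool (chi P f = 1) - of_bool (chi P f = -1))"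
    proof (rule sum.cong[OF refl])
      show "chi P f = of_bool (chi P f = 1) - of_bool (chi P f = -1)" for P
        using chi_vals[of P] by (elim disjE) simp_all
    qed
    also have "\<dots> = real (?N 1) - real (?N (-1))"
      by (simp add: sum_subtractf of_bool_def sum.If_cases Int_def)
    finally show ?thesis .
  qed
  have low: "?q ^ n \<le> n * card ?S + 2 * ?q ^ (n div 2)"
    by (rule card_monic_irred_deg_ge[OF n0])
  have "?q ^ (n div 2) \<le> ?q ^ \<nu>" using q \<nu> by (intro power_increasing) auto
  also have "\<dots> \<le> m * ?q ^ \<nu>" using m1 by simp
  finally have half: "?q ^ (n div 2) \<le> m * ?q ^ \<nu>" .
  have mm: "m \<le> m * ?q ^ \<nu>" using q by simp
  let ?E = "m * ?q ^ \<nu>"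
  define A B where "A = n * ?N 1" and "B = n * ?N (-1)"
  have "n * card ?S = n * ?N 0 + A + B" unfolding A_def B_def by (simp only: card distrib_left)
  \<comment> \<open>Of \<open>3 * ?E\<close>, one part is for the \<open>P\<close> dividing
    \<open>f\<close> and two are for the irreducibles of lower degree. With \<open>2 * ?E\<close>
    from each upper bound this makes the constant 7.\<close>
  then have all: "?q ^ n \<le> A + B + 3 * ?E" using low zero half mm by linarith
  have A: "A \<le> ?q ^ n div 2 + 2 * ?E" and B: "B \<le> ?q ^ n div 2 + 2 * ?E"
    unfolding A_def B_def using up[of 1] up[of "-1"] by (simp_all add: mult.assoc)
  have "2 * (?q ^ n div 2) \<le> ?q ^ n" by simp
  then have "A \<le> B + 7 * ?E" "B \<le> A + 7 * ?E" using all A B by linarith+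
  then have "real A \<le> real (B + 7 * ?E)" "real B \<le> real (A + 7 * ?E)"
    by (simp_all only: of_nat_le_iff)
  moreover have "real n * (\<Sum>P\<in>?S. chi P f) = real A - real B"
    unfolding sum A_def B_def by (simp add: right_diff_distrib)
  ultimately have "\<bar>real n * (\<Sum>P\<in>?S. chi P f)\<bar> \<le> 7 * real ?E"
    by (simp only: of_nat_add of_nat_mult of_nat_numeral abs_le_iff) linarith
  also have "real ?E \<le> real m * real ?q ^ (g + 2)"
    unfolding of_nat_mult of_nat_power using q \<nu> by (intro mult_left_mono power_increasing) auto
  finally show ?thesis by (simp add: abs_mult mult.assoc)
qed

section \<open>The functional equation\<close>

lemma sum_affine_eq_0:
  fixes h :: "'a::{field,finite} \<Rightarrow> real"
  assumes "(\<Sum>t\<in>UNIV. h t) = 0" "r \<noteq> 0"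
  shows "(\<Sum>t\<in>UNIV. h (c + t * r)) = 0"
proof -
  have "bij_betw (\<lambda>t. c + t * r) UNIV UNIV"
    using assms(2) by (intro bij_betwI[where g = "\<lambda>t. (t - c) / r"]) auto
  from sum.reindex_bij_betw[OF this, of h] show ?thesis using assms(1) by simp
qed

lemma bij_betw_polys_lt_translate:
  "w \<in> polys_lt d \<Longrightarrow> bij_betw (\<lambda>x. x + w) (polys_lt d) (polys_lt d :: 'a::field poly set)"
  by (rule bij_betwI[where g = "\<lambda>x. x - w"]) (auto intro: polys_lt_add polys_lt_diff)

lemma coeff_square_polys_lt:
  fixes x :: "'a::field poly"
  assumes "x \<in> polys_lt (Suc g)"
  shows "coeff (x * x) (2 * g) = coeff x g * coeff x g"
proof -
  have "coeff (x * x) (2 * g) = (\<Sum>i\<le>2 * g. coeff x i * coeff x (2 * g - i))" by (rule coeff_mult)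
  also have "\<dots> = (\<Sum>i\<in>{g}. coeff x i * coeff x (2 * g - i))"
  proof (rule sum.mono_neutral_right)
    have "coeff x i = 0 \<or> coeff x (2 * g - i) = 0" if "i \<le> 2 * g" "i \<noteq> g" for i
    proof (cases "g < i")
      case False
      then have "g < 2 * g - i" using that by simp
      then show ?thesis using assms by (simp add: polys_lt_def)
    qed (use assms in \<open>simp add: polys_lt_def\<close>)
    then show "\<forall>i\<in>{..2 * g} - {g}. coeff x i * coeff x (2 * g - i) = 0" by auto
  qed auto
  finally show ?thesis by simp
qed

lemma polys_lt_SucE:
  fixes w :: "'a::field poly"
  assumes "w \<in> polys_lt (Suc d)"
  obtains c f where "f \<in> polys_lt d" "w = monom c d + f"
proof -
  have "w \<in> (\<lambda>(c, f). monom c d + f) ` (UNIV \<times> polys_lt d)"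
    using assms by (simp add: bij_betw_imp_surj_on[OF bij_betw_polys_lt_Suc])
  then show thesis by (auto intro: that)
qed

section \<open>The residue pairing and Gauss sums\<close>

context odd_prime_modulus
begin

text \<open>The coefficient of \<open>1/X\<close> in the Laurent expansion of \<open>x / P\<close> at infinity.\<close>
definition res :: "'a poly \<Rightarrow> 'a" where
  "res x = coeff (x mod P) (n - 1)"

lemma res_add: "res (x + y) = res x + res y"
  by (simp add: res_def poly_mod_add_left)

lemma res_smult: "res (smult c x) = c * res x"
  by (simp add: res_def mod_smult_left)

lemma res_mod [simp]: "res (x mod P) = res x"
  by (simp add: res_def)

lemma res_polys_lt: "x \<in> polys_lt n \<Longrightarrow> res x = coeff x (n - 1)"
  by (simp add: res_def mod_polys_lt)

lemma res_0 [simp]: "res 0 = 0"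
  by (simp add: res_def)

lemma res_mult_eq_0:
  assumes "\<And>i. i < d \<Longrightarrow> res (y * monom 1 i) = 0" "w \<in> polys_lt d"
  shows "res (y * w) = 0"
  using assms
proof (induction d arbitrary: w)
  case (Suc d)
  from Suc.prems(2) obtain c f where w: "f \<in> polys_lt d" "w = monom c d + f" by (rule polys_lt_SucE)
  have "y * w = smult c (y * monom 1 d) + y * f"
    by (simp add: w algebra_simps smult_monom flip: mult_smult_right)
  then show ?case using Suc.prems(1)[of d] Suc.IH[OF Suc.prems(1) w(1)] by (simp add: res_add res_smult)
qed simp

text \<open>Orthogonality without characters: the functional sending \<open>w\<close> to
  \<open>res (y * w)\<close> is either zero or takes every value equally often, and in the second
  case the zero sum of \<open>h\<close> kills everything.\<close>

lemma sum_res_affine: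
  fixes h :: "'a \<Rightarrow> real"
  assumes h: "(\<Sum>t\<in>UNIV. h t) = 0"
  shows "(\<Sum>w\<in>polys_lt d. h (c + res (y * w))) =
    (if \<forall>i<d. res (y * monom 1 i) = 0 then real CARD('a) ^ d * h c else 0)"
proof (cases "\<forall>i<d. res (y * monom 1 i) = 0")
  case True
  then have "res (y * w) = 0" if "w \<in> polys_lt d" for w using that res_mult_eq_0 by blast
  then show ?thesis using True by (simp add: card_polys_lt)
next
  case False
  then obtain i where i: "i < d" "res (y * monom 1 i) \<noteq> 0" by auto
  let ?r = "res (y * monom 1 i)"
  let ?S = "\<Sum>w\<in>polys_lt d. h (c + res (y * w))"
  have shift: "res (y * (w + monom t i)) = res (y * w) + t * ?r" for w t
  proof -
    have "y * (w + monom t i) = y * w + smult t (y * monom 1 i)"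
      by (simp add: algebra_simps smult_monom flip: mult_smult_right)
    then show ?thesis by (simp add: res_add res_smult)
  qed
  have *: "?S = (\<Sum>w\<in>polys_lt d. h ((c + res (y * w)) + t * ?r))" for t
  proof -
    have "monom t i \<in> polys_lt d" using i(1) by (rule monom_in_polys_lt)
    from sum.reindex_bij_betw[OF bij_betw_polys_lt_translate[OF this], of "\<lambda>w. h (c + res (y * w))"]
    show ?thesis by (simp add: shift add.assoc)
  qed
  have "(\<Sum>t\<in>(UNIV::'a set). ?S) = (\<Sum>t\<in>UNIV. \<Sum>w\<in>polys_lt d. h ((c + res (y * w)) + t * ?r))"
    by (rule sum.cong[OF refl]) (rule *)
  also have "\<dots> = (\<Sum>w\<in>polys_lt d. \<Sum>t\<in>UNIV. h ((c + res (y * w)) + t * ?r))"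
    by (rule sum.swap)
  also have "\<dots> = 0" using sum_affine_eq_0[OF h i(2)] by simp
  finally have "?S = 0" by simp
  then show ?thesis using False by auto
qed

lemma res_mult_monom:
  assumes "y \<in> polys_lt (n - d)" "d < n"
  shows "res (y * monom 1 d) = coeff y (n - 1 - d)"
proof -
  have "coeff (y * monom 1 d) i = (if i < d then 0 else coeff y (i - d))" for i
    using coeff_monom_mult[of 1 d y i] by (simp add: mult.commute)
  moreover from this have "y * monom 1 d \<in> polys_lt n"
    using assms by (auto simp: polys_lt_def)
  ultimately show ?thesis using assms(2) by (simp add: res_polys_lt)
qed

text \<open>For the pairing \<open>res (y * w)\<close> the orthogonal complement of
  \<open>polys_lt d\<close> is \<open>polys_lt (n - d)\<close>: each further condition removes the
  current top coefficient of \<open>y\<close>.\<close>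

lemma res_vanish_iff:
  assumes "y \<in> polys_lt n" "d \<le> n"
  shows "(\<forall>i<d. res (y * monom 1 i) = 0) \<longleftrightarrow> y \<in> polys_lt (n - d)"
  using assms(2)
proof (induction d)
  case (Suc d)
  have "(\<forall>i<Suc d. res (y * monom 1 i) = 0) \<longleftrightarrow> y \<in> polys_lt (n - d) \<and> res (y * monom 1 d) = 0"
    using Suc by (auto simp: less_Suc_eq)
  also have "\<dots> \<longleftrightarrow> y \<in> polys_lt (n - d) \<and> coeff y (n - Suc d) = 0"
    using Suc.prems res_mult_monom[of y d] by auto
  also have "\<dots> \<longleftrightarrow> y \<in> polys_lt (n - Suc d)"
  proof -
    have "n - d = Suc (n - Suc d)" using Suc.prems by simp
    then show ?thesis by (auto simp: polys_lt_def le_Suc_eq Suc_le_eq not_less_eq_eq)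
       (metis le_neq_implies_less)
  qed
  finally show ?case .
qed (use assms(1) in simp)

text \<open>The function \<open>h\<close> takes the place of an additive character of the field: it only has to
  sum to zero. It will be the quadratic character of constants when \<open>n\<close> is odd, and
  \<open>q * of_bool (t = 0) - 1\<close> when \<open>n\<close> is even.\<close>
definition gauss_sum :: "('a \<Rightarrow> real) \<Rightarrow> real" where
  "gauss_sum h = (\<Sum>y\<in>polys_lt n. chi P y * h (res y))"

text \<open>The coefficient of \<open>q^(-d s)\<close> in the L-function of
  \<open>chi P\<close>.\<close>

definition char_sum :: "nat \<Rightarrow> real" where
  "char_sum d = (\<Sum>f\<in>monic_deg d. chi P f)"

lemma gauss_sum_twist:
  assumes "\<not> P dvd b"
  shows "(\<Sum>y\<in>polys_lt n. chi P y * h (res (b * y))) = chi P b * gauss_sum h"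
proof -
  let ?L = "\<Sum>y\<in>polys_lt n. chi P y * h (res (b * y))"
  have "gauss_sum h = (\<Sum>y\<in>polys_lt n. chi P (b * y mod P) * h (res (b * y mod P)))"
    unfolding gauss_sum_def
    using sum.reindex_bij_betw[OF bij_betw_times_mod[OF assms], of "\<lambda>y. chi P y * h (res y)"] by simp
  also have "\<dots> = chi P b * ?L"
    by (simp add: chi_mult sum_distrib_left mult.assoc)
  finally have "chi P b * gauss_sum h = (chi P b * chi P b) * ?L" by simp
  moreover have "chi P b * chi P b = 1" using chi_cases[of b] assms chi_eq_0_iff[of b] by auto
  ultimately show ?thesis by simp
qed

text \<open>In the weight \<open>1 + chi P y\<close> of \<open>sum_square_residues\<close> the
  summand 1 contributes nothing, because \<open>res\<close> takes all values equally often.\<close>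

lemma gauss_sum_eq_sum_squares:
  assumes h: "(\<Sum>t\<in>UNIV. h t) = 0"
  shows "gauss_sum h = (\<Sum>x\<in>polys_lt n. h (res (x ^ 2)))"
proof -
  have "res (monom 1 (n - 1)) = 1"
    using n_pos by (simp add: res_polys_lt monom_in_polys_lt)
  then have "(\<Sum>y\<in>polys_lt n. h (res y)) = 0"
    using sum_res_affine[OF h, where d = n and c = 0 and y = 1] n_pos
    by (auto split: if_splits dest: spec[of _ "n - 1"])
  moreover have "(\<Sum>x\<in>polys_lt n. h (res (x ^ 2 mod P))) = (\<Sum>y\<in>polys_lt n. (1 + chi P y) * h (res y))"
    by (rule sum_square_residues)
  ultimately show ?thesis by (simp add: gauss_sum_def algebra_simps sum.distrib)
qed

text \<open>The quadratic form \<open>x \<mapsto> res (x\<^sup>2)\<close> vanishes on polynomials of degree less than \<open>e\<close>;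
  averaging over that isotropic subspace leaves only its orthogonal complement.\<close>
lemma gauss_sum_isotropic:
  assumes h: "(\<Sum>t\<in>UNIV. h t) = 0" and e: "2 * e \<le> n"
  shows "gauss_sum h = (\<Sum>x\<in>polys_lt (n - e). h (res (x ^ 2)))"
proof -
  have le: "polys_lt e \<subseteq> (polys_lt n :: 'a poly set)" using e by (auto intro: polys_lt_mono)
  have iso: "res (w ^ 2) = 0" if w: "w \<in> polys_lt e" for w
  proof (cases e)
    case (Suc e')
    then have "w * w \<in> polys_lt (Suc (e' + e'))" using w by (intro polys_lt_mult) auto
    then have w2: "w ^ 2 \<in> polys_lt (n - 1)"
      using Suc e by (auto simp: power2_eq_square intro: polys_lt_mono)
    then have "w ^ 2 \<in> polys_lt n" by (rule polys_lt_mono) simp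
    then show ?thesis using w2 by (simp add: res_polys_lt polys_lt_def)
  qed (use w in simp)
  have expand: "res ((x + w) ^ 2) = res (x ^ 2) + res (smult 2 x * w)" if "w \<in> polys_lt e" for x w
  proof -
    have "(x + w) ^ 2 = x ^ 2 + smult 2 x * w + w ^ 2"
      using smult_add_left[of 1 1 x] by (simp add: power2_eq_square algebra_simps)
    then show ?thesis using iso[OF that] by (simp add: res_add)
  qed
  have "real CARD('a) ^ e * gauss_sum h = (\<Sum>w\<in>(polys_lt e :: 'a poly set). gauss_sum h)"
    by (simp add: card_polys_lt)
  also have "\<dots> = (\<Sum>w\<in>polys_lt e. \<Sum>x\<in>polys_lt n. h (res ((x + w) ^ 2)))"
  proof (rule sum.cong[OF refl])
    fix w :: "'a poly" assume "w \<in> polys_lt e"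
    then have "w \<in> polys_lt n" using le by auto
    from sum.reindex_bij_betw[OF bij_betw_polys_lt_translate[OF this], of "\<lambda>x. h (res (x ^ 2))"]
    show "gauss_sum h = (\<Sum>x\<in>polys_lt n. h (res ((x + w) ^ 2)))"
      by (simp add: gauss_sum_eq_sum_squares[OF h])
  qed
  also have "\<dots> = (\<Sum>x\<in>polys_lt n. \<Sum>w\<in>polys_lt e. h (res (x ^ 2) + res (smult 2 x * w)))"
    by (subst sum.swap) (simp add: expand cong: sum.cong)
  also have "\<dots> = (\<Sum>x\<in>polys_lt n. if x \<in> polys_lt (n - e) then real CARD('a) ^ e * h (res (x ^ 2)) else 0)"
  proof (rule sum.cong[OF refl])
    fix x :: "'a poly" assume x: "x \<in> polys_lt n"
    have "(\<forall>i<e. res (smult 2 x * monom 1 i) = 0) \<longleftrightarrow> smult 2 x \<in> polys_lt (n - e)"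
      using x e by (intro res_vanish_iff polys_lt_smult) auto
    also have "\<dots> \<longleftrightarrow> x \<in> polys_lt (n - e)" using two_neq_0 by (simp add: polys_lt_def)
    finally show "(\<Sum>w\<in>polys_lt e. h (res (x ^ 2) + res (smult 2 x * w))) =
      (if x \<in> polys_lt (n - e) then real CARD('a) ^ e * h (res (x ^ 2)) else 0)"
      unfolding sum_res_affine[OF h] by simp
  qed
  also have "\<dots> = (\<Sum>x\<in>polys_lt n \<inter> polys_lt (n - e). real CARD('a) ^ e * h (res (x ^ 2)))"
    by (simp add: sum.inter_restrict)
  also have "polys_lt n \<inter> polys_lt (n - e) = (polys_lt (n - e) :: 'a poly set)"
    by (auto intro: polys_lt_mono)
  finally show ?thesis by (simp flip: sum_distrib_left)
qed

lemma not_dvd_monic_deg: "f \<in> monic_deg d \<Longrightarrow> d < n \<Longrightarrow> \<not> P dvd f"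
  by (metis degP dvd_imp_degree_le monic_degD(1) monic_degD(4) not_le)

text \<open>Poisson summation. The Gauss sum turns \<open>chi P f\<close> into a sum of
  \<open>h (res (f * y))\<close>. With \<open>f = X^d + w\<close> and \<open>w\<close> free, only
  the complement \<open>polys_lt (n - d)\<close> survives, and on it the term \<open>X^d\<close>
  reads off the top coefficient of \<open>y\<close>.\<close>

lemma char_sum_gauss_sum:
  assumes h: "(\<Sum>t\<in>UNIV. h t) = 0" and d: "d < n"
  shows "char_sum d * gauss_sum h =
    real CARD('a) ^ d * (\<Sum>y\<in>polys_lt (n - d). chi P y * h (coeff y (n - 1 - d)))"
proof -
  have "char_sum d * gauss_sum h = (\<Sum>f\<in>monic_deg d. \<Sum>y\<in>polys_lt n. chi P y * h (res (f * y)))"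
    using d by (simp add: char_sum_def sum_distrib_right gauss_sum_twist not_dvd_monic_deg cong: sum.cong)
  also have "\<dots> = (\<Sum>y\<in>polys_lt n. chi P y * (\<Sum>f\<in>monic_deg d. h (res (f * y))))"
    by (subst sum.swap) (simp add: sum_distrib_left)
  also have "\<dots> = (\<Sum>y\<in>polys_lt n. if y \<in> polys_lt (n - d)
     then chi P y * (real CARD('a) ^ d * h (coeff y (n - 1 - d))) else 0)"
  proof (rule sum.cong[OF refl])
    fix y :: "'a poly" assume y: "y \<in> polys_lt n"
    have "(\<Sum>f\<in>monic_deg d. h (res (f * y))) = (\<Sum>w\<in>polys_lt d. h (res (y * monom 1 d) + res (y * w)))"
      by (simp add: sum_monic_deg ring_distribs res_add mult.commute)
    also have "\<dots> = (if y \<in> polys_lt (n - d) then real CARD('a) ^ d * h (res (y * monom 1 d)) else 0)"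
      using res_vanish_iff[OF y, of d] d by (simp add: sum_res_affine[OF h])
    finally show "chi P y * (\<Sum>f\<in>monic_deg d. h (res (f * y))) =
      (if y \<in> polys_lt (n - d) then chi P y * (real CARD('a) ^ d * h (coeff y (n - 1 - d))) else 0)"
      using res_mult_monom[OF _ d] by simp
  qed
  also have "\<dots> = (\<Sum>y\<in>polys_lt n \<inter> polys_lt (n - d). chi P y * (real CARD('a) ^ d * h (coeff y (n - 1 - d))))"
    by (rule sum.inter_restrict[symmetric]) simp
  also have "polys_lt n \<inter> polys_lt (n - d) = (polys_lt (n - d) :: 'a poly set)"
    by (auto intro: polys_lt_mono)
  finally show ?thesis by (simp add: sum_distrib_left mult.left_commute)
qed

lemma sum_chi_leading_coeff:
  assumes "c \<noteq> 0"
  shows "(\<Sum>f\<in>polys_lt m. chi P (monom c m + f)) = chi P [:c:] * char_sum m"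
proof -
  have bij: "bij_betw (smult c) (polys_lt m) (polys_lt m)"
    using assms by (intro bij_betwI[where g = "smult (inverse c)"]) (auto intro: polys_lt_smult)
  have "(\<Sum>f\<in>polys_lt m. chi P (monom c m + f)) = (\<Sum>f\<in>polys_lt m. chi P (monom c m + smult c f))"
    using sum.reindex_bij_betw[OF bij, of "\<lambda>f. chi P (monom c m + f)"] by simp
  also have "monom c m + smult c f = [:c:] * (monom 1 m + f)" for f
    by (simp add: smult_monom algebra_simps)
  then have "(\<Sum>f\<in>polys_lt m. chi P (monom c m + smult c f)) = chi P [:c:] * char_sum m"
    by (simp add: chi_mult char_sum_def sum_monic_deg sum_distrib_left del: mult_pCons_left)
  finally show ?thesis .
qed

lemma sum_chi_by_leading_coeff:
  "(\<Sum>y\<in>polys_lt (Suc m). chi P y * h (coeff y m)) =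
    h 0 * (\<Sum>y\<in>polys_lt m. chi P y) + (\<Sum>c\<in>UNIV - {0}. chi P [:c:] * h c) * char_sum m"
proof -
  have "(\<Sum>y\<in>polys_lt (Suc m). chi P y * h (coeff y m)) =
     (\<Sum>c\<in>UNIV. \<Sum>f\<in>polys_lt m. chi P (monom c m + f) * h c)"
    unfolding sum_polys_lt_Suc by (intro sum.cong refl) (simp add: polys_lt_def)
  also have "\<dots> = (\<Sum>c\<in>UNIV. h c * (\<Sum>f\<in>polys_lt m. chi P (monom c m + f)))"
    by (simp add: sum_distrib_left mult.commute)
  also have "\<dots> = h 0 * (\<Sum>f\<in>polys_lt m. chi P f) + (\<Sum>c\<in>UNIV - {0}. h c * (\<Sum>f\<in>polys_lt m. chi P (monom c m + f)))"
    by (subst sum.remove[of _ 0]) auto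
  also have "(\<Sum>c\<in>UNIV - {0}. h c * (\<Sum>f\<in>polys_lt m. chi P (monom c m + f))) = (\<Sum>c\<in>UNIV - {0}. chi P [:c:] * h c) * char_sum m"
    unfolding sum_distrib_right by (rule sum.cong) (auto simp: sum_chi_leading_coeff)
  finally show ?thesis .
qed

text \<open>Translations by residues \<open>u\<close> permute the monic polynomials of degree
  \<open>d >= n\<close>. Averaging over all \<open>u\<close> replaces every value by a full sum over
  residues, which is zero.\<close>

lemma char_sum_eq_0:
  assumes "n \<le> d"
  shows "char_sum d = 0"
proof -
  have "real CARD('a) ^ n * char_sum d = (\<Sum>u\<in>(polys_lt n :: 'a poly set). char_sum d)" by (simp add: card_polys_lt)
  also have "\<dots> = (\<Sum>u\<in>polys_lt n. \<Sum>f\<in>polys_lt d. chi P (monom 1 d + (f + u)))"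
  proof (rule sum.cong[OF refl])
    fix u :: "'a poly" assume "u \<in> polys_lt n"
    then have "u \<in> polys_lt d" using assms by (rule polys_lt_mono)
    from sum.reindex_bij_betw[OF bij_betw_polys_lt_translate[OF this], of "\<lambda>f. chi P (monom 1 d + f)"]
    show "char_sum d = (\<Sum>f\<in>polys_lt d. chi P (monom 1 d + (f + u)))"
      by (simp add: char_sum_def sum_monic_deg)
  qed
  also have "\<dots> = (\<Sum>f\<in>polys_lt d. \<Sum>u\<in>polys_lt n. chi P (u + (monom 1 d + f) mod P))"
  proof (subst sum.swap, intro sum.cong refl)
    fix f u :: "'a poly"
    show "chi P (monom 1 d + (f + u)) = chi P (u + (monom 1 d + f) mod P)"
      by (rule chi_cong) (simp add: cong_def mod_add_right_eq add_ac)
  qed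
  also have "\<dots> = (\<Sum>f\<in>(polys_lt d :: 'a poly set). \<Sum>u\<in>polys_lt n. chi P u)"
  proof (rule sum.cong[OF refl])
    fix f :: "'a poly"
    show "(\<Sum>u\<in>polys_lt n. chi P (u + (monom 1 d + f) mod P)) = (\<Sum>u\<in>polys_lt n. chi P u)"
      by (rule sum.reindex_bij_betw[OF bij_betw_polys_lt_translate]) simp
  qed
  finally show ?thesis by (simp add: sum_chi_residues)
qed

section \<open>Values of the character on constants\<close>

lemma half_card_eq: "(CARD('a) ^ n - 1) div 2 = (CARD('a) - 1) div 2 * (\<Sum>i<n. CARD('a) ^ i)"
proof -
  let ?N = "\<Sum>i<n. CARD('a) ^ i"
  obtain b where b: "CARD('a) = 2 * b + 1" using odd_card by (elim oddE)
  have "CARD('a) ^ n = (CARD('a) - 1) * ?N + 1"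
  proof (induction n)
    case (Suc n)
    then show ?case using b by (simp add: algebra_simps)
  qed simp
  then have "CARD('a) ^ n - 1 = 2 * (b * ?N)" using b by simp
  then show ?thesis using b by simp
qed

lemma const_half_power_cases:
  assumes "c \<noteq> (0::'a)"
  shows "c ^ ((CARD('a) - 1) div 2) = 1 \<or> c ^ ((CARD('a) - 1) div 2) = - 1"
proof -
  let ?u = "c ^ ((CARD('a) - 1) div 2)"
  have "c * c ^ (CARD('a) - 1) = c"
    using field_pow_card[of c] card_field_ge_2[where 'a='a]
    by (metis Suc_diff_1 gr0I not_numeral_le_zero power_Suc)
  then have "c ^ (CARD('a) - 1) = 1" using assms by simp
  moreover have "2 * ((CARD('a) - 1) div 2) = CARD('a) - 1" using odd_card by simp
  ultimately have "?u ^ 2 = 1" by (metis mult.commute power_mult)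
  then show ?thesis by (simp add: power2_eq_1_iff)
qed

text \<open>The base on the right is 1 or -1 for \<open>c\<close> nonzero, and the geometric sum has
  the parity of \<open>n\<close>. So \<open>chi P\<close> is trivial on nonzero constants for even
  \<open>n\<close>, and is the quadratic character of the field for odd \<open>n\<close>.\<close>

lemma const_euler: "[:c:] ^ ((CARD('a) ^ n - 1) div 2) = [:(c ^ ((CARD('a) - 1) div 2)) ^ (\<Sum>i<n. CARD('a) ^ i):]"
  unfolding half_card_eq by (simp add: poly_const_pow power_mult)

lemma parity_geometric: "even (\<Sum>i<n. CARD('a) ^ i) \<longleftrightarrow> even n"
  using odd_card by (induction n) auto

lemma not_cong_neg_one: "\<not> [- 1 = 1] (mod P)"
  using not_dvd_two by (auto simp: cong_iff simp flip: dvd_minus_iff[of P "- 2"])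

lemma chi_const_even:
  assumes "even n" "c \<noteq> 0"
  shows "chi P [:c:] = 1"
proof -
  let ?N = "\<Sum>i<n. CARD('a) ^ i"
  have "even ?N" using assms parity_geometric by simp
  then have "(c ^ ((CARD('a) - 1) div 2)) ^ ?N = 1"
    using const_half_power_cases[OF assms(2)] by (auto simp: power_minus_even)
  then have *: "[:c:] ^ ((CARD('a) ^ n - 1) div 2) = 1"
    unfolding const_euler by (simp add: one_pCons)
  have "chi P [:c:] \<noteq> -1"
  proof
    assume "chi P [:c:] = -1"
    then have "[1 = -1] (mod P)" using euler_nonresidue[of "[:c:]"] * by simp
    then show False using not_cong_neg_one cong_sym by blast
  qed
  moreover have "chi P [:c:] \<noteq> 0" using not_dvd_const assms(2) by (simp add: chi_eq_0_iff)
  ultimately show ?thesis using chi_cases by blast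
qed

text \<open>Too few roots of \<open>X^((q-1)/2) - 1\<close> exist for all nonzero constants, so some
  constant has character -1; multiplying by it negates the sum.\<close>

lemma sum_chi_const_odd:
  assumes "odd n"
  shows "(\<Sum>c\<in>UNIV. chi P [:c:]) = 0"
proof -
  let ?N = "\<Sum>i<n. CARD('a) ^ i"
  let ?h = "(CARD('a) - 1) div 2"
  have q3: "CARD('a) \<ge> 3"
    using card_field_ge_2[where 'a='a] odd_card by (cases "CARD('a) = 2") auto
  have "\<exists>c::'a. c \<noteq> 0 \<and> c ^ ?h \<noteq> 1"
  proof (rule ccontr)
    assume "\<not> ?thesis"
    then have sub: "UNIV - {0} \<subseteq> {c::'a. poly (monom 1 ?h - 1) c = 0}" by (auto simp: poly_monom)
    have h0: "?h > 0" using q3 by simp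
    have deg: "degree (monom 1 ?h - 1 :: 'a poly) \<le> ?h"
      by (rule degree_diff_le) (auto simp: degree_monom_eq)
    have "monom 1 ?h - 1 \<noteq> (0::'a poly)"
    proof
      assume "monom 1 ?h - 1 = (0::'a poly)"
      then have "degree (monom 1 ?h :: 'a poly) = degree (1 :: 'a poly)" by simp
      then show False using h0 by (simp add: degree_monom_eq)
    qed
    then have "card {c::'a. poly (monom 1 ?h - 1) c = 0} \<le> ?h" "finite {c::'a. poly (monom 1 ?h - 1) c = 0}"
      using card_poly_roots_bound deg le_trans poly_roots_finite by blast+
    then have "CARD('a) - 1 \<le> ?h"
      using card_mono[OF _ sub] by (simp add: card_Diff_singleton)
    then show False using q3 by linarith
  qed
  then obtain c :: 'a where c: "c \<noteq> 0" "c ^ ?h = -1" using const_half_power_cases by blast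
  have "odd ?N" using assms parity_geometric by simp
  then have *: "[:c:] ^ ((CARD('a) ^ n - 1) div 2) = - 1"
    unfolding const_euler c(2) by (simp add: one_pCons)
  have "chi P [:c:] \<noteq> 1"
  proof
    assume "chi P [:c:] = 1"
    then have "[-1 = 1] (mod P)" using euler_residue[of "[:c:]"] * by simp
    then show False using not_cong_neg_one by blast
  qed
  moreover have "chi P [:c:] \<noteq> 0" using not_dvd_const c(1) by (simp add: chi_eq_0_iff)
  ultimately have chi_c: "chi P [:c:] = -1" using chi_cases by blast
  have "bij_betw ((*) c) UNIV UNIV"
    using c(1) by (intro bij_betwI[where g = "\<lambda>x. x / c"]) auto
  then have "(\<Sum>t\<in>UNIV. chi P [:t:]) = (\<Sum>t\<in>UNIV. chi P [:c * t:])"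
    using sum.reindex_bij_betw[of "(*) c" UNIV UNIV "\<lambda>t. chi P [:t:]"] by simp
  also have "\<dots> = (\<Sum>t\<in>UNIV. - chi P [:t:])"
    by (intro sum.cong refl) (use chi_mult[of "[:c:]" "[:t:]" for t] chi_c in \<open>simp add: mult.commute\<close>)
  finally show ?thesis by (simp add: sum_negf)
qed

section \<open>Functional equations for odd and even degree\<close>

lemma card_pos: "real CARD('a) > 0" "real CARD('a) > 1"
  using card_field_ge_2[where 'a='a] by simp_all

text \<open>Here \<open>h\<close> is the character on constants. The isotropic space
  \<open>polys_lt g\<close> reduces the Gauss sum to degree at most \<open>g\<close>, where
  \<open>res (x^2)\<close> is the square of the coefficient at \<open>g\<close>; this gives
  \<open>(q - 1) * q^g\<close>. Since \<open>h 0 = 0\<close>, only polynomials of exact degree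
  \<open>2 * g - d\<close> survive on the dual side.\<close>

lemma functional_equation_odd:
  assumes n: "n = 2 * g + 1" and d: "d \<le> 2 * g"
  shows "real CARD('a) ^ g * char_sum d = real CARD('a) ^ d * char_sum (2 * g - d)"
proof -
  let ?q = "real CARD('a)"
  let ?h = "\<lambda>c. chi P [:c:]"
  have odd: "odd n" using n by simp
  have h: "(\<Sum>t\<in>UNIV. ?h t) = 0" using odd by (rule sum_chi_const_odd)
  have sq: "?h c * ?h c = 1" if "c \<noteq> 0" for c
    using chi_cases[of "[:c:]"] not_dvd_const[OF that] chi_eq_0_iff[of "[:c:]"] by auto
  have "gauss_sum ?h = (\<Sum>x\<in>polys_lt (Suc g). ?h (res (x ^ 2)))"
    using gauss_sum_isotropic[OF h, of g] n by simp
  also have "\<dots> = (\<Sum>c\<in>UNIV. \<Sum>f\<in>(polys_lt g :: 'a poly set). ?h (c * c))"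
    unfolding sum_polys_lt_Suc
  proof (intro sum.cong refl)
    fix c :: 'a and f :: "'a poly" assume f: "f \<in> polys_lt g"
    let ?x = "monom c g + f"
    have x: "?x \<in> polys_lt (Suc g)"
      using f by (intro polys_lt_add monom_in_polys_lt) (auto intro: polys_lt_mono)
    have "?x * ?x \<in> polys_lt n" using polys_lt_mult[OF x x] n by (simp add: mult_2)
    then have "res (?x ^ 2) = coeff (?x * ?x) (2 * g)"
      using n res_polys_lt[of "?x * ?x"] unfolding power2_eq_square by (metis add_diff_cancel_right')
    also have "\<dots> = coeff ?x g * coeff ?x g" using x by (rule coeff_square_polys_lt)
    also have "coeff ?x g = c" using f by (simp add: polys_lt_def)
    finally show "?h (res (?x ^ 2)) = ?h (c * c)" by simp
  qed
  also have "\<dots> = (\<Sum>c\<in>UNIV. ?q ^ g * (?h c * ?h c))"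
    using chi_mult[of "[:c:]" "[:c:]" for c] by (simp add: card_polys_lt)
  also have "\<dots> = (\<Sum>c\<in>UNIV - {0::'a}. ?q ^ g)"
    by (subst sum.remove[of _ 0]) (auto simp: sq intro!: sum.cong)
  also have "\<dots> = (?q - 1) * ?q ^ g" using card_pos by (simp add: card_Diff_singleton of_nat_diff)
  finally have tau: "gauss_sum ?h = (?q - 1) * ?q ^ g" .
  have m: "n - d = Suc (2 * g - d)" "n - 1 - d = 2 * g - d" using n d by simp_all
  have csum: "(\<Sum>c\<in>UNIV - {0}. ?h c * ?h c) = ?q - 1"
  proof -
    have "(\<Sum>c\<in>UNIV - {0}. ?h c * ?h c) = (\<Sum>c\<in>UNIV - {0::'a}. 1)"
      by (intro sum.cong refl sq) simp
    then show ?thesis using card_pos by (simp add: card_Diff_singleton of_nat_diff)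
  qed
  have "?h 0 = 0" by simp
  then have K: "(\<Sum>y\<in>polys_lt (Suc (2 * g - d)). chi P y * ?h (coeff y (2 * g - d))) =
    (?q - 1) * char_sum (2 * g - d)"
    by (simp only: sum_chi_by_leading_coeff[where h = ?h] csum mult_zero_left add_0)
  have "d < n" using d n by simp
  then have "char_sum d * gauss_sum ?h = ?q ^ d * ((?q - 1) * char_sum (2 * g - d))"
    using char_sum_gauss_sum[OF h, of d] by (simp only: m K)
  then have "(?q - 1) * (?q ^ g * char_sum d) = (?q - 1) * (?q ^ d * char_sum (2 * g - d))"
    by (simp only: tau mult_ac)
  then show ?thesis using card_pos by simp
qed

lemma sum_chi_polys_lt_even:
  assumes "even n"
  shows "(\<Sum>y\<in>polys_lt m. chi P y) = (real CARD('a) - 1) * (\<Sum>j<m. char_sum j)"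
proof (induction m)
  case (Suc m)
  have eq: "(\<Sum>c\<in>UNIV - {0}. chi P [:c:]) = real CARD('a) - 1"
  proof -
    have "(\<Sum>c\<in>UNIV - {0}. chi P [:c:]) = (\<Sum>c\<in>UNIV - {0::'a}. 1)"
      by (intro sum.cong refl) (simp add: chi_const_even[OF assms])
    then show ?thesis using card_pos by (simp add: card_Diff_singleton of_nat_diff)
  qed
  have "(\<Sum>y\<in>polys_lt (Suc m). chi P y) = (\<Sum>y\<in>polys_lt m. chi P y) + (real CARD('a) - 1) * char_sum m"
    using sum_chi_by_leading_coeff[where m = m and h = "\<lambda>_. 1"] by (simp only: eq mult_1_left mult_1_right)
  then show ?case using Suc by (simp add: algebra_simps)
qed simp

text \<open>For even \<open>n\<close> the character on constants no longer sums to zero, so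
  \<open>h\<close> is a point mass minus its mean. The isotropic space
  \<open>polys_lt (g + 1)\<close> is its own complement, which makes the Gauss sum immediate. As
  \<open>h 0\<close> is nonzero, lower degrees enter; this reflects the trivial zero of the
  L-function at \<open>s = 0\<close>.\<close>

lemma functional_equation_even:
  assumes n: "n = 2 * g + 2" and d: "d \<le> 2 * g + 1"
  shows "real CARD('a) ^ (g + 1) * char_sum d =
    real CARD('a) ^ d * ((real CARD('a) - 1) * (\<Sum>j<2 * g + 1 - d. char_sum j) - char_sum (2 * g + 1 - d))"
proof -
  let ?q = "real CARD('a)"
  define h :: "'a \<Rightarrow> real" where "h = (\<lambda>t. ?q * of_bool (t = 0) - 1)"
  have even: "even n" using n by simp
  have h: "(\<Sum>t\<in>UNIV. h t) = 0" by (simp add: h_def sum_subtractf of_bool_def flip: sum_distrib_left)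
  have "gauss_sum h = (\<Sum>x\<in>polys_lt (Suc g). h (res (x ^ 2)))"
    using gauss_sum_isotropic[OF h, of "g + 1"] n by simp
  also have "\<dots> = (\<Sum>x\<in>(polys_lt (Suc g) :: 'a poly set). ?q - 1)"
  proof (intro sum.cong refl)
    fix x :: "'a poly" assume x: "x \<in> polys_lt (Suc g)"
    have "x * x \<in> polys_lt (n - 1)" using polys_lt_mult[OF x x] n by (simp add: mult_2)
    moreover from this have "x * x \<in> polys_lt n" by (rule polys_lt_mono) simp
    ultimately have "res (x ^ 2) = 0" by (simp add: res_polys_lt power2_eq_square polys_lt_def)
    then show "h (res (x ^ 2)) = ?q - 1" by (simp add: h_def)
  qed
  finally have tau: "gauss_sum h = (?q - 1) * ?q ^ (g + 1)" by (simp add: card_polys_lt)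
  let ?m = "2 * g + 1 - d"
  have m: "n - d = Suc ?m" "n - 1 - d = ?m" using n d by simp_all
  have csum: "(\<Sum>c\<in>UNIV - {0}. chi P [:c:] * h c) = - (?q - 1)"
  proof -
    have "(\<Sum>c\<in>UNIV - {0}. chi P [:c:] * h c) = (\<Sum>c\<in>UNIV - {0::'a}. - 1)"
      by (intro sum.cong refl) (simp add: chi_const_even[OF even] h_def)
    then show ?thesis using card_pos by (simp add: card_Diff_singleton of_nat_diff)
  qed
  have "h 0 = ?q - 1" by (simp add: h_def)
  then have K: "(\<Sum>y\<in>polys_lt (Suc ?m). chi P y * h (coeff y ?m)) =
    (?q - 1) * ((?q - 1) * (\<Sum>j<?m. char_sum j)) + - (?q - 1) * char_sum ?m"
    by (simp only: sum_chi_by_leading_coeff csum sum_chi_polys_lt_even[OF even])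
  have "d < n" using d n by simp
  then have "char_sum d * gauss_sum h = ?q ^ d * ((?q - 1) * ((?q - 1) * (\<Sum>j<?m. char_sum j)) + - (?q - 1) * char_sum ?m)"
    using char_sum_gauss_sum[OF h, of d] by (simp only: m K)
  then have "(?q - 1) * (?q ^ (g + 1) * char_sum d) = (?q - 1) * (?q ^ d * ((?q - 1) * (\<Sum>j<?m. char_sum j) - char_sum ?m))"
    unfolding tau by (simp add: algebra_simps)
  then show ?thesis using card_pos by simp
qed

lemma L_half_eq: "L_half P = (\<Sum>d<n. char_sum d / sqrt (real CARD('a)) ^ d)"
  unfolding L_half_def char_sum_def[symmetric]
  by (rule suminf_finite) (auto simp: char_sum_eq_0)

lemma sum_lessThan_split: "(\<Sum>i<a + b. F i) = (\<Sum>i<a. F i) + (\<Sum>i<b. F (a + i))" for F :: "nat \<Rightarrow> real"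
  by (induction b) auto

lemma L_half_odd:
  assumes n: "n = 2 * g + 1"
  defines "s \<equiv> sqrt (real CARD('a))"
  shows "L_half P = (\<Sum>j\<le>g. (if j < g then 2 / s ^ j else 1 / s ^ j) * char_sum j)"
proof -
  let ?q = "real CARD('a)"
  have s: "s > 0" "s ^ 2 = ?q" using card_pos by (simp_all add: s_def)
  define T where "T = (\<lambda>j. char_sum j / s ^ j)"
  have sym: "T (2 * g - j) = T j" if jg: "j \<le> g" for j
  proof -
    obtain e where e: "g = j + e" using le_Suc_ex[OF jg] by (elim exE)
    have eq: "2 * g - (2 * g - j) = j" "2 * g - j = j + 2 * e" using e by simp_all
    have "s ^ (2 * g) * char_sum (2 * g - j) = s ^ (2 * (2 * g - j)) * char_sum j"
      using functional_equation_odd[OF n, of "2 * g - j"] unfolding power_mult s(2) eq(1) by simp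
    also have "2 * (2 * g - j) = 2 * g + 2 * e" using e by simp
    finally have "char_sum (2 * g - j) = s ^ (2 * e) * char_sum j" using s(1) by (simp add: power_add)
    then show ?thesis unfolding T_def eq(2) using s(1) by (simp add: power_add)
  qed
  have "L_half P = (\<Sum>d<(g + 1) + g. T d)"
    unfolding L_half_eq T_def s_def by (simp add: n mult_2)
  also have "\<dots> = (\<Sum>j<g + 1. T j) + (\<Sum>i<g. T (g + 1 + i))" by (rule sum_lessThan_split)
  also have "(\<Sum>i<g. T (g + 1 + i)) = (\<Sum>i<g. T (g - Suc i))"
  proof (intro sum.cong refl)
    fix i assume "i \<in> {..<g}"
    then have eq: "g + 1 + i = 2 * g - (g - Suc i)" by auto
    show "T (g + 1 + i) = T (g - Suc i)" unfolding eq by (rule sym) simp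
  qed
  also have "\<dots> = (\<Sum>j<g. T j)" by (rule sum.nat_diff_reindex)
  also have "(\<Sum>j<g + 1. T j) + (\<Sum>j<g. T j) = (\<Sum>j<g. 2 / s ^ j * char_sum j) + 1 / s ^ g * char_sum g"
    by (simp add: T_def sum_distrib_left)
  also have "\<dots> = (\<Sum>j\<le>g. (if j < g then 2 / s ^ j else 1 / s ^ j) * char_sum j)"
    by (simp add: lessThan_Suc_atMost[symmetric])
  finally show ?thesis .
qed

lemma L_half_even:
  assumes n: "n = 2 * g + 2"
  defines "s \<equiv> sqrt (real CARD('a))"
  shows "L_half P = (\<Sum>j\<le>g. (2 / s ^ j - 1 / s ^ g - 1 / s ^ (g + 1)) * char_sum j)"
proof -
  let ?q = "real CARD('a)"
  have s: "s > 0" "s ^ 2 = ?q" using card_pos by (simp_all add: s_def)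
  define T where "T = (\<lambda>j. char_sum j / s ^ j)"
  define U where "U = (\<lambda>m. ((s ^ 2 - 1) * (\<Sum>j<m. char_sum j) - char_sum m) / s ^ (m + 1))"
  have sym: "T (2 * g + 1 - m) = U m" if mg: "m \<le> g" for m
  proof -
    obtain e where e: "g = m + e" using le_Suc_ex[OF mg] by (elim exE)
    have eq: "2 * g + 1 - (2 * g + 1 - m) = m" "2 * g + 1 - m = m + 2 * e + 1" using e by simp_all
    let ?B = "(s ^ 2 - 1) * (\<Sum>j<m. char_sum j) - char_sum m"
    have "s ^ (2 * (g + 1)) * char_sum (2 * g + 1 - m) = s ^ (2 * (2 * g + 1 - m)) * ?B"
      using functional_equation_even[OF n, of "2 * g + 1 - m"] that unfolding power_mult s(2) eq(1) by simp
    also have "2 * (2 * g + 1 - m) = 2 * (g + 1) + 2 * e" using e by simp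
    finally have "char_sum (2 * g + 1 - m) = s ^ (2 * e) * ?B" using s(1) by (simp add: power_add)
    then show ?thesis unfolding T_def U_def eq(2) using s(1) by (simp add: power_add)
  qed
  \<comment> \<open>Summation by parts over the lower-degree sums inside \<open>U\<close>. For
    \<open>N = g + 1\<close> the correction \<open>(1 + s) / s^N\<close> is
    \<open>1 / s^g + 1 / s^(g + 1)\<close>.\<close>
  have U: "(\<Sum>m<N. U m) = (\<Sum>j<N. (1 / s ^ j - (1 + s) / s ^ N) * char_sum j)" for N
  proof (induction N)
    case (Suc N)
    have *: "(1 / s ^ j - (1 + s) / s ^ Suc N) * char_sum j =
      (1 / s ^ j - (1 + s) / s ^ N) * char_sum j + (s ^ 2 - 1) / s ^ (N + 1) * char_sum j" for j
      using s(1) by (simp add: field_simps power2_eq_square)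
    have "(\<Sum>j<Suc N. (1 / s ^ j - (1 + s) / s ^ Suc N) * char_sum j) =
      (\<Sum>j<N. (1 / s ^ j - (1 + s) / s ^ N) * char_sum j) + (s ^ 2 - 1) / s ^ (N + 1) * (\<Sum>j<N. char_sum j)
       + (1 / s ^ N - (1 + s) / s ^ Suc N) * char_sum N"
      unfolding sum.lessThan_Suc sum_distrib_left sum.distrib[symmetric] by (simp only: *)
    also have "1 / s ^ N - (1 + s) / s ^ Suc N = - (1 / s ^ (N + 1))" using s(1) by (simp add: field_simps)
    finally have "(\<Sum>j<Suc N. (1 / s ^ j - (1 + s) / s ^ Suc N) * char_sum j) =
      (\<Sum>m<N. U m) + ((s ^ 2 - 1) / s ^ (N + 1) * (\<Sum>j<N. char_sum j) + - (1 / s ^ (N + 1)) * char_sum N)"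
      by (simp only: Suc add.assoc)
    also have "(s ^ 2 - 1) / s ^ (N + 1) * (\<Sum>j<N. char_sum j) + - (1 / s ^ (N + 1)) * char_sum N = U N"
      unfolding U_def using s(1) by (simp add: field_simps)
    finally show ?case by simp
  qed simp
  have "L_half P = (\<Sum>d<(g + 1) + (g + 1). T d)"
    unfolding L_half_eq T_def s_def by (simp add: n mult_2)
  also have "\<dots> = (\<Sum>j<g + 1. T j) + (\<Sum>i<g + 1. T (g + 1 + i))" by (rule sum_lessThan_split)
  also have "(\<Sum>i<g + 1. T (g + 1 + i)) = (\<Sum>i<g + 1. U (g + 1 - Suc i))"
  proof (intro sum.cong refl)
    fix i assume "i \<in> {..<g + 1}"
    then have eq: "g + 1 + i = 2 * g + 1 - (g + 1 - Suc i)" by auto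
    show "T (g + 1 + i) = U (g + 1 - Suc i)" unfolding eq by (rule sym) simp
  qed
  also have "\<dots> = (\<Sum>m<g + 1. U m)" by (rule sum.nat_diff_reindex)
  also have "(\<Sum>j<g + 1. T j) + (\<Sum>m<g + 1. U m) = (\<Sum>j<g + 1. (2 / s ^ j - 1 / s ^ g - 1 / s ^ (g + 1)) * char_sum j)"
    unfolding U sum.distrib[symmetric] using s(1) by (intro sum.cong refl) (simp add: T_def field_simps)
  finally show ?thesis by (simp add: lessThan_Suc_atMost[symmetric])
qed

end

text \<open>Both parities are merged: from here on only the size of the weights matters. The lower
  bound stops before \<open>j = g\<close>, where for even \<open>n\<close> the weight is just
  \<open>1 / s^g - 1 / s^(g + 1)\<close>.\<close>

lemma L_half_short_sum:
  assumes odd: "odd CARD('a::{field,finite})" and q4: "CARD('a) \<ge> 4" and n: "n \<in> {2 * g + 1, 2 * g + 2}"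
  defines "s \<equiv> sqrt (real CARD('a))"
  obtains w :: "nat \<Rightarrow> real" where
    "\<And>j. j \<le> g \<Longrightarrow> 0 \<le> w j \<and> w j \<le> 2 / s ^ j" "\<And>j. j < g \<Longrightarrow> 1 / s ^ j \<le> w j"
    "\<And>P :: 'a poly. P \<in> monic_irred_deg n \<Longrightarrow> L_half P = (\<Sum>j\<le>g. w j * (\<Sum>f\<in>monic_deg j. chi P f))"
proof -
  have s: "s \<ge> 2" using q4 by (auto simp: s_def intro: real_le_rsqrt)
  have pr: "odd_prime_modulus P n" if "P \<in> monic_irred_deg n" for P :: "'a poly"
    using that odd by unfold_locales
  show thesis
  proof (cases "n = 2 * g + 1")
    case True
    show thesis
    proof (rule that[of "\<lambda>j. if j < g then 2 / s ^ j else 1 / s ^ j"])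
      fix P :: "'a poly" assume "P \<in> monic_irred_deg n"
      then interpret odd_prime_modulus P n by (rule pr)
      show "L_half P = (\<Sum>j\<le>g. (if j < g then 2 / s ^ j else 1 / s ^ j) * (\<Sum>f\<in>monic_deg j. chi P f))"
        using L_half_odd[OF True] unfolding s_def char_sum_def .
    qed (use s in \<open>auto simp: divide_right_mono\<close>)
  next
    case False
    then have n2: "n = 2 * g + 2" using n by simp
    have tail: "1 / s ^ g + 1 / s ^ (g + 1) \<le> 2 / s ^ g"
      using s by (simp add: field_simps)
    show thesis
    proof (rule that[of "\<lambda>j. 2 / s ^ j - 1 / s ^ g - 1 / s ^ (g + 1)"])
      fix j assume j: "j \<le> g"
      have pos: "0 \<le> 1 / s ^ g + 1 / s ^ (g + 1)" using s by simp
      have "2 / s ^ g \<le> 2 / s ^ j" using s j by (intro divide_left_mono power_increasing) auto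
      then show "0 \<le> 2 / s ^ j - 1 / s ^ g - 1 / s ^ (g + 1) \<and> 2 / s ^ j - 1 / s ^ g - 1 / s ^ (g + 1) \<le> 2 / s ^ j"
        using tail pos by linarith
    next
      fix j assume j: "j < g"
      have "2 * s ^ j \<le> s * s ^ j" using s by (intro mult_right_mono) auto
      also have "\<dots> \<le> s ^ g" using s j power_increasing[of "Suc j" g s] by simp
      finally have "2 / s ^ g \<le> 1 / s ^ j" using s by (simp add: field_simps)
      then show "1 / s ^ j \<le> 2 / s ^ j - 1 / s ^ g - 1 / s ^ (g + 1)" using tail by simp
    next
      fix P :: "'a poly" assume "P \<in> monic_irred_deg n"
      then interpret odd_prime_modulus P n by (rule pr)
      show "L_half P = (\<Sum>j\<le>g. (2 / s ^ j - 1 / s ^ g - 1 / s ^ (g + 1)) * (\<Sum>f\<in>monic_deg j. chi P f))"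
        using L_half_even[OF n2] unfolding s_def char_sum_def .
    qed
  qed
qed

section \<open>Tuples whose product is a square\<close>

text \<open>The multiplicity of the vertex \<open>i\<close> in the edge \<open>e\<close>, a loop counting twice. A tuple of the form
  \<open>F i = (\<Prod>e. A e ^ inc i e)\<close> has the square of \<open>\<Prod>e. A e\<close> as its product.\<close>
definition inc :: "'i \<Rightarrow> 'i \<times> 'i \<Rightarrow> nat" where
  "inc i e = of_bool (fst e = i) + of_bool (snd e = i)"

definition sqfree :: "'a::{field,finite} poly \<Rightarrow> bool" where
  "sqfree f \<longleftrightarrow> (\<forall>P. monic_irred P \<longrightarrow> \<not> P ^ 2 dvd f)"

lemma sqfree_dvd: "sqfree g \<Longrightarrow> f dvd g \<Longrightarrow> sqfree f"
  unfolding sqfree_def using dvd_trans by blast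

lemma sum_inc: "finite I \<Longrightarrow> e \<in> I \<times> I \<Longrightarrow> (\<Sum>i\<in>I. inc i e) = 2"
  by (auto simp: inc_def sum.distrib of_bool_def)

lemma prod_power_inc:
  fixes A :: "'i \<times> 'i \<Rightarrow> 'b::comm_monoid_mult"
  assumes "finite I" "E \<subseteq> I \<times> I"
  shows "(\<Prod>i\<in>I. \<Prod>e\<in>E. A e ^ inc i e) = (\<Prod>e\<in>E. A e ^ 2)"
proof -
  have "(\<Prod>i\<in>I. \<Prod>e\<in>E. A e ^ inc i e) = (\<Prod>e\<in>E. \<Prod>i\<in>I. A e ^ inc i e)"
    by (rule prod.swap)
  also have "\<dots> = (\<Prod>e\<in>E. A e ^ (\<Sum>i\<in>I. inc i e))"
    by (simp add: power_sum)
  also have "\<dots> = (\<Prod>e\<in>E. A e ^ 2)"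
  proof (rule prod.cong[OF refl])
    fix e assume "e \<in> E"
    then have "e \<in> I \<times> I" using assms(2) by auto
    then show "A e ^ (\<Sum>i\<in>I. inc i e) = A e ^ 2" by (simp only: sum_inc[OF assms(1)])
  qed
  finally show ?thesis .
qed

lemma lead_coeff_prod_1:
  fixes f :: "'b \<Rightarrow> 'a::field poly"
  assumes "\<And>i. i \<in> I \<Longrightarrow> lead_coeff (f i) = 1"
  shows "lead_coeff (\<Prod>i\<in>I. f i) = 1"
  by (simp only: lead_coeff_prod assms prod.neutral_const cong: prod.cong)

lemma (in prime_modulus) square_dvd_prodE:
  assumes "finite I" "P ^ 2 dvd (\<Prod>i\<in>I. F i)"
  obtains i where "i \<in> I" "P ^ 2 dvd F i" | i j where "i \<in> I" "j \<in> I" "i \<noteq> j" "P dvd F i" "P dvd F j"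
proof -
  have "P dvd (\<Prod>i\<in>I. F i)" using assms(2) by (metis dvd_power dvd_trans pos2)
  then obtain i where i: "i \<in> I" "P dvd F i" using dvd_prod_iff[OF assms(1)] by blast
  show thesis
  proof (cases "P ^ 2 dvd F i")
    case True
    then show thesis using i that(1) by blast
  next
    case False
    obtain u where u: "F i = P * u" using i(2) by (elim dvdE)
    have "(\<Prod>i\<in>I. F i) = F i * (\<Prod>j\<in>I - {i}. F j)" using assms(1) i(1) by (rule prod.remove)
    then have "P * P dvd P * (u * (\<Prod>j\<in>I - {i}. F j))"
      using assms(2) u by (simp add: power2_eq_square mult.assoc)
    then have "P dvd u * (\<Prod>j\<in>I - {i}. F j)" by simp
    moreover have "\<not> P dvd u" using False u by (simp add: power2_eq_square)
    ultimately have "P dvd (\<Prod>j\<in>I - {i}. F j)" by (simp add: dvd_mult_iff)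
    then obtain j where "j \<in> I - {i}" "P dvd F j"
      using dvd_prod_iff[of "I - {i}" F] assms(1) by blast
    then show thesis using i that(2)[of i j] by blast
  qed
qed

text \<open>Repeatedly removing a prime whose square divides the product, and recording in \<open>A\<close> the two
  indices from which it was removed, leaves a squarefree product.\<close>
lemma pair_decomposition:
  fixes F :: "'i \<Rightarrow> 'a::{field,finite} poly"
  assumes fin: "finite I" and E: "E \<subseteq> I \<times> I"
    and complete: "\<And>i j. i \<in> I \<Longrightarrow> j \<in> I \<Longrightarrow> (i, j) \<in> E \<or> (j, i) \<in> E"
    and monic: "\<And>i. i \<in> I \<Longrightarrow> lead_coeff (F i) = 1"
  shows "\<exists>G A. (\<forall>i\<in>I. lead_coeff (G i) = 1) \<and> (\<forall>e\<in>E. lead_coeff (A e) = 1) \<and>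
    (\<forall>i\<in>I. F i = G i * (\<Prod>e\<in>E. A e ^ inc i e)) \<and> sqfree (\<Prod>i\<in>I. G i)"
  using monic
proof (induction "degree (\<Prod>i\<in>I. F i)" arbitrary: F rule: less_induct)
  case less
  have finE: "finite E" using fin E by (meson finite_SigmaI finite_subset)
  show ?case
  proof (cases "sqfree (\<Prod>i\<in>I. F i)")
    case True
    then show ?thesis using less.prems by (intro exI[of _ F] exI[of _ "\<lambda>_. 1"]) auto
  next
    case False
    then obtain P where P: "monic_irred P" "P ^ 2 dvd (\<Prod>i\<in>I. F i)" by (auto simp: sqfree_def)
    interpret P: prime_modulus P "degree P" by (rule monic_irred_prime_modulus) fact
    obtain e where e: "e \<in> E" "\<And>l. P ^ inc l e dvd F l"
    proof (rule P.square_dvd_prodE[OF fin P(2)])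
      fix i assume i: "i \<in> I" "P ^ 2 dvd F i"
      then have "P ^ inc l (i, i) dvd F l" for l by (auto simp: inc_def numeral_2_eq_2)
      then show thesis using that[of "(i, i)"] complete[of i i] i by blast
    next
      fix i j assume ij: "i \<in> I" "j \<in> I" "i \<noteq> j" "P dvd F i" "P dvd F j"
      then have "P ^ inc l (i, j) dvd F l" "P ^ inc l (j, i) dvd F l" for l
        by (auto simp: inc_def)
      then show thesis using that complete[of i j] ij by blast
    qed
    then have "\<forall>l. \<exists>f. F l = P ^ inc l e * f" by (meson dvdE)
    then obtain F' where F': "F l = P ^ inc l e * F' l" for l by metis
    have lcP: "lead_coeff (P ^ m) = 1" for m
      using P(1) by (simp add: lead_coeff_power monic_irred_def)
    have monic': "lead_coeff (F' l) = 1" if "l \<in> I" for l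
      using less.prems[OF that] F'[of l] lead_coeff_mult[of "P ^ inc l e" "F' l"]
      by (simp only: lcP mult_1_left)
    have "(\<Prod>i\<in>I. F i) = P ^ (\<Sum>i\<in>I. inc i e) * (\<Prod>i\<in>I. F' i)"
      by (simp only: F' prod.distrib power_sum)
    also have "(\<Sum>i\<in>I. inc i e) = 2" using e(1) E fin by (intro sum_inc) auto
    finally have prodF: "(\<Prod>i\<in>I. F i) = P ^ 2 * (\<Prod>i\<in>I. F' i)" .
    have nz: "(\<Prod>i\<in>I. F' i) \<noteq> 0"
      using lead_coeff_prod_1[of I F', OF monic'] by auto
    have "degree (\<Prod>i\<in>I. F' i) < degree (\<Prod>i\<in>I. F i)"
      unfolding prodF using nz P.n_pos by (simp add: degree_mult_eq degree_power_eq)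
    from less.hyps[OF this monic'] obtain G A where GA: "\<forall>i\<in>I. lead_coeff (G i) = 1"
      "\<forall>e\<in>E. lead_coeff (A e) = 1" "\<forall>i\<in>I. F' i = G i * (\<Prod>e\<in>E. A e ^ inc i e)"
      "sqfree (\<Prod>i\<in>I. G i)" by blast
    define A' where "A' = A(e := A e * P)"
    have A': "A' d = A d * (if d = e then P else 1)" for d by (simp add: A'_def)
    have prodA: "(\<Prod>d\<in>E. A' d ^ inc i d) = (\<Prod>d\<in>E. A d ^ inc i d) * P ^ inc i e" for i
    proof -
      have "(\<Prod>d\<in>E. (if d = e then P else 1) ^ inc i d) = (\<Prod>d\<in>E. if d = e then P ^ inc i e else 1)"
        by (rule prod.cong) auto
      then show ?thesis using finE e(1) by (simp add: A' power_mult_distrib prod.distrib)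
    qed
    have "\<forall>i\<in>I. F i = G i * (\<Prod>d\<in>E. A' d ^ inc i d)"
      unfolding prodA using F' GA(3) by (simp add: mult.commute mult.left_commute)
    moreover have "\<forall>d\<in>E. lead_coeff (A' d) = 1"
      using GA(2) P(1) by (auto simp: A' lead_coeff_mult monic_irred_def)
    ultimately show ?thesis using GA by blast
  qed
qed

lemma sqfree_square_imp_const:
  fixes v :: "'a::{field,finite} poly"
  assumes "sqfree (v ^ 2)"
  shows "degree v = 0"
proof (rule ccontr)
  assume "degree v \<noteq> 0"
  then obtain P where "monic_irred P" "P dvd v" using monic_irred_dvd_exists by blast
  then show False using assms by (auto simp: sqfree_def dvd_power_same)
qed

lemma sqfree_dvdI:
  fixes g h :: "'a::{field,finite} poly"
  assumes "sqfree g" "lead_coeff g = 1" "\<And>P. monic_irred P \<Longrightarrow> P dvd g \<Longrightarrow> P dvd h"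
  shows "g dvd h"
  using assms
proof (induction "degree g" arbitrary: g h rule: less_induct)
  case less
  show ?case
  proof (cases "degree g = 0")
    case True
    then obtain c where "g = [:c:]" by (rule degree_eq_zeroE)
    then have "g = 1" using less.prems(2) by (simp add: one_pCons)
    then show ?thesis by simp
  next
    case False
    then obtain P where P: "monic_irred P" "P dvd g" using monic_irred_dvd_exists by blast
    interpret P: prime_modulus P "degree P" by (rule monic_irred_prime_modulus) fact
    obtain g' where g': "g = P * g'" using P(2) by (elim dvdE)
    obtain h' where h': "h = P * h'" using less.prems(3)[OF P] by (elim dvdE)
    have ndvd: "\<not> P dvd g'" using less.prems(1) P(1) g' by (auto simp: sqfree_def power2_eq_square)
    have "g' \<noteq> 0" using g' less.prems(2) by auto
    have "g' dvd h'"
    proof (rule less.hyps)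
      show "degree g' < degree g" using g' \<open>g' \<noteq> 0\<close> P.n_pos by (simp add: degree_mult_eq)
      show "sqfree g'" by (rule sqfree_dvd[OF less.prems(1)]) (simp add: g')
      show "lead_coeff g' = 1" using less.prems(2) P(1) by (simp add: g' lead_coeff_mult monic_irred_def)
      fix R assume R: "monic_irred R" "R dvd g'"
      interpret R: prime_modulus R "degree R" by (rule monic_irred_prime_modulus) fact
      have "R dvd P * h'" using less.prems(3)[OF R(1)] R(2) by (simp add: g' h')
      moreover have "\<not> R dvd P" using monic_irred_dvd_eq[OF R(1) P(1)] R(2) ndvd by auto
      ultimately show "R dvd h'" by (simp add: R.dvd_mult_iff)
    qed
    then show ?thesis by (simp add: g' h' mult_dvd_mono)
  qed
qed

text \<open>Unordered pairs of indices, loops included. Their number is the exponent in the theorem,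
  since each edge will contribute one factor of order \<open>n\<close>.\<close>

definition edges :: "nat \<Rightarrow> (nat \<times> nat) set" where
  "edges k = {(i, j). i \<le> j \<and> j < k}"

lemma edges_subset: "edges k \<subseteq> {..<k} \<times> {..<k}"
  by (auto simp: edges_def)

lemma finite_edges [simp]: "finite (edges k)"
  by (rule finite_subset[OF edges_subset]) auto

lemma card_edges: "card (edges k) = k * (k + 1) div 2"
proof -
  have "edges k = (\<lambda>(j, i). (i, j)) ` (SIGMA j:{..<k}. {..j})"
    by (auto simp: edges_def image_iff)
  moreover have "inj_on (\<lambda>(j, i). (i, j)) (SIGMA j:{..<k}. {..j::nat})"
    by (auto simp: inj_on_def)
  ultimately have "card (edges k) = (\<Sum>j<k. Suc j)" by (simp add: card_image)
  also have "\<dots> = k * (k + 1) div 2" by (induction k) auto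
  finally show ?thesis .
qed

text \<open>Lets the edge carrying a prime be recovered from the multiplicities of that prime in the
  entries of a tuple.\<close>

lemma inc_inj:
  assumes "e \<in> edges k" "e' \<in> edges k" "\<And>i. i < k \<Longrightarrow> inc i e = inc i e'"
  shows "e = e'"
proof -
  obtain a b a' b' where ab: "e = (a, b)" "e' = (a', b')" by (metis surj_pair)
  have lt: "a \<le> b" "b < k" "a' \<le> b'" "b' < k" using assms(1,2) by (auto simp: ab edges_def)
  have "a < k" "a' < k" using lt by auto
  from assms(3)[OF this(1)] assms(3)[OF this(2)] assms(3)[OF lt(2)] assms(3)[OF lt(4)]
  show ?thesis using lt(1,3) unfolding ab inc_def fst_conv snd_conv
    by (cases "a = a'"; cases "a = b'"; cases "b = a'"; cases "b = b'"; simp)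
qed

lemma (in prime_modulus) power_dvd_mult_iff:
  assumes "\<not> P dvd r"
  shows "P ^ m dvd P ^ a * r \<longleftrightarrow> m \<le> a"
proof
  assume dvd: "P ^ m dvd P ^ a * r"
  show "m \<le> a"
  proof (rule ccontr)
    assume "\<not> m \<le> a"
    then have "P ^ Suc a dvd P ^ m" by (intro le_imp_power_dvd) simp
    then have "P ^ Suc a dvd P ^ a * r" using dvd dvd_trans by blast
    then have "P ^ a * P dvd P ^ a * r" by (simp add: mult.commute)
    then have "P dvd r" by simp
    then show False using assms by simp
  qed
qed (simp add: dvd_mult2 le_imp_power_dvd)

text \<open>Squarefreeness of the total product puts \<open>P\<close> into a single
  \<open>g e\<close>, and there only once, so its multiplicity in entry \<open>i\<close> is exactly
  \<open>inc i e\<close>.\<close>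

lemma (in prime_modulus) power_dvd_incidence_prod_iff:
  fixes g :: "nat \<times> nat \<Rightarrow> 'a poly"
  assumes sq: "sqfree (\<Prod>e\<in>edges k. g e)" and e: "e \<in> edges k" "P dvd g e"
  shows "P ^ m dvd (\<Prod>e\<in>edges k. g e ^ inc i e) \<longleftrightarrow> m \<le> inc i e"
proof -
  have mi: "monic_irred P" using irred lcP by (simp add: monic_irred_def)
  have split: "(\<Prod>e\<in>edges k. f e) = f e * (\<Prod>d\<in>edges k - {e}. f d)" for f :: "nat \<times> nat \<Rightarrow> 'a poly"
    using e(1) by (intro prod.remove) auto
  obtain u where u: "g e = P * u" using e(2) by (elim dvdE)
  have "\<not> P * P dvd P * (u * (\<Prod>d\<in>edges k - {e}. g d))"
  proof -
    have "\<not> P ^ 2 dvd (\<Prod>e\<in>edges k. g e)" using sq mi unfolding sqfree_def by blast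
    then show ?thesis unfolding split[of g] by (simp only: u power2_eq_square mult.assoc not_False_eq_True)
  qed
  then have nd: "\<not> P dvd u * (\<Prod>d\<in>edges k - {e}. g d)" by simp
  then have "\<not> P dvd g d" if "d \<in> edges k - {e}" for d
    using that dvd_prod_iff[of "edges k - {e}" g] by (auto simp: dvd_mult_iff)
  then have "\<not> P dvd g d ^ inc i d" if "d \<in> edges k - {e}" for d
    using that not_dvd_one by (cases "inc i d = 0") (auto simp: dvd_power_iff)
  then have "\<not> P dvd (\<Prod>d\<in>edges k - {e}. g d ^ inc i d)"
    using dvd_prod_iff[of "edges k - {e}" "\<lambda>d. g d ^ inc i d"] by auto
  moreover have "\<not> P dvd u ^ inc i e"
    using nd not_dvd_one by (cases "inc i e = 0") (auto simp: dvd_power_iff dvd_mult_iff)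
  ultimately have nr: "\<not> P dvd u ^ inc i e * (\<Prod>d\<in>edges k - {e}. g d ^ inc i d)"
    by (simp add: dvd_mult_iff)
  have eq: "(\<Prod>e\<in>edges k. g e ^ inc i e) = P ^ inc i e * (u ^ inc i e * (\<Prod>d\<in>edges k - {e}. g d ^ inc i d))"
    unfolding split[of "\<lambda>e. g e ^ inc i e"] by (simp add: u power_mult_distrib mult.assoc)
  show ?thesis unfolding eq by (rule power_dvd_mult_iff[OF nr])
qed

text \<open>A prime of \<open>g e\<close> has the multiplicity vector of \<open>e\<close> in the
  common tuple, and \<open>inc_inj\<close> forces it to sit on the same edge in \<open>g'\<close>.
  With the roles exchanged this yields uniqueness of the parametrisation.\<close>

lemma incidence_prod_dvd:
  fixes g g' :: "nat \<times> nat \<Rightarrow> 'a::{field,finite} poly"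
  assumes sq: "sqfree (\<Prod>e\<in>edges k. g e)" "sqfree (\<Prod>e\<in>edges k. g' e)"
    and monic: "\<And>e. e \<in> edges k \<Longrightarrow> lead_coeff (g e) = 1"
    and eq: "\<And>i. i < k \<Longrightarrow> (\<Prod>e\<in>edges k. g e ^ inc i e) = (\<Prod>e\<in>edges k. g' e ^ inc i e)"
    and e: "e \<in> edges k"
  shows "g e dvd g' e"
proof (rule sqfree_dvdI)
  show "sqfree (g e)" using sq(1) by (rule sqfree_dvd) (use e in \<open>auto intro: dvd_prodI\<close>)
  show "lead_coeff (g e) = 1" using e by (rule monic)
  fix P assume P: "monic_irred P" "P dvd g e"
  interpret P: prime_modulus P "degree P" by (rule monic_irred_prime_modulus) fact
  obtain a b where ab: "e = (a, b)" by fastforce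
  have a: "a < k" using e by (auto simp: ab edges_def)
  have "1 \<le> inc a e" by (simp add: ab inc_def)
  then have "P ^ 1 dvd (\<Prod>e\<in>edges k. g e ^ inc a e)"
    by (subst P.power_dvd_incidence_prod_iff[OF sq(1) e P(2)])
  then have "P dvd (\<Prod>e\<in>edges k. g' e ^ inc a e)" using eq[OF a] by simp
  then obtain e' where e': "e' \<in> edges k" "P dvd g' e' ^ inc a e'"
    using P.dvd_prod_iff[of "edges k" "\<lambda>e. g' e ^ inc a e"] by auto
  then have "inc a e' \<noteq> 0" using P.not_dvd_one by (cases "inc a e' = 0") auto
  then have dvd': "P dvd g' e'" using e'(2) by (simp add: P.dvd_power_iff)
  have "inc i e = inc i e'" if i: "i < k" for i
  proof -
    have "m \<le> inc i e \<longleftrightarrow> m \<le> inc i e'" for m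
      using P.power_dvd_incidence_prod_iff[OF sq(1) e P(2), of m i]
        P.power_dvd_incidence_prod_iff[OF sq(2) e'(1) dvd', of m i] eq[OF i] by simp
    then show ?thesis by (meson order.refl antisym)
  qed
  then have "e = e'" using e e'(1) by (intro inc_inj)
  then show "P dvd g' e" using dvd' by simp
qed

section \<open>Weighted counts of square tuples\<close>

definition monic_le :: "nat \<Rightarrow> 'a::{field,finite} poly set" where
  "monic_le x = {f. degree f \<le> x \<and> lead_coeff f = 1}"

lemma monic_le_eq: "monic_le x = (\<Union>d\<in>{..x}. monic_deg d)"
  by (auto simp: monic_le_def monic_deg_def)

lemma finite_monic_le [simp]: "finite (monic_le x)"
  by (simp add: monic_le_eq)

lemma sum_monic_le: "(\<Sum>f\<in>monic_le x. F f) = (\<Sum>d\<le>x. \<Sum>f\<in>monic_deg d. F f)"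
  unfolding monic_le_eq by (rule sum.UNION_disjoint) (auto dest: monic_degD(1))

lemma sum_monic_le_degree:
  "(\<Sum>f\<in>(monic_le x :: 'a::{field,finite} poly set). h (degree f)) = (\<Sum>d\<le>x. real CARD('a) ^ d * h d)"
proof -
  have "(\<Sum>f\<in>(monic_deg d :: 'a poly set). h (degree f)) = real CARD('a) ^ d * h d" for d
    by (simp add: monic_degD(1) card_monic_deg cong: sum.cong)
  then show ?thesis by (simp add: sum_monic_le)
qed

lemma degree_prod_monic:
  fixes f :: "'b \<Rightarrow> 'a::field poly"
  assumes "\<And>i. i \<in> I \<Longrightarrow> lead_coeff (f i) = 1"
  shows "degree (\<Prod>i\<in>I. f i) = (\<Sum>i\<in>I. degree (f i))"
  using assms by (intro degree_prod_eq_sum_degree) (metis leading_coeff_0_iff zero_neq_one)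

lemma monic_prod_degree:
  fixes s :: real
  assumes "\<And>i. i \<in> I \<Longrightarrow> lead_coeff (f i) = 1"
  shows "(\<Prod>i\<in>I. 1 / s ^ degree (f i)) = 1 / s ^ degree (\<Prod>i\<in>I. f i :: 'a::field poly)"
  by (simp add: degree_prod_monic[OF assms] power_sum prod_dividef)

lemma degree_le_if_dvd_monic: "f dvd g \<Longrightarrow> lead_coeff g = 1 \<Longrightarrow> degree f \<le> degree g"
  for f g :: "'a::field poly"
  by (rule dvd_imp_degree_le) auto

lemma degree_zero_monic: "degree f = 0 \<Longrightarrow> lead_coeff f = 1 \<Longrightarrow> f = (1 :: 'a::field poly)"
  by (auto simp: one_pCons elim!: degree_eq_zeroE)

definition square_tuples :: "nat \<Rightarrow> nat \<Rightarrow> (nat \<Rightarrow> 'a::{field,finite} poly) set" where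
  "square_tuples k x = {F \<in> PiE {..<k} (\<lambda>_. monic_le x). \<exists>w. (\<Prod>i<k. F i) = w ^ 2}"

lemma finite_square_tuples [simp]: "finite (square_tuples k x)"
  unfolding square_tuples_def
  by (rule finite_subset[of _ "PiE {..<k} (\<lambda>_. monic_le x)"]) (auto intro: finite_PiE)

text \<open>Each \<open>A e\<close> has total multiplicity 2 in the tuple, which turns its weight
  \<open>1 / s\<close> per degree into \<open>1 / q\<close>. The monic polynomials of a given degree
  then have total weight 1.\<close>

lemma incidence_prod_degree:
  fixes A :: "nat \<times> nat \<Rightarrow> 'a::field poly"
  assumes "\<And>e. e \<in> edges k \<Longrightarrow> lead_coeff (A e) = 1" "s ^ 2 = (q::real)"
  shows "(\<Prod>i<k. 1 / s ^ degree (\<Prod>e\<in>edges k. A e ^ inc i e)) = (\<Prod>e\<in>edges k. 1 / q ^ degree (A e))"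
proof -
  have lcp: "lead_coeff (A e ^ m) = 1" if "e \<in> edges k" for e m
    using assms(1)[OF that] by (simp add: lead_coeff_power)
  have "(\<Prod>i<k. 1 / s ^ degree (\<Prod>e\<in>edges k. A e ^ inc i e)) =
    1 / s ^ degree (\<Prod>i<k. \<Prod>e\<in>edges k. A e ^ inc i e)"
    by (rule monic_prod_degree) (intro lead_coeff_prod_1 lcp)
  also have "(\<Prod>i<k. \<Prod>e\<in>edges k. A e ^ inc i e) = (\<Prod>e\<in>edges k. A e ^ 2)"
    by (rule prod_power_inc) (auto simp: edges_subset)
  also have "1 / s ^ degree (\<Prod>e\<in>edges k. A e ^ 2) = (\<Prod>e\<in>edges k. 1 / s ^ degree (A e ^ 2))"
    by (rule monic_prod_degree[symmetric]) (rule lcp)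
  also have "\<dots> = (\<Prod>e\<in>edges k. 1 / q ^ degree (A e))"
  proof (rule prod.cong[OF refl])
    fix e assume e: "e \<in> edges k"
    have "A e \<noteq> 0" using assms(1)[OF e] by force
    then show "1 / s ^ degree (A e ^ 2) = 1 / q ^ degree (A e)"
      by (simp add: degree_power_eq power_mult assms(2))
  qed
  finally show ?thesis .
qed

text \<open>In the pair decomposition of a square tuple the product of the \<open>G i\<close> is
  both squarefree and a square, so every \<open>G i\<close> is 1 and the tuple comes from edge
  labels \<open>A e\<close> of degree at most \<open>x\<close>. A tuple may arise repeatedly, which
  is harmless for an upper bound.\<close>

lemma square_tuples_upper:
  fixes s :: real
  assumes s: "s > 0" "s ^ 2 = real CARD('a::{field,finite})"
  shows "(\<Sum>F\<in>(square_tuples k x :: (nat \<Rightarrow> 'a poly) set). \<Prod>i<k. 1 / s ^ degree (F i)) \<le> real (x + 1) ^ card (edges k)"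
proof -
  let ?q = "real CARD('a)"
  let ?T = "\<lambda>A. restrict (\<lambda>i. \<Prod>e\<in>edges k. A e ^ inc i e) {..<k} :: nat \<Rightarrow> 'a poly"
  let ?B = "PiE (edges k) (\<lambda>_. monic_le x :: 'a poly set)"
  let ?w = "\<lambda>F :: nat \<Rightarrow> 'a poly. \<Prod>i<k. 1 / s ^ degree (F i)"
  have q0: "?q > 0" using card_field_ge_2[where 'a='a] by simp
  have sub: "square_tuples k x \<subseteq> ?T ` ?B"
  proof
    fix F :: "nat \<Rightarrow> 'a poly" assume F: "F \<in> square_tuples k x"
    then obtain w where FP: "F \<in> PiE {..<k} (\<lambda>_. monic_le x)" and w: "(\<Prod>i<k. F i) = w ^ 2"
      by (auto simp: square_tuples_def)
    have Fi: "lead_coeff (F i) = 1" "degree (F i) \<le> x" if "i \<in> {..<k}" for i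
      using PiE_mem[OF FP that] by (auto simp: monic_le_def)
    have "\<exists>G A. (\<forall>i\<in>{..<k}. lead_coeff (G i) = 1) \<and> (\<forall>e\<in>edges k. lead_coeff (A e) = 1) \<and>
      (\<forall>i\<in>{..<k}. F i = G i * (\<Prod>e\<in>edges k. A e ^ inc i e)) \<and> sqfree (\<Prod>i\<in>{..<k}. G i)"
      by (rule pair_decomposition) (auto simp: edges_def Fi)
    then obtain G A where G: "\<And>i. i \<in> {..<k} \<Longrightarrow> lead_coeff (G i) = 1"
      and A: "\<And>e. e \<in> edges k \<Longrightarrow> lead_coeff (A e) = 1"
      and FGA: "\<And>i. i \<in> {..<k} \<Longrightarrow> F i = G i * (\<Prod>e\<in>edges k. A e ^ inc i e)"
      and sq: "sqfree (\<Prod>i<k. G i)" by blast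
    have "(\<Prod>i<k. F i) = (\<Prod>i<k. G i) * (\<Prod>i<k. \<Prod>e\<in>edges k. A e ^ inc i e)"
      unfolding prod.distrib[symmetric] by (intro prod.cong refl FGA)
    also have "(\<Prod>i<k. \<Prod>e\<in>edges k. A e ^ inc i e) = (\<Prod>e\<in>edges k. A e ^ 2)"
      by (rule prod_power_inc) (auto simp: edges_subset)
    also have "\<dots> = (\<Prod>e\<in>edges k. A e) ^ 2" by (simp add: prod_power_distrib)
    finally have eq: "(\<Prod>i<k. G i) * (\<Prod>e\<in>edges k. A e) ^ 2 = w ^ 2" using w by simp
    have "lead_coeff (\<Prod>e\<in>edges k. A e) = 1" using A by (rule lead_coeff_prod_1)
    then have "(\<Prod>e\<in>edges k. A e) \<noteq> 0" by force
    with eq obtain v where v: "(\<Prod>i<k. G i) = v ^ 2" using square_cancel by blast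
    then have "degree v = 0" using sq sqfree_square_imp_const by metis
    then have "degree (\<Prod>i<k. G i) \<le> 0" unfolding v using degree_power_le[of v 2] by simp
    then have "(\<Sum>i<k. degree (G i)) = 0" using degree_prod_monic[of "{..<k}" G, OF G] by simp
    then have G1: "G i = 1" if "i \<in> {..<k}" for i
      using that G by (intro degree_zero_monic) auto
    have FA: "F i = (\<Prod>e\<in>edges k. A e ^ inc i e)" if "i \<in> {..<k}" for i
      using FGA[OF that] G1[OF that] by simp
    have "A e \<in> monic_le x" if e: "e \<in> edges k" for e
    proof -
      obtain a b where ab: "e = (a, b)" by fastforce
      have a: "a \<in> {..<k}" using e by (auto simp: ab edges_def)
      have "inc a e > 0" by (simp add: ab inc_def)
      then have "A e dvd A e ^ inc a e" by (simp add: dvd_power)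
      also have "A e ^ inc a e dvd F a"
        unfolding FA[OF a] using e by (intro dvd_prodI) auto
      finally have "degree (A e) \<le> degree (F a)" using Fi(1)[OF a] by (rule degree_le_if_dvd_monic)
      then show ?thesis using Fi(2)[OF a] A[OF e] by (simp add: monic_le_def)
    qed
    then have "restrict A (edges k) \<in> ?B" by auto
    moreover have "F = ?T (restrict A (edges k))"
    proof
      fix i
      show "F i = ?T (restrict A (edges k)) i"
      proof (cases "i \<in> {..<k}")
        case False
        then show ?thesis using PiE_arb[OF FP False] by simp
      qed (simp add: FA)
    qed
    ultimately show "F \<in> ?T ` ?B" by blast
  qed
  have nonneg: "0 \<le> ?w F" for F using s(1) by (intro prod_nonneg) auto
  have finB: "finite ?B" by (intro finite_PiE) auto
  have "(\<Sum>F\<in>square_tuples k x. ?w F) \<le> (\<Sum>F\<in>?T ` ?B. ?w F)"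
    using sub finB nonneg by (intro sum_mono2) auto
  also have "\<dots> \<le> (\<Sum>A\<in>?B. ?w (?T A))"
    using sum_image_le[OF finB, of ?w ?T] nonneg by (simp add: o_def)
  also have "\<dots> = (\<Sum>A\<in>?B. \<Prod>e\<in>edges k. 1 / ?q ^ degree (A e))"
  proof (rule sum.cong[OF refl])
    fix A assume A: "A \<in> ?B"
    have lcA: "lead_coeff (A e) = 1" if "e \<in> edges k" for e
      using PiE_mem[OF A that] by (simp add: monic_le_def)
    have "?w (?T A) = (\<Prod>i<k. 1 / s ^ degree (\<Prod>e\<in>edges k. A e ^ inc i e))"
      by (rule prod.cong) auto
    also have "\<dots> = (\<Prod>e\<in>edges k. 1 / ?q ^ degree (A e))"
      using lcA s(2) by (rule incidence_prod_degree)
    finally show "?w (?T A) = (\<Prod>e\<in>edges k. 1 / ?q ^ degree (A e))" .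
  qed
  also have "\<dots> = (\<Prod>e\<in>edges k. \<Sum>f\<in>(monic_le x :: 'a poly set). 1 / ?q ^ degree f)"
    by (rule prod_sum_PiE[symmetric]) auto
  also have "(\<Sum>f\<in>(monic_le x :: 'a poly set). 1 / ?q ^ degree f) = real (x + 1)"
    using q0 sum_monic_le_degree[where h = "\<lambda>d. 1 / ?q ^ d" and x = x and 'a = 'a] by simp
  finally show ?thesis by simp
qed

definition sqfree_tuples :: "'i set \<Rightarrow> nat \<Rightarrow> ('i \<Rightarrow> 'a::{field,finite} poly) set" where
  "sqfree_tuples I y = {g \<in> PiE I (\<lambda>_. monic_le y). sqfree (\<Prod>i\<in>I. g i)}"

lemma finite_sqfree_tuples [simp]: "finite I \<Longrightarrow> finite (sqfree_tuples I y)"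
  unfolding sqfree_tuples_def
  by (rule finite_subset[of _ "PiE I (\<lambda>_. monic_le y)"]) (auto intro: finite_PiE)

lemma sum_geometric_le_2:
  assumes "(q::real) \<ge> 2"
  shows "(\<Sum>d\<le>y. 1 / q ^ d) \<le> 2"
proof -
  have "(\<Sum>d\<le>y. 1 / q ^ d) \<le> (\<Sum>d\<le>y. (1 / 2) ^ d)"
    using assms by (intro sum_mono) (auto simp: power_one_over intro!: divide_left_mono power_mono)
  also have "\<dots> = 2 - (1 / 2) ^ y" by (induction y) auto
  also have "\<dots> \<le> 2" by simp
  finally show ?thesis .
qed

text \<open>In place of an Euler product, every tuple is covered by a squarefree one times pair
  factors. A pair factor \<open>A e\<close> carries the weight
  \<open>1 / q^(2 * degree (A e))\<close>, whose sum is at most 2, and there are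
  \<open>card I * card I\<close> ordered pairs.\<close>

lemma sqfree_tuples_lower:
  assumes I: "finite I"
  shows "real (y + 1) ^ card I \<le> 2 ^ (card I * card I) *
    (\<Sum>g\<in>(sqfree_tuples I y :: ('i \<Rightarrow> 'a::{field,finite} poly) set). \<Prod>i\<in>I. 1 / real CARD('a) ^ degree (g i))"
proof -
  let ?q = "real CARD('a)"
  let ?E = "I \<times> I"
  let ?G = "sqfree_tuples I y :: ('i \<Rightarrow> 'a poly) set"
  let ?A = "PiE ?E (\<lambda>_. monic_le y :: 'a poly set)"
  let ?B = "PiE I (\<lambda>_. monic_le y :: 'a poly set)"
  let ?T = "\<lambda>(g, A). restrict (\<lambda>i. g i * (\<Prod>e\<in>?E. A e ^ inc i e)) I :: 'i \<Rightarrow> 'a poly"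
  let ?w = "\<lambda>F :: 'i \<Rightarrow> 'a poly. \<Prod>i\<in>I. 1 / ?q ^ degree (F i)"
  have q2: "?q \<ge> 2" using card_field_ge_2[where 'a='a] by simp
  have sub: "?B \<subseteq> ?T ` (?G \<times> ?A)"
  proof
    fix F assume FP: "F \<in> ?B"
    have Fi: "lead_coeff (F i) = 1" "degree (F i) \<le> y" if "i \<in> I" for i
      using PiE_mem[OF FP that] by (auto simp: monic_le_def)
    have "\<exists>G A. (\<forall>i\<in>I. lead_coeff (G i) = 1) \<and> (\<forall>e\<in>?E. lead_coeff (A e) = 1) \<and>
      (\<forall>i\<in>I. F i = G i * (\<Prod>e\<in>?E. A e ^ inc i e)) \<and> sqfree (\<Prod>i\<in>I. G i)"
      by (rule pair_decomposition) (auto simp: Fi I)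
    then obtain G A where GA: "\<forall>i\<in>I. lead_coeff (G i) = 1" "\<forall>e\<in>?E. lead_coeff (A e) = 1"
      "\<forall>i\<in>I. F i = G i * (\<Prod>e\<in>?E. A e ^ inc i e)" and sq: "sqfree (\<Prod>i\<in>I. G i)"
      by (elim exE conjE)
    note G = bspec[OF GA(1)] and A = bspec[OF GA(2)] and FGA = bspec[OF GA(3)]
    have Gm: "G i \<in> monic_le y" if i: "i \<in> I" for i
    proof -
      have "G i dvd F i" unfolding FGA[OF i] by simp
      then have "degree (G i) \<le> degree (F i)" using Fi(1)[OF i] by (rule degree_le_if_dvd_monic)
      then show ?thesis using Fi(2)[OF i] G[OF i] by (simp add: monic_le_def)
    qed
    have Am: "A e \<in> monic_le y" if e: "e \<in> ?E" for e
    proof -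
      obtain a b where ab: "e = (a, b)" by fastforce
      have a: "a \<in> I" using e by (auto simp: ab)
      have "inc a e > 0" by (simp add: ab inc_def)
      then have "A e dvd A e ^ inc a e" by (simp add: dvd_power)
      also have "A e ^ inc a e dvd (\<Prod>e\<in>?E. A e ^ inc a e)"
        using e I by (intro dvd_prodI) auto
      also have "\<dots> dvd F a" unfolding FGA[OF a] by simp
      finally have "degree (A e) \<le> degree (F a)" using Fi(1)[OF a] by (rule degree_le_if_dvd_monic)
      then show ?thesis using Fi(2)[OF a] A[OF e] by (simp add: monic_le_def)
    qed
    have "restrict G I \<in> ?G" using Gm sq by (auto simp: sqfree_tuples_def)
    moreover have "restrict A ?E \<in> ?A" using Am by auto
    moreover have "F = ?T (restrict G I, restrict A ?E)"
    proof
      fix i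
      show "F i = ?T (restrict G I, restrict A ?E) i"
      proof (cases "i \<in> I")
        case False
        then show ?thesis using PiE_arb[OF FP False] by simp
      qed (simp add: FGA)
    qed
    ultimately show "F \<in> ?T ` (?G \<times> ?A)" by blast
  qed
  have nonneg: "0 \<le> ?w F" for F by (intro prod_nonneg) auto
  have finA: "finite ?A" using I by (intro finite_PiE) auto
  have fin: "finite (?G \<times> ?A)" using I finA by auto
  have "real (y + 1) ^ card I = (\<Prod>i\<in>I. \<Sum>f\<in>(monic_le y :: 'a poly set). 1 / ?q ^ degree f)"
    using q2 sum_monic_le_degree[where h = "\<lambda>d. 1 / ?q ^ d" and x = y and 'a = 'a] by simp
  also have "\<dots> = (\<Sum>F\<in>?B. ?w F)"
    using I by (intro prod_sum_PiE) auto
  also have "\<dots> \<le> (\<Sum>F\<in>?T ` (?G \<times> ?A). ?w F)"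
    using sub fin nonneg by (intro sum_mono2) auto
  also have "\<dots> \<le> (\<Sum>x\<in>?G \<times> ?A. ?w (?T x))"
    using sum_image_le[OF fin, of ?w ?T] nonneg by (simp add: o_def)
  also have "\<dots> = (\<Sum>x\<in>?G \<times> ?A. ?w (fst x) * (\<Prod>e\<in>?E. 1 / ?q ^ (2 * degree (snd x e))))"
  proof (rule sum.cong[OF refl])
    fix x assume "x \<in> ?G \<times> ?A"
    then obtain g A where x: "x = (g, A)" and g: "g \<in> ?G" and A: "A \<in> ?A" by blast
    have lcg: "lead_coeff (g i) = 1" if "i \<in> I" for i
      using g PiE_mem[of g I _ i] that by (auto simp: sqfree_tuples_def monic_le_def)
    have lcA: "lead_coeff (A e ^ m) = 1" if "e \<in> ?E" for e m
      using PiE_mem[OF A that] by (simp add: monic_le_def lead_coeff_power)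
    have lcp: "lead_coeff (\<Prod>e\<in>?E. A e ^ inc i e) = 1" for i
      by (intro lead_coeff_prod_1 lcA)
    have "?w (?T x) = (\<Prod>i\<in>I. (1 / ?q ^ degree (g i)) * (1 / ?q ^ degree (\<Prod>e\<in>?E. A e ^ inc i e)))"
    proof (rule prod.cong[OF refl])
      fix i assume i: "i \<in> I"
      have "g i \<noteq> 0" "(\<Prod>e\<in>?E. A e ^ inc i e) \<noteq> 0" using lcg[OF i] lcp[of i] by force+
      then have "degree (g i * (\<Prod>e\<in>?E. A e ^ inc i e)) = degree (g i) + degree (\<Prod>e\<in>?E. A e ^ inc i e)"
        by (rule degree_mult_eq)
      then show "1 / ?q ^ degree (?T x i) = (1 / ?q ^ degree (g i)) * (1 / ?q ^ degree (\<Prod>e\<in>?E. A e ^ inc i e))"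
        using i by (simp add: x power_add)
    qed
    also have "\<dots> = ?w g * (\<Prod>i\<in>I. 1 / ?q ^ degree (\<Prod>e\<in>?E. A e ^ inc i e))"
      by (rule prod.distrib)
    also have "(\<Prod>i\<in>I. 1 / ?q ^ degree (\<Prod>e\<in>?E. A e ^ inc i e)) = 1 / ?q ^ degree (\<Prod>i\<in>I. \<Prod>e\<in>?E. A e ^ inc i e)"
      by (rule monic_prod_degree) (rule lcp)
    also have "(\<Prod>i\<in>I. \<Prod>e\<in>?E. A e ^ inc i e) = (\<Prod>e\<in>?E. A e ^ 2)"
      using I by (rule prod_power_inc) auto
    also have "1 / ?q ^ degree (\<Prod>e\<in>?E. A e ^ 2) = (\<Prod>e\<in>?E. 1 / ?q ^ degree (A e ^ 2))"
      by (rule monic_prod_degree[symmetric]) (rule lcA)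
    also have "\<dots> = (\<Prod>e\<in>?E. 1 / ?q ^ (2 * degree (A e)))"
    proof (rule prod.cong[OF refl])
      fix e assume "e \<in> ?E"
      then have "A e \<noteq> 0" using lcA[of e 1] by force
      then show "1 / ?q ^ degree (A e ^ 2) = 1 / ?q ^ (2 * degree (A e))"
        by (simp add: degree_power_eq)
    qed
    finally show "?w (?T x) = ?w (fst x) * (\<Prod>e\<in>?E. 1 / ?q ^ (2 * degree (snd x e)))"
      by (simp add: x)
  qed
  also have "\<dots> = (\<Sum>g\<in>?G. ?w g) * (\<Sum>A\<in>?A. \<Prod>e\<in>?E. 1 / ?q ^ (2 * degree (A e)))"
    by (simp only: sum_product sum.cartesian_product) (simp add: case_prod_beta')
  also have "(\<Sum>A\<in>?A. \<Prod>e\<in>?E. 1 / ?q ^ (2 * degree (A e))) =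
      (\<Prod>e\<in>?E. \<Sum>f\<in>(monic_le y :: 'a poly set). 1 / ?q ^ (2 * degree f))"
    using I by (intro prod_sum_PiE[symmetric]) auto
  also have "(\<Sum>f\<in>(monic_le y :: 'a poly set). 1 / ?q ^ (2 * degree f)) = (\<Sum>d\<le>y. 1 / ?q ^ d)"
    using q2 sum_monic_le_degree[where h = "\<lambda>d. 1 / ?q ^ (2 * d)" and x = y and 'a = 'a]
    by (simp add: mult_2 power_add)
  also have "(\<Sum>g\<in>?G. ?w g) * (\<Prod>e\<in>?E. \<Sum>d\<le>y. 1 / ?q ^ d) \<le> (\<Sum>g\<in>?G. ?w g) * 2 ^ (card I * card I)"
  proof (intro mult_left_mono)
    have "(\<Prod>e\<in>?E. \<Sum>d\<le>y. 1 / ?q ^ d) \<le> (\<Prod>e\<in>?E. 2)"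
      using sum_geometric_le_2[OF q2] by (intro prod_mono) (auto intro: sum_nonneg)
    then show "(\<Prod>e\<in>?E. \<Sum>d\<le>y. 1 / ?q ^ d) \<le> 2 ^ (card I * card I)"
      by (simp add: card_cartesian_product)
    show "0 \<le> (\<Sum>g\<in>?G. ?w g)" by (intro sum_nonneg nonneg)
  qed
  finally show ?thesis by (simp add: mult.commute)
qed

text \<open>Edge labels with squarefree product inject into the square tuples. An entry is a product
  of at most \<open>card (edges k)\<close> labels with exponents at most 2, whence the condition
  relating \<open>x\<close> and \<open>y\<close>.\<close>

lemma square_tuples_lower:
  fixes s :: real
  assumes s: "s > 0" "s ^ 2 = real CARD('a::{field,finite})" and x: "2 * card (edges k) * y \<le> x"
  shows "real (y + 1) ^ card (edges k) \<le> 2 ^ (card (edges k) * card (edges k)) *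
    (\<Sum>F\<in>(square_tuples k x :: (nat \<Rightarrow> 'a poly) set). \<Prod>i<k. 1 / s ^ degree (F i))"
proof -
  let ?q = "real CARD('a)"
  let ?E = "edges k"
  let ?G = "sqfree_tuples ?E y :: (nat \<times> nat \<Rightarrow> 'a poly) set"
  let ?T = "\<lambda>A. restrict (\<lambda>i. \<Prod>e\<in>edges k. A e ^ inc i e) {..<k} :: nat \<Rightarrow> 'a poly"
  let ?w = "\<lambda>F :: nat \<Rightarrow> 'a poly. \<Prod>i<k. 1 / s ^ degree (F i)"
  have G: "lead_coeff (g e) = 1" "degree (g e) \<le> y" if "g \<in> ?G" "e \<in> ?E" for g e
    using that PiE_mem[of g ?E _ e] by (auto simp: sqfree_tuples_def monic_le_def)
  have inj: "inj_on ?T ?G"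
  proof (rule inj_onI)
    fix g g' assume g: "g \<in> ?G" and g': "g' \<in> ?G" and eq: "?T g = ?T g'"
    have eqi: "(\<Prod>e\<in>?E. g e ^ inc i e) = (\<Prod>e\<in>?E. g' e ^ inc i e)" if "i < k" for i
      using fun_cong[OF eq, of i] that by simp
    have sq: "sqfree (\<Prod>e\<in>?E. g e)" "sqfree (\<Prod>e\<in>?E. g' e)"
      using g g' by (auto simp: sqfree_tuples_def)
    have "g e = g' e" if e: "e \<in> ?E" for e
    proof (rule monic_dvd_antisym)
      show "g e dvd g' e" by (rule incidence_prod_dvd[OF sq G(1)[OF g] eqi e])
      show "g' e dvd g e" by (rule incidence_prod_dvd[OF sq(2,1) G(1)[OF g'] eqi[symmetric] e])
    qed (use G g g' e in auto)
    moreover have "g \<in> PiE ?E (\<lambda>_. monic_le y)" "g' \<in> PiE ?E (\<lambda>_. monic_le y)"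
      using g g' by (auto simp: sqfree_tuples_def)
    ultimately show "g = g'" by (intro PiE_ext)
  qed
  have into: "?T ` ?G \<subseteq> square_tuples k x"
  proof (rule image_subsetI)
    fix g assume g: "g \<in> ?G"
    have "(\<Prod>e\<in>?E. g e ^ inc i e) \<in> monic_le x" for i
    proof -
      have lcp: "lead_coeff (g e ^ m) = 1" if "e \<in> ?E" for e m
        using G(1)[OF g that] by (simp add: lead_coeff_power)
      have "degree (\<Prod>e\<in>?E. g e ^ inc i e) = (\<Sum>e\<in>?E. degree (g e ^ inc i e))"
        by (rule degree_prod_monic) (rule lcp)
      also have "\<dots> \<le> (\<Sum>e\<in>?E. 2 * y)"
      proof (rule sum_mono)
        fix e assume e: "e \<in> ?E"
        have "degree (g e ^ inc i e) \<le> degree (g e) * inc i e" by (rule degree_power_le)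
        also have "\<dots> \<le> y * 2" using G(2)[OF g e] by (intro mult_le_mono) (auto simp: inc_def)
        finally show "degree (g e ^ inc i e) \<le> 2 * y" by simp
      qed
      also have "\<dots> \<le> x" using x by (simp add: algebra_simps)
      finally show ?thesis using lead_coeff_prod_1[of ?E "\<lambda>e. g e ^ inc i e", OF lcp]
        by (simp add: monic_le_def)
    qed
    then have "?T g \<in> PiE {..<k} (\<lambda>_. monic_le x)" by auto
    moreover have "(\<Prod>i<k. ?T g i) = (\<Prod>e\<in>?E. g e) ^ 2"
    proof -
      have "(\<Prod>i<k. ?T g i) = (\<Prod>i<k. \<Prod>e\<in>?E. g e ^ inc i e)" by (rule prod.cong) auto
      also have "\<dots> = (\<Prod>e\<in>?E. g e ^ 2)" by (rule prod_power_inc) (auto simp: edges_subset)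
      finally show ?thesis by (simp add: prod_power_distrib)
    qed
    ultimately show "?T g \<in> square_tuples k x" by (auto simp: square_tuples_def)
  qed
  have nonneg: "0 \<le> ?w F" for F using s(1) by (intro prod_nonneg) auto
  have "(\<Sum>g\<in>?G. \<Prod>e\<in>?E. 1 / ?q ^ degree (g e)) = (\<Sum>g\<in>?G. ?w (?T g))"
  proof (rule sum.cong[OF refl])
    fix g assume g: "g \<in> ?G"
    have "?w (?T g) = (\<Prod>i<k. 1 / s ^ degree (\<Prod>e\<in>edges k. g e ^ inc i e))"
      by (rule prod.cong) auto
    also have "\<dots> = (\<Prod>e\<in>?E. 1 / ?q ^ degree (g e))"
      using G(1)[OF g] s(2) by (rule incidence_prod_degree)
    finally show "(\<Prod>e\<in>?E. 1 / ?q ^ degree (g e)) = ?w (?T g)" by simp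
  qed
  also have "\<dots> = (\<Sum>F\<in>?T ` ?G. ?w F)"
    using sum.reindex[OF inj, of ?w] by (simp add: o_def)
  also have "\<dots> \<le> (\<Sum>F\<in>square_tuples k x. ?w F)"
    using into nonneg by (intro sum_mono2) auto
  finally have "2 ^ (card ?E * card ?E) * (\<Sum>g\<in>?G. \<Prod>e\<in>?E. 1 / ?q ^ degree (g e)) \<le>
      2 ^ (card ?E * card ?E) * (\<Sum>F\<in>square_tuples k x. ?w F)"
    by (intro mult_left_mono) auto
  with sqfree_tuples_lower[OF finite_edges[of k], of y, where 'a = 'a] show ?thesis
    by (rule order.trans)
qed

section \<open>Moments of the central value\<close>

text \<open>Summed over \<open>P\<close>, this replaces Hoelder's inequality.\<close>
lemma even_power_tangent:
  fixes L B :: real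
  assumes "even k" "k > 0"
  shows "real k * B ^ (k - 1) * L - real (k - 1) * B ^ k \<le> L ^ k"
proof (cases "B = 0")
  case True
  have "k - 1 > 0" using assms by presburger
  then show ?thesis using True assms zero_le_even_power[OF assms(1), of L] by (simp add: power_0_left)
next
  case False
  have "1 + real k * (L / B - 1) \<le> (1 + (L / B - 1)) ^ k"
    using assms(1) by (rule Bernoulli_inequality_even)
  then have "(1 + real k * (L / B - 1)) * B ^ k \<le> (L / B) ^ k * B ^ k"
    using assms(1) by (intro mult_right_mono) (auto simp: zero_le_even_power)
  also have "(L / B) ^ k * B ^ k = L ^ k" using False by (simp add: power_divide)
  also have "(1 + real k * (L / B - 1)) * B ^ k = real k * B ^ (k - 1) * L - real (k - 1) * B ^ k"
  proof -
    have "B ^ k = B * B ^ (k - 1)" using assms(2) by (cases k) auto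
    then show ?thesis using False assms(2) by (simp add: field_simps of_nat_diff)
  qed
  finally show ?thesis .
qed

lemma card_monic_irred_deg_half:
  assumes g: "g \<ge> 1" and n: "n \<in> {2 * g + 1, 2 * g + 2}" and q: "CARD('a) \<ge> 4"
  shows "CARD('a) ^ n \<le> 2 * (n * card (monic_irred_deg n :: 'a::{field,finite} poly set))"
proof -
  let ?q = "CARD('a)"
  have "n > 0" using n by auto
  then have *: "?q ^ n \<le> n * card (monic_irred_deg n :: 'a poly set) + 2 * ?q ^ (n div 2)"
    by (rule card_monic_irred_deg_ge)
  have "?q ^ (n div 2) \<le> ?q ^ (g + 1)" using n q by (intro power_increasing) auto
  moreover have "4 * ?q ^ (g + 1) \<le> ?q ^ Suc (g + 1)" using mult_le_mono1[OF q, of "?q ^ (g + 1)"] by simp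
  moreover have "?q ^ Suc (g + 1) \<le> ?q ^ n" using n g q by (intro power_increasing) auto
  ultimately have "4 * ?q ^ (n div 2) \<le> ?q ^ n" by linarith
  with * show ?thesis by linarith
qed

text \<open>For a square the bound on the degree keeps every \<open>P\<close> from dividing the
  root, so there are no exceptional \<open>P\<close>. Otherwise the factor \<open>degree f\<close>
  of \<open>character_sum_bound\<close> is cancelled against \<open>n\<close>.\<close>

lemma character_average:
  fixes f :: "'a::{field,finite} poly"
  assumes odd: "odd CARD('a)" and q: "CARD('a) \<ge> 4" and g: "g \<ge> 1" and n: "n \<in> {2 * g + 1, 2 * g + 2}"
    and f: "lead_coeff f = 1" "degree f \<le> 2 * g"
  shows "\<bar>(\<Sum>P\<in>monic_irred_deg n. chi P f) -
    real (card (monic_irred_deg n :: 'a poly set)) * of_bool (\<exists>w. f = w ^ 2)\<bar> \<le> 7 * real CARD('a) ^ (g + 2)"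
proof (cases "\<exists>w. f = w ^ 2")
  case True
  then obtain w where w: "f = w ^ 2" by blast
  have "w \<noteq> 0" using f(1) w by auto
  then have deg: "degree w \<le> g" using f(2) w by (simp add: degree_power_eq)
  have "chi P f = 1" if "P \<in> monic_irred_deg n" for P
  proof -
    interpret prime_modulus P n using that by unfold_locales
    have "\<not> P dvd w" using deg n dvd_imp_degree_le[of P w] \<open>w \<noteq> 0\<close> by (auto simp: degP)
    then show ?thesis unfolding w by (rule chi_square)
  qed
  then have "(\<Sum>P\<in>monic_irred_deg n. chi P f) = real (card (monic_irred_deg n :: 'a poly set))"
    by simp
  then show ?thesis using True by simp
next
  case False
  have "2 * g \<le> 2 ^ (g + 1)" using less_exp[of g] by simp
  also have "(2::nat) ^ (g + 1) \<le> 2 ^ (2 * g)" using g by (intro power_increasing) auto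
  also have "\<dots> \<le> CARD('a) ^ g" using q by (auto simp: power_mult intro: power_mono)
  finally have "degree f \<le> CARD('a) ^ g" using f(2) by simp
  moreover have "f \<in> monic_deg (degree f)" using f(1) by (simp add: monic_deg_def)
  ultimately have *: "real n * \<bar>\<Sum>P\<in>monic_irred_deg n. chi P f\<bar> \<le> 7 * real (degree f) * real CARD('a) ^ (g + 2)"
    using False odd n by (intro character_sum_bound)
  have "real (degree f) \<le> real n" using f(2) n by auto
  then have "7 * real (degree f) * real CARD('a) ^ (g + 2) \<le> 7 * real n * real CARD('a) ^ (g + 2)"
    by (intro mult_right_mono) auto
  also have "7 * real n * real CARD('a) ^ (g + 2) = real n * (7 * real CARD('a) ^ (g + 2))" by simp
  finally have "real n * \<bar>\<Sum>P\<in>monic_irred_deg n. chi P f\<bar> \<le> real n * (7 * real CARD('a) ^ (g + 2))"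
    using * by linarith
  moreover have "real n > 0" using n by auto
  ultimately have "\<bar>\<Sum>P\<in>monic_irred_deg n. chi P f\<bar> \<le> 7 * real CARD('a) ^ (g + 2)"
    by (simp only: mult_le_cancel_left_pos)
  then show ?thesis using False by simp
qed

text \<open>The length and weights may vary with the factor, so that one expansion serves both the
  mean of \<open>A^k\<close> and that of \<open>L A^(k-1)\<close>.\<close>

lemma moment_expansion:
  fixes c :: "nat \<Rightarrow> nat \<Rightarrow> real"
  assumes odd: "odd CARD('a::{field,finite})" and q: "CARD('a) \<ge> 4" and g: "g \<ge> 1"
    and n: "n \<in> {2 * g + 1, 2 * g + 2}"
    and X: "(\<Sum>i<k. X i) \<le> 2 * g" and c: "\<And>i d. i < k \<Longrightarrow> d \<le> X i \<Longrightarrow> 0 \<le> c i d"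
  shows "\<bar>(\<Sum>P\<in>(monic_irred_deg n :: 'a poly set). \<Prod>i<k. \<Sum>f\<in>monic_le (X i). c i (degree f) * chi P f) -
     real (card (monic_irred_deg n :: 'a poly set)) *
     (\<Sum>F\<in>{F \<in> PiE {..<k} (\<lambda>i. monic_le (X i) :: 'a poly set). \<exists>w. (\<Prod>i<k. F i) = w ^ 2}. \<Prod>i<k. c i (degree (F i)))\<bar>
     \<le> 7 * real CARD('a) ^ (g + 2) * (\<Prod>i<k. \<Sum>f\<in>(monic_le (X i) :: 'a poly set). c i (degree f))"
proof -
  let ?N = "real (card (monic_irred_deg n :: 'a poly set))"
  let ?B = "7 * real CARD('a) ^ (g + 2)"
  let ?Pi = "PiE {..<k} (\<lambda>i. monic_le (X i) :: 'a poly set)"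
  let ?W = "\<lambda>F :: nat \<Rightarrow> 'a poly. \<Prod>i<k. c i (degree (F i))"
  let ?sq = "\<lambda>F :: nat \<Rightarrow> 'a poly. \<exists>w. (\<Prod>i<k. F i) = w ^ 2"
  let ?T = "\<lambda>F :: nat \<Rightarrow> 'a poly. \<Sum>P\<in>monic_irred_deg n. chi P (\<Prod>i<k. F i)"
  have fin: "finite ?Pi" by (intro finite_PiE) auto
  have "(\<Sum>P\<in>(monic_irred_deg n :: 'a poly set). \<Prod>i<k. \<Sum>f\<in>monic_le (X i). c i (degree f) * chi P f) =
    (\<Sum>P\<in>(monic_irred_deg n :: 'a poly set). \<Sum>F\<in>?Pi. ?W F * chi P (\<Prod>i<k. F i))"
  proof (rule sum.cong[OF refl])
    fix P :: "'a poly" assume "P \<in> monic_irred_deg n"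
    then interpret odd_prime_modulus P n using odd by unfold_locales
    have "(\<Prod>i<k. \<Sum>f\<in>monic_le (X i). c i (degree f) * chi P f) =
      (\<Sum>F\<in>?Pi. \<Prod>i<k. c i (degree (F i)) * chi P (F i))"
      by (rule prod_sum_PiE) auto
    then show "(\<Prod>i<k. \<Sum>f\<in>monic_le (X i). c i (degree f) * chi P f) =
      (\<Sum>F\<in>?Pi. ?W F * chi P (\<Prod>i<k. F i))"
      by (simp add: prod.distrib chi_prod)
  qed
  also have "\<dots> = (\<Sum>F\<in>?Pi. ?W F * ?T F)"
    by (subst sum.swap) (simp add: sum_distrib_left)
  finally have 1: "(\<Sum>P\<in>(monic_irred_deg n :: 'a poly set). \<Prod>i<k. \<Sum>f\<in>monic_le (X i). c i (degree f) * chi P f) =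
    (\<Sum>F\<in>?Pi. ?W F * ?T F)" .
  have "?N * (\<Sum>F\<in>{F \<in> ?Pi. ?sq F}. ?W F) = (\<Sum>F\<in>?Pi. ?W F * (?N * of_bool (?sq F)))"
  proof -
    have "(if b then p * r else 0) = r * (p * of_bool b)" for b and p r :: real by simp
    then show ?thesis unfolding sum_distrib_left by (simp only: sum.inter_filter[OF fin])
  qed
  with 1 have "\<bar>(\<Sum>P\<in>(monic_irred_deg n :: 'a poly set). \<Prod>i<k. \<Sum>f\<in>monic_le (X i). c i (degree f) * chi P f) -
      ?N * (\<Sum>F\<in>{F \<in> ?Pi. ?sq F}. ?W F)\<bar> = \<bar>\<Sum>F\<in>?Pi. ?W F * (?T F - ?N * of_bool (?sq F))\<bar>"
    by (simp only: right_diff_distrib sum_subtractf)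
  also have "\<dots> \<le> (\<Sum>F\<in>?Pi. \<bar>?W F * (?T F - ?N * of_bool (?sq F))\<bar>)"
    by (rule sum_abs)
  also have "\<dots> \<le> (\<Sum>F\<in>?Pi. ?W F * ?B)"
  proof (rule sum_mono)
    fix F assume F: "F \<in> ?Pi"
    have Fi: "lead_coeff (F i) = 1" "degree (F i) \<le> X i" if "i \<in> {..<k}" for i
      using PiE_mem[OF F that] by (auto simp: monic_le_def)
    have W: "0 \<le> ?W F" using Fi(2) c by (intro prod_nonneg) auto
    have "degree (\<Prod>i<k. F i) = (\<Sum>i<k. degree (F i))" by (rule degree_prod_monic) (rule Fi(1))
    also have "\<dots> \<le> (\<Sum>i<k. X i)" by (intro sum_mono Fi(2))
    finally have "degree (\<Prod>i<k. F i) \<le> 2 * g" using X by simp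
    moreover have "lead_coeff (\<Prod>i<k. F i) = 1" by (rule lead_coeff_prod_1) (rule Fi(1))
    ultimately have "\<bar>?T F - ?N * of_bool (?sq F)\<bar> \<le> ?B"
      by (intro character_average[OF odd q g n])
    then show "\<bar>?W F * (?T F - ?N * of_bool (?sq F))\<bar> \<le> ?W F * ?B"
      using W unfolding abs_mult by (intro mult_mono) auto
  qed
  also have "\<dots> = ?B * (\<Sum>F\<in>?Pi. ?W F)" by (simp add: sum_distrib_left mult.commute)
  also have "(\<Sum>F\<in>?Pi. ?W F) = (\<Prod>i<k. \<Sum>f\<in>(monic_le (X i) :: 'a poly set). c i (degree f))"
    by (rule prod_sum_PiE[symmetric]) auto
  finally show ?thesis .
qed

lemma sum_pow_le_real: "(s::real) \<ge> 2 \<Longrightarrow> (\<Sum>i\<le>x. s ^ i) \<le> 2 * s ^ x"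
proof (induction x)
  case (Suc x)
  then have "(\<Sum>i\<le>Suc x. s ^ i) \<le> 2 * s ^ x + s ^ Suc x" by simp
  also have "2 * s ^ x \<le> s * s ^ x" using Suc by (intro mult_right_mono) auto
  finally show ?case by simp
qed simp

text \<open>The factor \<open>4 * g + 4\<close> bounds \<open>2 * n\<close>, from the lower bound
  for the number of irreducibles; \<open>g - g div 2\<close> is what remains of the saving
  \<open>s^g\<close> once \<open>s^(k * x)\<close> is paid for.\<close>

lemma exponential_dominates:
  fixes C :: real
  obtains G where "\<And>g :: nat. g \<ge> G \<Longrightarrow> C * real (4 * g + 4) \<le> 2 ^ (g - g div 2)"
proof -
  have "(\<lambda>r. \<bar>C\<bar> * (8 * (real r / 2 ^ r) + 8 * (1 / 2 ^ r))) \<longlonglongrightarrow> \<bar>C\<bar> * (8 * 0 + 8 * 0)"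
    by (intro tendsto_intros lim_n_over_pown LIMSEQ_divide_realpow_zero) auto
  then have "(\<lambda>r. \<bar>C\<bar> * real (8 * r + 8) / 2 ^ r) \<longlonglongrightarrow> 0"
    by (simp add: add_divide_distrib algebra_simps)
  then have "eventually (\<lambda>r::nat. \<bar>C\<bar> * real (8 * r + 8) / 2 ^ r < 1) sequentially"
    by (rule order_tendstoD) simp
  then obtain R where R: "\<And>r. r \<ge> R \<Longrightarrow> \<bar>C\<bar> * real (8 * r + 8) / 2 ^ r < 1"
    by (auto simp: eventually_sequentially)
  show thesis
  proof (rule that[of "2 * R"])
    fix g :: nat assume g: "g \<ge> 2 * R"
    let ?r = "g div 2"
    have "\<bar>C\<bar> * real (8 * ?r + 8) / 2 ^ ?r < 1" using g by (intro R) simp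
    then have "\<bar>C\<bar> * real (8 * ?r + 8) \<le> 2 ^ ?r" by (simp add: field_simps)
    moreover have "C * real (4 * g + 4) \<le> \<bar>C\<bar> * real (8 * ?r + 8)"
    proof (rule mult_mono)
      have "4 * g + 4 \<le> 8 * ?r + 8" by linarith
      then show "real (4 * g + 4) \<le> real (8 * ?r + 8)" by (simp only: of_nat_le_iff)
    qed auto
    moreover have "(2::real) ^ ?r \<le> 2 ^ (g - ?r)" by (intro power_increasing) auto
    ultimately show "C * real (4 * g + 4) \<le> 2 ^ (g - ?r)" by linarith
  qed
qed

text \<open>Both error terms are at most \<open>B * 4 * 2 ^ k * s ^ (g + k * x)\<close> with \<open>B = 7 * s ^ (2 * g + 4)\<close>,
  against a main term of size \<open>s ^ (4 * g + 2) / (4 * g + 4)\<close>.\<close>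
lemma error_bound:
  fixes s :: real and N :: real
  assumes s: "s \<ge> 2" and N: "s ^ (2 * n) \<le> 2 * (real n * N)" and N0: "0 \<le> N"
    and n: "n \<in> {2 * g + 1, 2 * g + 2}" and x: "2 * (k * x) \<le> g" and \<epsilon>: "\<epsilon> > 0"
    and g: "28 * 2 ^ k * s ^ 2 / \<epsilon> * real (4 * g + 4) \<le> 2 ^ (g - g div 2)"
  shows "7 * s ^ (2 * (g + 2)) * (4 * 2 ^ k * s ^ (g + k * x)) \<le> \<epsilon> * N"
proof -
  have s0: "s > 0" using s by simp
  have kx: "k * x \<le> g div 2" using x by simp
  have "s ^ (4 * g + 2) \<le> s ^ (2 * n)" using s n by (intro power_increasing) auto
  also have "\<dots> \<le> 2 * (real n * N)" by (rule N)
  also have "\<dots> \<le> real (4 * g + 4) * N" using n N0 by (auto simp: algebra_simps intro: mult_right_mono)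
  finally have N1: "s ^ (4 * g + 2) \<le> real (4 * g + 4) * N" .
  have "7 * s ^ (2 * (g + 2)) * (4 * 2 ^ k * s ^ (g + k * x)) = 28 * 2 ^ k * s ^ (3 * g + 4 + k * x)"
  proof -
    have "2 * (g + 2) + (g + k * x) = 3 * g + 4 + k * x" by simp
    then have "s ^ (2 * (g + 2)) * s ^ (g + k * x) = s ^ (3 * g + 4 + k * x)"
      by (simp only: power_add[symmetric])
    then show ?thesis by simp
  qed
  also have "\<dots> \<le> 28 * 2 ^ k * s ^ (3 * g + 4 + g div 2)"
    using s kx by (intro mult_left_mono power_increasing) auto
  finally have 1: "7 * s ^ (2 * (g + 2)) * (4 * 2 ^ k * s ^ (g + k * x)) \<le> 28 * 2 ^ k * s ^ (3 * g + 4 + g div 2)" .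
  have "28 * 2 ^ k * s ^ 2 * real (4 * g + 4) \<le> \<epsilon> * 2 ^ (g - g div 2)"
    using g \<epsilon> by (simp add: field_simps)
  also have "\<dots> \<le> \<epsilon> * s ^ (g - g div 2)" using \<epsilon> s by (intro mult_left_mono power_mono) auto
  finally have 2: "28 * 2 ^ k * s ^ 2 * real (4 * g + 4) \<le> \<epsilon> * s ^ (g - g div 2)" .
  have e1: "(3 * g + 4 + g div 2) + (g - g div 2) = 2 + (4 * g + 2)" by simp
  have "(28 * 2 ^ k * s ^ (3 * g + 4 + g div 2)) * s ^ (g - g div 2) = 28 * 2 ^ k * s ^ 2 * s ^ (4 * g + 2)"
    unfolding mult.assoc power_add[symmetric] e1 by simp
  also have "\<dots> \<le> 28 * 2 ^ k * s ^ 2 * (real (4 * g + 4) * N)"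
    using N1 s0 by (intro mult_left_mono) auto
  also have "\<dots> = (28 * 2 ^ k * s ^ 2 * real (4 * g + 4)) * N" by simp
  also have "\<dots> \<le> (\<epsilon> * s ^ (g - g div 2)) * N" using 2 N0 by (rule mult_right_mono)
  finally have "(28 * 2 ^ k * s ^ (3 * g + 4 + g div 2)) * s ^ (g - g div 2) \<le> (\<epsilon> * N) * s ^ (g - g div 2)"
    by (simp only: mult_ac)
  then have "28 * 2 ^ k * s ^ (3 * g + 4 + g div 2) \<le> \<epsilon> * N"
    using s0 by (simp only: mult_le_cancel_right_pos zero_less_power)
  with 1 show ?thesis by linarith
qed

lemma moment_lower_bound:
  fixes k :: nat
  assumes q1: "CARD('a::{field,finite}) mod 4 = 1" and even: "even k" and k: "k > 0"
  shows "\<exists>c>0. \<exists>G. \<forall>g\<ge>G. \<forall>n\<in>{2 * g + 1, 2 * g + 2}.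
    c * real n ^ (k * (k + 1) div 2) * real (card (monic_irred_deg n :: 'a poly set))
      \<le> (\<Sum>P\<in>(monic_irred_deg n :: 'a poly set). L_half P ^ k)"
proof -
  let ?q = "CARD('a)"
  define K where "K = card (edges k)"
  define s where "s = sqrt (real ?q)"
  have K: "K = k * (k + 1) div 2" by (simp add: K_def card_edges)
  have odd: "odd ?q" using q1 by presburger
  have q4: "?q \<ge> 4" using q1 card_field_ge_2[where 'a='a] by presburger
  have k2: "k \<ge> 2" using even k by presburger
  have K1: "K \<ge> 1" using k by (cases k) (auto simp: K)
  have s2: "s \<ge> 2" using q4 by (auto simp: s_def intro: real_le_rsqrt)
  have s0: "s > 0" using s2 by simp
  have sq: "s ^ 2 = real ?q" by (simp add: s_def)
  \<comment> \<open>\<open>square_tuples_lower\<close> yields a main term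
    \<open>2 * c1 * Z^K\<close>, half of which may be lost to the error. \<open>c2\<close> is
    \<open>(2 * K)^K\<close>, from \<open>x + 1 <= 2 * K * Z\<close>, doubled to absorb the error in
    the upper bound. The ratio \<open>lam\<close> balances the two terms of the tangent
    inequality.\<close>
  define c1 :: real where "c1 = 1 / (2 * 2 ^ (K * K))"
  define c2 :: real where "c2 = 2 * real (2 * K) ^ K"
  define lam where "lam = c1 / c2"
  have c1: "c1 > 0" and c2: "c2 > 0" using K1 by (simp_all add: c1_def c2_def)
  then have lam: "lam > 0" by (simp add: lam_def)
  have c1_le: "c1 \<le> 1"
  proof -
    have "(1::real) \<le> 2 ^ (K * K)" by (rule one_le_power) simp
    then have "1 \<le> 2 * (2::real) ^ (K * K)" by linarith
    then show ?thesis by (simp add: c1_def)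
  qed
  obtain G0 where G0: "\<And>g :: nat. g \<ge> G0 \<Longrightarrow> 28 * 2 ^ k * s ^ 2 / c1 * real (4 * g + 4) \<le> 2 ^ (g - g div 2)"
    by (rule exponential_dominates[of "28 * 2 ^ k * s ^ 2 / c1"]) blast
  \<comment> \<open>The denominator comes from \<open>n <= 8 * k * K * Z\<close>, the loss in
    passing from \<open>n\<close> through \<open>x\<close> to \<open>y\<close>.\<close>
  define c where "c = lam ^ (k - 1) * c1 / real (8 * k * K) ^ K"
  have "c > 0" using lam c1 k K1 by (simp add: c_def)
  moreover have "c * real n ^ K * real (card (monic_irred_deg n :: 'a poly set))
      \<le> (\<Sum>P\<in>(monic_irred_deg n :: 'a poly set). L_half P ^ k)"
    if g: "g \<ge> max 1 G0" and n: "n \<in> {2 * g + 1, 2 * g + 2}" for g n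
  proof -
    have g1: "g \<ge> 1" and gG: "g \<ge> G0" using g by simp_all
    \<comment> \<open>This makes \<open>k * x\<close> at most \<open>g / 2\<close>, as
      \<open>error_bound\<close> requires; in particular
      \<open>g + (k - 1) * x <= 2 * g\<close>.\<close>
    define x where "x = g div (2 * k)"
    define y where "y = x div (2 * K)"
    define Z where "Z = real (y + 1)"
    let ?M = "monic_irred_deg n :: 'a poly set"
    define N where "N = real (card ?M)"
    have kx: "2 * (k * x) \<le> g" unfolding x_def using div_times_less_eq_dividend[of g "2 * k"] by (simp add: mult_ac)
    have "1 * x \<le> k * x" using k by (intro mult_le_mono1) simp
    then have xg: "x < g" using kx g1 by linarith
    have "x < 2 * K * (y + 1)"
      unfolding y_def using dividend_less_times_div[of "2 * K" x] K1 by simp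
    then have "x + 1 \<le> 2 * K * (y + 1)" by simp
    then have xZ: "real (x + 1) \<le> real (2 * K) * Z" unfolding Z_def of_nat_mult[symmetric] by (simp only: of_nat_le_iff)
    have "g < 2 * k * (x + 1)"
      unfolding x_def using dividend_less_times_div[of "2 * k" g] k by simp
    then have "n \<le> 4 * k * (x + 1)" using n by auto
    then have "real n \<le> real (4 * k) * real (x + 1)" unfolding of_nat_mult[symmetric] by (simp only: of_nat_le_iff)
    also have "\<dots> \<le> real (4 * k) * (real (2 * K) * Z)" using xZ by (intro mult_left_mono) auto
    finally have nZ: "real n \<le> real (8 * k * K) * Z" by simp
    have Z1: "Z \<ge> 1" by (simp add: Z_def)
    have ZK: "1 \<le> Z ^ K" using Z1 by (rule one_le_power)
    have N0: "0 \<le> N" by (simp add: N_def)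
    have "?q ^ n \<le> 2 * (n * card ?M)" by (rule card_monic_irred_deg_half[OF g1 n q4])
    then have "real (?q ^ n) \<le> real (2 * (n * card ?M))" by (simp only: of_nat_le_iff)
    then have N1: "s ^ (2 * n) \<le> 2 * (real n * N)"
      by (simp add: N_def power_mult sq)
    have err: "7 * s ^ (2 * (g + 2)) * (4 * 2 ^ k * s ^ (g + k * x)) \<le> c1 * N"
      by (rule error_bound[OF s2 N1 N0 n kx c1 G0[OF gG]])
    have B: "7 * real ?q ^ (g + 2) = 7 * s ^ (2 * (g + 2))" by (simp only: power_mult sq)
    have B0: "0 \<le> 7 * s ^ (2 * (g + 2))" using s0 by simp
    obtain w where w: "\<And>j. j \<le> g \<Longrightarrow> 0 \<le> w j \<and> w j \<le> 2 / s ^ j" "\<And>j. j < g \<Longrightarrow> 1 / s ^ j \<le> w j"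
      and L: "\<And>P :: 'a poly. P \<in> ?M \<Longrightarrow> L_half P = (\<Sum>j\<le>g. w j * (\<Sum>f\<in>monic_deg j. chi P f))"
      unfolding s_def by (rule L_half_short_sum[OF odd q4 n]) blast
    define A where "A = (\<lambda>P :: 'a poly. \<Sum>f\<in>monic_le x. 1 / s ^ degree f * chi P f)"
    have Lle: "L_half P = (\<Sum>f\<in>monic_le g. w (degree f) * chi P f)" if "P \<in> ?M" for P
      unfolding L[OF that] sum_monic_le sum_distrib_left
      by (intro sum.cong refl) (simp add: monic_degD(1))
    have sumA: "(\<Sum>f\<in>(monic_le x :: 'a poly set). 1 / s ^ degree f) \<le> 2 * s ^ x"
    proof -
      have "(\<Sum>f\<in>(monic_le x :: 'a poly set). 1 / s ^ degree f) = (\<Sum>d\<le>x. real ?q ^ d * (1 / s ^ d))"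
        by (rule sum_monic_le_degree)
      also have "\<dots> = (\<Sum>d\<le>x. s ^ d)"
        using s0 by (intro sum.cong refl) (simp add: sq[symmetric] power2_eq_square power_mult_distrib)
      also have "\<dots> \<le> 2 * s ^ x" using s2 by (rule sum_pow_le_real)
      finally show ?thesis .
    qed
    have sumA0: "0 \<le> (\<Sum>f\<in>(monic_le x :: 'a poly set). 1 / s ^ degree f)"
      using s0 by (intro sum_nonneg) auto
    have sumw: "(\<Sum>f\<in>(monic_le g :: 'a poly set). w (degree f)) \<le> 4 * s ^ g"
    proof -
      have "(\<Sum>f\<in>(monic_le g :: 'a poly set). w (degree f)) = (\<Sum>d\<le>g. real ?q ^ d * w d)"
        by (rule sum_monic_le_degree)
      also have "\<dots> \<le> (\<Sum>d\<le>g. real ?q ^ d * (2 / s ^ d))"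
        using w(1) by (intro sum_mono mult_left_mono) auto
      also have "\<dots> = 2 * (\<Sum>d\<le>g. s ^ d)"
        unfolding sum_distrib_left
        using s0 by (intro sum.cong refl) (simp add: sq[symmetric] power2_eq_square power_mult_distrib)
      also have "\<dots> \<le> 2 * (2 * s ^ g)" using sum_pow_le_real[OF s2] by (intro mult_left_mono) auto
      finally show ?thesis by simp
    qed
    let ?D = "\<Sum>F\<in>(square_tuples k x :: (nat \<Rightarrow> 'a poly) set). \<Prod>i<k. 1 / s ^ degree (F i)"

    have S2: "(\<Sum>P\<in>?M. A P ^ k) \<le> c2 * N * Z ^ K"
    proof -
      have "\<bar>(\<Sum>P\<in>?M. \<Prod>i<k. \<Sum>f\<in>monic_le x. 1 / s ^ degree f * chi P f) - N * ?D\<bar>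
         \<le> 7 * real ?q ^ (g + 2) * (\<Prod>i<k. \<Sum>f\<in>(monic_le x :: 'a poly set). 1 / s ^ degree f)"
        unfolding square_tuples_def N_def
        by (rule moment_expansion[OF odd q4 g1 n]) (use kx s0 in simp_all)
      moreover have "(\<Sum>P\<in>?M. \<Prod>i<k. \<Sum>f\<in>monic_le x. 1 / s ^ degree f * chi P f) = (\<Sum>P\<in>?M. A P ^ k)"
        by (simp add: A_def)
      moreover have "7 * real ?q ^ (g + 2) * (\<Prod>i<k. \<Sum>f\<in>(monic_le x :: 'a poly set). 1 / s ^ degree f) \<le> c1 * N"
      proof -
        have "(\<Prod>i<k. \<Sum>f\<in>(monic_le x :: 'a poly set). 1 / s ^ degree f) \<le> (2 * s ^ x) ^ k"
          using power_mono[OF sumA sumA0, of k] by (simp only: prod_constant card_lessThan)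
        also have "\<dots> = 2 ^ k * s ^ (k * x)" by (simp add: power_mult_distrib power_mult[symmetric] mult.commute)
        also have "\<dots> \<le> 2 ^ k * s ^ (g + k * x)" using s2 by (intro mult_left_mono power_increasing) auto
        also have "\<dots> \<le> 4 * 2 ^ k * s ^ (g + k * x)" using s0 by simp
        finally have "7 * s ^ (2 * (g + 2)) * (\<Prod>i<k. \<Sum>f\<in>(monic_le x :: 'a poly set). 1 / s ^ degree f)
          \<le> 7 * s ^ (2 * (g + 2)) * (4 * 2 ^ k * s ^ (g + k * x))"
          using B0 by (rule mult_left_mono)
        then show ?thesis using err unfolding B by linarith
      qed
      ultimately have "(\<Sum>P\<in>?M. A P ^ k) \<le> N * ?D + c1 * N" by linarith
      also have "\<dots> \<le> N * (real (2 * K) * Z) ^ K + 1 * N"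
      proof (intro add_mono mult_left_mono mult_right_mono)
        have "?D \<le> real (x + 1) ^ K" unfolding K_def by (rule square_tuples_upper[OF s0 sq])
        also have "\<dots> \<le> (real (2 * K) * Z) ^ K" using xZ by (intro power_mono) auto
        finally show "?D \<le> (real (2 * K) * Z) ^ K" .
      qed (use N0 c1_le in auto)
      also have "\<dots> \<le> N * (real (2 * K) * Z) ^ K + (real (2 * K) * Z) ^ K * N"
      proof (intro add_left_mono mult_right_mono)
        have "1 * 1 \<le> real (2 * K) * Z" using K1 Z1 by (intro mult_mono) auto
        then show "1 \<le> (real (2 * K) * Z) ^ K" by (intro one_le_power) simp
      qed (rule N0)
      also have "\<dots> = c2 * N * Z ^ K" by (simp add: c2_def power_mult_distrib)
      finally show ?thesis .
    qed

    have S1: "c1 * N * Z ^ K \<le> (\<Sum>P\<in>?M. L_half P * A P ^ (k - 1))"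
    proof -
      \<comment> \<open>Index 0 stands for \<open>L\<close>, of length \<open>g\<close> with the
        weights \<open>w\<close>; the other \<open>k - 1\<close> indices stand for copies of
        \<open>A\<close>.\<close>
      define X where "X = (\<lambda>i::nat. if i = 0 then g else x)"
      define v where "v = (\<lambda>(i::nat) d. if i = 0 then w d else 1 / s ^ d)"
      obtain k' where k': "k = Suc k'" using k by (cases k) auto
      have v0: "0 \<le> v i d" if "d \<le> X i" for i d
        using that w(1)[of d] s0 by (auto simp: v_def X_def)
      have sumX: "(\<Sum>i<k. X i) \<le> 2 * g"
      proof -
        have "(\<Sum>i<k. X i) = g + k' * x" unfolding k' sum.lessThan_Suc_shift X_def by simp
        moreover have "k' * x \<le> k * x" by (simp add: k')
        ultimately show ?thesis using kx by linarith
      qed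
      let ?D' = "\<Sum>F\<in>{F \<in> PiE {..<k} (\<lambda>i. monic_le (X i) :: 'a poly set). \<exists>w. (\<Prod>i<k. F i) = w ^ 2}. \<Prod>i<k. v i (degree (F i))"
      let ?S = "\<Sum>P\<in>?M. \<Prod>i<k. \<Sum>f\<in>monic_le (X i). v i (degree f) * chi P f"
      have main: "\<bar>?S - N * ?D'\<bar> \<le> 7 * real ?q ^ (g + 2) * (\<Prod>i<k. \<Sum>f\<in>(monic_le (X i) :: 'a poly set). v i (degree f))"
        unfolding N_def by (rule moment_expansion[OF odd q4 g1 n sumX v0])
      have S: "?S = (\<Sum>P\<in>?M. L_half P * A P ^ (k - 1))"
        unfolding k' prod.lessThan_Suc_shift X_def v_def A_def
        by (intro sum.cong refl) (simp add: Lle)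
      have "(\<Prod>i<k. \<Sum>f\<in>(monic_le (X i) :: 'a poly set). v i (degree f)) =
        (\<Sum>f\<in>(monic_le g :: 'a poly set). w (degree f)) * (\<Sum>f\<in>(monic_le x :: 'a poly set). 1 / s ^ degree f) ^ k'"
        unfolding k' prod.lessThan_Suc_shift X_def v_def by simp
      also have "\<dots> \<le> (4 * s ^ g) * (2 * s ^ x) ^ k'"
        using sumA sumA0 sumw s0 by (intro mult_mono power_mono) auto
      also have "\<dots> = 4 * 2 ^ k' * s ^ (g + k' * x)"
        by (simp add: power_mult_distrib power_mult[symmetric] power_add mult.commute)
      also have "\<dots> \<le> 4 * 2 ^ k * s ^ (g + k * x)"
        using s2 by (intro mult_mono power_increasing) (auto simp: k')
      finally have "7 * s ^ (2 * (g + 2)) * (\<Prod>i<k. \<Sum>f\<in>(monic_le (X i) :: 'a poly set). v i (degree f))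
          \<le> 7 * s ^ (2 * (g + 2)) * (4 * 2 ^ k * s ^ (g + k * x))"
        using B0 by (rule mult_left_mono)
      then have lower: "N * ?D' - c1 * N \<le> (\<Sum>P\<in>?M. L_half P * A P ^ (k - 1))"
        using main err unfolding S B by linarith
      \<comment> \<open>All weights are nonnegative, so tuples whose entry 0 has degree above
        \<open>x\<close> may be discarded; for the others \<open>x < g\<close> makes
        \<open>w\<close> at least the weight \<open>1 / s^j\<close>.\<close>
      have "?D \<le> ?D'"
      proof -
        have "?D \<le> (\<Sum>F\<in>(square_tuples k x :: (nat \<Rightarrow> 'a poly) set). \<Prod>i<k. v i (degree (F i)))"
        proof (intro sum_mono prod_mono conjI)
          fix F :: "nat \<Rightarrow> 'a poly" and i
          assume F: "F \<in> square_tuples k x" and i: "i \<in> {..<k}"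
          then have "F i \<in> monic_le x" by (auto simp: square_tuples_def)
          then have "degree (F i) < g" using xg by (auto simp: monic_le_def)
          then show "1 / s ^ degree (F i) \<le> v i (degree (F i))" using w(2)[of "degree (F i)"]
            by (cases "i = 0") (simp_all add: v_def)
        qed (use s0 in auto)
        also have "\<dots> \<le> ?D'"
        proof (rule sum_mono2)
          show "finite {F \<in> PiE {..<k} (\<lambda>i. monic_le (X i) :: 'a poly set). \<exists>w. (\<Prod>i<k. F i) = w ^ 2}"
            by (rule finite_subset[of _ "PiE {..<k} (\<lambda>i. monic_le (X i))"]) (auto intro: finite_PiE)
          have "monic_le x \<subseteq> (monic_le (X i) :: 'a poly set)" for i
            using xg by (auto simp: monic_le_def X_def)
          then show "square_tuples k x \<subseteq> {F \<in> PiE {..<k} (\<lambda>i. monic_le (X i) :: 'a poly set). \<exists>w. (\<Prod>i<k. F i) = w ^ 2}"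
            unfolding square_tuples_def using PiE_mono[of "{..<k}" "\<lambda>_. monic_le x" "\<lambda>i. monic_le (X i)"] by blast
          fix F assume "F \<in> {F \<in> PiE {..<k} (\<lambda>i. monic_le (X i) :: 'a poly set). \<exists>w. (\<Prod>i<k. F i) = w ^ 2} - square_tuples k x"
          then have F: "F \<in> PiE {..<k} (\<lambda>i. monic_le (X i))" by simp
          show "0 \<le> (\<Prod>i<k. v i (degree (F i)))"
          proof (rule prod_nonneg)
            fix i assume "i \<in> {..<k}"
            from PiE_mem[OF F this] show "0 \<le> v i (degree (F i))" by (intro v0) (simp add: monic_le_def)
          qed
        qed
        finally show ?thesis .
      qed
      moreover have "Z ^ K \<le> 2 ^ (K * K) * ?D"
        unfolding Z_def K_def using square_tuples_lower[OF s0 sq, of k y x]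
        by (simp add: y_def K_def mult.commute)
      then have "2 * c1 * Z ^ K \<le> ?D" by (simp add: c1_def field_simps)
      ultimately have "N * (2 * c1 * Z ^ K) \<le> N * ?D'" using N0 by (intro mult_left_mono) auto
      moreover have "c1 * N \<le> c1 * N * Z ^ K"
        using c1 N0 ZK mult_left_mono[of 1 "Z ^ K" "c1 * N"] by simp
      ultimately have "c1 * N * Z ^ K \<le> N * ?D' - c1 * N" by (simp add: algebra_simps)
      then show ?thesis using lower by linarith
    qed

    \<comment> \<open>The tangent inequality is used with \<open>B = lam * A P\<close>. By the
      choice of \<open>lam\<close> the subtracted term is at most \<open>k - 1\<close> copies of
      \<open>c1 * N * Z^K\<close>, against at least \<open>k\<close> copies in the first, so one
      copy survives.\<close>
    have "lam ^ (k - 1) * (c1 * N * Z ^ K) \<le>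
      lam ^ (k - 1) * (real k * (\<Sum>P\<in>?M. L_half P * A P ^ (k - 1)) - real (k - 1) * lam * (\<Sum>P\<in>?M. A P ^ k))"
    proof (rule mult_left_mono)
      have "real (k - 1) * lam * (\<Sum>P\<in>?M. A P ^ k) \<le> real (k - 1) * lam * (c2 * N * Z ^ K)"
        using S2 lam by (intro mult_left_mono) auto
      also have "\<dots> = real (k - 1) * (c1 * N * Z ^ K)" using c2 by (simp add: lam_def)
      also have "\<dots> = real k * (c1 * N * Z ^ K) - c1 * N * Z ^ K"
        using k by (simp add: of_nat_diff algebra_simps)
      also have "\<dots> \<le> real k * (\<Sum>P\<in>?M. L_half P * A P ^ (k - 1)) - c1 * N * Z ^ K"
        using S1 by (intro diff_right_mono mult_left_mono) auto
      finally show "c1 * N * Z ^ K \<le> real k * (\<Sum>P\<in>?M. L_half P * A P ^ (k - 1)) - real (k - 1) * lam * (\<Sum>P\<in>?M. A P ^ k)"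
        by linarith
    qed (use lam in auto)
    also have "\<dots> = (\<Sum>P\<in>?M. real k * (lam * A P) ^ (k - 1) * L_half P - real (k - 1) * (lam * A P) ^ k)"
    proof -
      have "lam ^ k = lam ^ (k - 1) * lam" using k by (cases k) auto
      then show ?thesis
        by (simp add: right_diff_distrib sum_distrib_left sum_subtractf power_mult_distrib mult_ac)
    qed
    also have "\<dots> \<le> (\<Sum>P\<in>?M. L_half P ^ k)"
      by (intro sum_mono even_power_tangent even k)
    finally have final: "lam ^ (k - 1) * (c1 * N * Z ^ K) \<le> (\<Sum>P\<in>?M. L_half P ^ k)" .
    have pos: "0 < real (8 * k * K) ^ K" using k K1 by simp
    have "real n ^ K \<le> (real (8 * k * K) * Z) ^ K" using nZ by (rule power_mono) simp
    then have "real n ^ K / real (8 * k * K) ^ K \<le> Z ^ K"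
      using pos by (simp add: power_mult_distrib field_simps)
    then have "(lam ^ (k - 1) * c1 * N) * (real n ^ K / real (8 * k * K) ^ K) \<le> (lam ^ (k - 1) * c1 * N) * Z ^ K"
      using lam c1 N0 by (intro mult_left_mono) auto
    then have "c * real n ^ K * N \<le> lam ^ (k - 1) * (c1 * N * Z ^ K)" by (simp add: c_def mult_ac)
    then show ?thesis using final by (simp add: N_def)
  qed
  ultimately show ?thesis unfolding K[symmetric] by blast
qed

theorem theorem1p1:
  fixes k :: nat
  assumes "card (UNIV :: 'a::{field,finite} set) mod 4 = 1"
    and "even k"
  shows "\<exists>c>0. \<exists>G. \<forall>g\<ge>G. \<forall>n\<in>{2*g+1, 2*g+2}.
           (1 / real (card (monic_irred_deg n :: 'a poly set))) *
             (\<Sum>P\<in>(monic_irred_deg n :: 'a poly set). L_half P ^ k)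
           \<ge> c * real n ^ (k * (k + 1) div 2)"
proof -
  have q4: "CARD('a) \<ge> 4" using assms(1) card_field_ge_2[where 'a='a] by presburger
  have card: "real (card (monic_irred_deg n :: 'a poly set)) > 0"
    if "g \<ge> 1" "n \<in> {2 * g + 1, 2 * g + 2}" for g n
  proof -
    have "CARD('a) ^ n > 0" using q4 by simp
    then show ?thesis using card_monic_irred_deg_half[OF that q4] by (cases "card (monic_irred_deg n :: 'a poly set) = 0") auto
  qed
  show ?thesis
  proof (cases "k = 0")
    case True
    show ?thesis
    \<comment> \<open>Here the mean is 1; \<open>g >= 1\<close> is imposed so that there are
      irreducibles to divide by.\<close>
    proof (intro exI[of _ 1] conjI exI[of _ 1] allI impI ballI)
      fix g n :: nat assume g: "1 \<le> g" "n \<in> {2 * g + 1, 2 * g + 2}"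
      then have "monic_irred_deg n \<noteq> ({} :: 'a poly set)" using card[OF g] by auto
      then show "1 / real (card (monic_irred_deg n :: 'a poly set)) *
        (\<Sum>P\<in>(monic_irred_deg n :: 'a poly set). L_half P ^ k) \<ge> 1 * real n ^ (k * (k + 1) div 2)"
        using True by simp
    qed simp
  next
    case False
    then obtain c G where c: "c > 0" and G: "\<And>g n. g \<ge> G \<Longrightarrow> n \<in> {2 * g + 1, 2 * g + 2} \<Longrightarrow>
      c * real n ^ (k * (k + 1) div 2) * real (card (monic_irred_deg n :: 'a poly set))
        \<le> (\<Sum>P\<in>(monic_irred_deg n :: 'a poly set). L_half P ^ k)"
      using moment_lower_bound[OF assms] by blast
    show ?thesis
    proof (intro exI[of _ c] conjI exI[of _ "max 1 G"] allI impI ballI)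
      fix g n :: nat assume g: "max 1 G \<le> g" "n \<in> {2 * g + 1, 2 * g + 2}"
      then have "g \<ge> 1" "g \<ge> G" by simp_all
      then show "1 / real (card (monic_irred_deg n :: 'a poly set)) *
        (\<Sum>P\<in>(monic_irred_deg n :: 'a poly set). L_half P ^ k) \<ge> c * real n ^ (k * (k + 1) div 2)"
        using G[OF \<open>g \<ge> G\<close> g(2)] card[OF \<open>g \<ge> 1\<close> g(2)] by (simp add: field_simps)
    qed (rule c)
  qed
qed

end
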